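(* Let $X=\partial_x-\frac y2\partial_z$ and $Y=\partial_y+\frac x2\partial_z$ be the Heisenberg vector fields on $\mathbb R^3$, with $Z=[X,Y]=\partial_z$, and let $H_i\in C^1(\mathbb R^m)$, $1\le i\le m$. Suppose that $u=(u_i)_{i=1}^m\in C^2(\mathbb R^3,\mathbb R^m)$ is a stable solution of the symmetric system $$X(Xu_i)+Y(Yu_i)=H_i(u_1,\dots,u_m)\quad\text{in }\mathbb R^3,\qquad1\le i\le m,$$ satisfying, for each $i$, $$ZYu_i\,Xu_i-ZXu_i\,Yu_i\le0 .$$ In addition, assume that there is a constant $C$ such that $$\int_{B_R}(x^2+y^2)|\nabla_{\mathbb H}u_i|^2\,dx\,dy\,dz\le CR^4\quad\text{for all }R>1\text{ and }1\le i\le m,$$ where $B_R=\{(x,y,z)\in\mathbb R^3:\ |x^2+y^2|^2+z^2<R^4\}$. Then, for every $i$, $\mathcal A_i\equiv0$ (the intrinsic curvature of the level sets of $u_i$ vanishes identically) and $\mathcal B_i\equiv0$ on $\{|\nabla_{\mathbb H}u_i|\neq0\}$.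
   Context: $\nabla_{\mathbb H}v:=(Xv)X+(Yv)Y$, $|\nabla_{\mathbb H}v|=\sqrt{(Xv)^2+(Yv)^2}$. For $\zeta=\zeta_1X+\zeta_2Y$, $\theta=\theta_1X+\theta_2Y$ (identified with coefficient pairs): $\operatorname{div}_{XY}(\zeta)=X\zeta_1+Y\zeta_2$, $\langle\zeta,\theta\rangle_{XY}=\zeta_1\theta_1+\zeta_2\theta_2$. On $\{|\nabla_{\mathbb H}u_i|\ne0\}$ set $$\eta_i=|\nabla_{\mathbb H}u_i|^{-1}[(Xu_i)X+(Yu_i)Y],\quad \tau_i=|\nabla_{\mathbb H}u_i|^{-1}[(Yu_i)X-(Xu_i)Y],$$ $$\mathcal A_i=\operatorname{div}_{XY}(\eta_i),\quad \mathcal B_i=|\nabla_{\mathbb H}u_i|^{-1}\left[-Zu_i+\langle H_{ess}u_i\,\tau_i,\eta_i\rangle_{XY}\right],\quad H_{ess}u_i=\begin{bmatrix} XXu_i & YXu_i \\ XYu_i & YYu_i \end{bmatrix}.$$ The system is called symmetric if the matrix $(\partial_iH_j(u))_{i,j=1}^m$ is symmetric. A solution $u$ is called stable if $-\sum_{i,j=1}^m\int_{\mathbb R^3}\partial_iH_j(u)\zeta_i\zeta_j\le\sum_{i=1}^m\int_{\mathbb R^3}|\nabla_{\mathbb H}\zeta_i|^2$ for all $\zeta_i\in C_c^1(\mathbb R^3)$, $1\le i\le m$. *)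

theory Defs
  imports "HOL-Analysis.Analysis"
begin

definition pd :: "'n::finite \<Rightarrow> (real^'n \<Rightarrow> real) \<Rightarrow> real^'n \<Rightarrow> real" where
  "pd k f p = deriv (\<lambda>t. f (p + t *\<^sub>R axis k 1)) 0"

text \<open>\<open>Ck k f\<close>: \<open>f\<close> is of class \<open>C\<^sup>k\<close> on the whole space.\<close>

primrec Ck :: "nat \<Rightarrow> (real^'n::finite \<Rightarrow> real) \<Rightarrow> bool" where
  "Ck 0 f \<longleftrightarrow> continuous_on UNIV f"
| "Ck (Suc k) f \<longleftrightarrow> f differentiable_on UNIV \<and> (\<forall>i. Ck k (pd i f))"

definition Cc1 :: "(real^'n::finite \<Rightarrow> real) \<Rightarrow> bool" where
  "Cc1 f \<longleftrightarrow> Ck 1 f \<and> compact (closure {p. f p \<noteq> 0})"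

text \<open>
  A point of the Heisenberg group is \<open>p = (x, y, z) = (p $ 1, p $ 2, p $ 3)\<close>.  Horizontal vector
  fields \<open>\<zeta>\<^sub>1 X + \<zeta>\<^sub>2 Y\<close> are represented by their coefficient pairs in \<open>real^2\<close>, so
  that the pairing \<open>\<langle>\<zeta>, \<theta>\<rangle>\<close> with respect to \<open>X, Y\<close> is the standard inner product
  and its norm the standard norm.
\<close>

definition XH :: "(real^3 \<Rightarrow> real) \<Rightarrow> real^3 \<Rightarrow> real" where
  "XH v p = pd 1 v p - p $ 2 / 2 * pd 3 v p"

definition YH :: "(real^3 \<Rightarrow> real) \<Rightarrow> real^3 \<Rightarrow> real" where
  "YH v p = pd 2 v p + p $ 1 / 2 * pd 3 v p"

text \<open>
  The commutator \<open>[X, Y]\<close> equals \<open>\<partial>\<^sub>z\<close>; it is taken as the first-order operator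
  \<open>\<partial>\<^sub>z\<close> since it is also applied to functions that are only \<open>C\<^sup>1\<close>.
\<close>

definition ZH :: "(real^3 \<Rightarrow> real) \<Rightarrow> real^3 \<Rightarrow> real" where
  "ZH v = pd 3 v"

definition gradH :: "(real^3 \<Rightarrow> real) \<Rightarrow> real^3 \<Rightarrow> real^2" where
  "gradH v p = vector [XH v p, YH v p]"

definition divXY :: "(real^3 \<Rightarrow> real^2) \<Rightarrow> real^3 \<Rightarrow> real" where
  "divXY \<zeta> p = XH (\<lambda>q. \<zeta> q $ 1) p + YH (\<lambda>q. \<zeta> q $ 2) p"

text \<open>In the matrix below \<open>YXv\<close> means \<open>Y(Xv)\<close>; rows are listed first.\<close>

definition HessH :: "(real^3 \<Rightarrow> real) \<Rightarrow> real^3 \<Rightarrow> real^2^2" where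
  "HessH v p = vector [vector [XH (XH v) p, YH (XH v) p],
                       vector [XH (YH v) p, YH (YH v) p]]"

text \<open>
  The next four are meaningful only where \<open>gradH v p \<noteq> 0\<close>.
\<close>

definition etaH :: "(real^3 \<Rightarrow> real) \<Rightarrow> real^3 \<Rightarrow> real^2" where
  "etaH v p = (1 / norm (gradH v p)) *\<^sub>R vector [XH v p, YH v p]"

definition tauH :: "(real^3 \<Rightarrow> real) \<Rightarrow> real^3 \<Rightarrow> real^2" where
  "tauH v p = (1 / norm (gradH v p)) *\<^sub>R vector [YH v p, - XH v p]"

definition curvA :: "(real^3 \<Rightarrow> real) \<Rightarrow> real^3 \<Rightarrow> real" where
  "curvA v p = divXY (etaH v) p"

definition curvB :: "(real^3 \<Rightarrow> real) \<Rightarrow> real^3 \<Rightarrow> real" where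
  "curvB v p = (1 / norm (gradH v p)) *
     (- ZH v p + (HessH v p *v tauH v p) \<bullet> etaH v p)"

definition ballH :: "real \<Rightarrow> (real^3) set" where
  "ballH R = {p. \<bar>(p $ 1)\<^sup>2 + (p $ 2)\<^sup>2\<bar>\<^sup>2 + (p $ 3)\<^sup>2 < R ^ 4}"

definition solutionH ::
  "('m \<Rightarrow> real^'m \<Rightarrow> real) \<Rightarrow> (real^3 \<Rightarrow> real^'m::finite) \<Rightarrow> bool" where
  "solutionH H u \<longleftrightarrow>
     (\<forall>i p. XH (XH (\<lambda>q. u q $ i)) p + YH (YH (\<lambda>q. u q $ i)) p = H i (u p))"

definition symmetric_system ::
  "('m \<Rightarrow> real^'m \<Rightarrow> real) \<Rightarrow> (real^3 \<Rightarrow> real^'m::finite) \<Rightarrow> bool" where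
  "symmetric_system H u \<longleftrightarrow> (\<forall>p i j. pd i (H j) (u p) = pd j (H i) (u p))"

definition stableH ::
  "('m \<Rightarrow> real^'m \<Rightarrow> real) \<Rightarrow> (real^3 \<Rightarrow> real^'m::finite) \<Rightarrow> bool" where
  "stableH H u \<longleftrightarrow>
     (\<forall>\<zeta> :: 'm \<Rightarrow> real^3 \<Rightarrow> real. (\<forall>i. Cc1 (\<zeta> i)) \<longrightarrow>
        - (\<Sum>i\<in>UNIV. \<Sum>j\<in>UNIV. LINT p|lborel. pd i (H j) (u p) * \<zeta> i p * \<zeta> j p)
          \<le> (\<Sum>i\<in>UNIV. LINT p|lborel. (norm (gradH (\<zeta> i) p))\<^sup>2))"

end

theory Submission
  imports Defs
begin

text \<open>
  Write \<open>a = Xu\<close>, \<open>b = Yu\<close> (vector valued).  Both solve the linearised system up to the commutator terms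
  \<open>2 Zb\<close> and \<open>-2 Za\<close>, so testing stability with \<open>\<phi>a\<close> and \<open>\<phi>b\<close> and adding gives, by the sign condition, the bound
  \<open>\<integral> \<bar>\<nabla>u\<bar>\<^sup>2 \<bar>\<nabla>\<phi>\<bar>\<^sup>2\<close>, which the growth condition makes arbitrarily small for logarithmic cutoffs.
  Cauchy-Schwarz for the nonnegative form then puts \<open>a\<close> and \<open>b\<close> into its kernel, hence \<open>Za = Zb = 0\<close> and
  \<open>Zu = c\<close> is constant.

  Next use the test fields \<open>\<phi>(cos(\<lambda>z) a + sin(\<lambda>z) b)\<close> and \<open>\<phi>(cos(\<lambda>z) b - sin(\<lambda>z) a)\<close> with \<open>\<lambda> = R\<^sup>-\<^sup>2\<close> at scale
  \<open>R\<close>: the term linear in \<open>\<lambda>\<close> is \<open>-\<lambda> \<integral> \<phi>\<^sup>2 (\<bar>\<nabla>u\<bar>\<^sup>2 + c\<^sup>2 (x\<^sup>2 + y\<^sup>2))\<close> up to a boundary term, and everything else is at most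
  a multiple of \<open>R\<^sup>-\<^sup>4 \<integral> (x\<^sup>2 + y\<^sup>2) \<bar>\<nabla>u\<bar>\<^sup>2\<close>.  As the integrands do not depend on \<open>z\<close>, rescaling \<open>z\<close> first shows that
  \<open>\<bar>\<nabla>u\<bar>\<^sup>2\<close> is integrable over a slab, and then by dominated convergence that it vanishes.  So the horizontal gradient is zero
  everywhere, and the claim on \<open>{\<nabla>u \<noteq> 0}\<close> holds vacuously.
\<close>

subsection \<open>Functions of class C1\<close>

text \<open>The growth bound is critical for the scaling: one cutoff at scale R leaves an energy
  that is bounded in R but not small, so the first step averages over dyadic scales, and it yields
  only invariance in z. The second step exploits that the angle \<lambda>z has horizontal gradient
  \<lambda>(-y/2, x/2), so rotating the pair (Xu, Yu) by it acts like a constant magnetic field.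
  Since Xu and Yu lie in the kernel of the form, the energy of the rotated fields consists of the
  cost of the cutoff, a cost quadratic in \<lambda>, and a linear part that acquires a sign once
  second derivatives are integrated away; \<lambda> = 1/R^2 makes the two costs comparable. The
  resulting bound improves itself: energy on a slab is controlled by the same energy weighted with
  (x^2 + y^2)/R^2. Since u is only C2, the fields Xu and Yu solve the linearised system only weakly,
  and commutations that would involve third derivatives are done under the integral sign.\<close>

lemma Ck1_iff: "Ck 1 f \<longleftrightarrow> (\<forall>p. f differentiable (at p)) \<and> (\<forall>i. continuous_on UNIV (pd i f))"
  by (simp add: differentiable_on_def)

lemma Ck1_differentiable: "Ck 1 f \<Longrightarrow> f differentiable (at p)"
  and Ck1_continuous_pd: "Ck 1 f \<Longrightarrow> continuous_on UNIV (pd i f)"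
  by (simp_all add: Ck1_iff del: One_nat_def)

lemma Ck1_continuous: "Ck 1 f \<Longrightarrow> continuous_on UNIV f"
  by (simp add: differentiable_imp_continuous_on)

lemma pd_eqI:
  assumes "(f has_derivative D) (at p)"
  shows "pd k f p = D (axis k 1)"
proof -
  have "((\<lambda>t::real. p + t *\<^sub>R axis k 1) has_derivative (\<lambda>t. t *\<^sub>R axis k 1)) (at 0)"
    by (auto intro!: derivative_eq_intros)
  moreover have "(f has_derivative D) (at (p + 0 *\<^sub>R axis k 1))"
    using assms by simp
  ultimately have "((\<lambda>t. f (p + t *\<^sub>R axis k 1)) has_derivative (\<lambda>t. D (t *\<^sub>R axis k 1))) (at 0)"
    by (rule has_derivative_compose)
  then have "((\<lambda>t. f (p + t *\<^sub>R axis k 1)) has_real_derivative D (axis k 1)) (at 0)"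
    by (rule has_derivative_imp_has_field_derivative)
       (simp add: linear_scale[OF has_derivative_linear[OF assms]])
  then show ?thesis
    unfolding pd_def by (rule DERIV_imp_deriv)
qed

lemma has_derivative_pd:
  fixes f :: "real^'n \<Rightarrow> real"
  assumes "f differentiable (at p)"
  shows "(f has_derivative (\<lambda>v. \<Sum>k\<in>UNIV. v $ k * pd k f p)) (at p)"
proof -
  from assms obtain D where D: "(f has_derivative D) (at p)"
    unfolding differentiable_def by blast
  have "D v = (\<Sum>k\<in>UNIV. v $ k * pd k f p)" for v
  proof -
    have "D v = D (\<Sum>k\<in>UNIV. v $ k *\<^sub>R axis k 1)"
      by (simp add: basis_expansion flip: scalar_mult_eq_scaleR)
    also have "\<dots> = (\<Sum>k\<in>UNIV. v $ k * pd k f p)"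
      using has_derivative_linear[OF D] by (simp add: linear_sum linear_scale pd_eqI[OF D])
    finally show ?thesis .
  qed
  then have "D = (\<lambda>v. \<Sum>k\<in>UNIV. v $ k * pd k f p)" ..
  with D show ?thesis by simp
qed

lemma has_real_derivative_pd:
  fixes f :: "real^'n \<Rightarrow> real"
  assumes "f differentiable (at (p + s *\<^sub>R axis k 1))"
  shows "((\<lambda>t. f (p + t *\<^sub>R axis k 1)) has_real_derivative pd k f (p + s *\<^sub>R axis k 1)) (at s)"
proof -
  from assms obtain D where D: "(f has_derivative D) (at (p + s *\<^sub>R axis k 1))"
    unfolding differentiable_def by blast
  have "((\<lambda>t::real. p + t *\<^sub>R axis k 1) has_derivative (\<lambda>t. t *\<^sub>R axis k 1)) (at s)"
    by (auto intro!: derivative_eq_intros)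
  from has_derivative_compose[OF this D]
  show ?thesis
    by (rule has_derivative_imp_has_field_derivative)
       (simp add: linear_scale[OF has_derivative_linear[OF D]] pd_eqI[OF D])
qed

lemma sum_axis: "(\<Sum>i\<in>UNIV. axis k (1::real) $ i * c i) = c k"
  by (simp add: axis_def mult_delta_left)

lemma pd_const [simp]: "pd k (\<lambda>_. c) p = 0"
  by (rule pd_eqI[THEN trans]) auto

lemma pd_coord: "pd k (\<lambda>q. q $ j) p = (if k = j then 1 else 0)"
proof -
  have "((\<lambda>q. q $ j) has_derivative (\<lambda>v. v $ j)) (at p)"
    by (intro bounded_linear_imp_has_derivative bounded_linear_vec_nth)
  from pd_eqI[OF this, of k] show ?thesis by (simp add: axis_def)
qed

context
  fixes f g :: "real^'n \<Rightarrow> real" and p :: "real^'n"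
  assumes f: "f differentiable (at p)" and g: "g differentiable (at p)"
begin

lemma pd_add: "pd k (\<lambda>q. f q + g q) p = pd k f p + pd k g p"
  using pd_eqI[OF has_derivative_add[OF has_derivative_pd[OF f] has_derivative_pd[OF g]], of k]
  by (simp add: sum_axis)

lemma pd_diff: "pd k (\<lambda>q. f q - g q) p = pd k f p - pd k g p"
  using pd_eqI[OF has_derivative_diff[OF has_derivative_pd[OF f] has_derivative_pd[OF g]], of k]
  by (simp add: sum_axis)

lemma pd_mult: "pd k (\<lambda>q. f q * g q) p = pd k f p * g p + f p * pd k g p"
  using pd_eqI[OF has_derivative_mult[OF has_derivative_pd[OF f] has_derivative_pd[OF g]], of k]
  by (simp add: sum_axis)

end

lemma pd_cmult: "f differentiable (at p) \<Longrightarrow> pd k (\<lambda>q. c * f q) p = c * pd k f p"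
  using pd_mult[of "\<lambda>_. c" p f k] by simp

lemma pd_real_comp:
  fixes f :: "real^'n \<Rightarrow> real"
  assumes f: "f differentiable (at p)" and h: "(h has_real_derivative h') (at (f p))"
  shows "pd k (\<lambda>q. h (f q)) p = h' * pd k f p"
proof -
  from pd_eqI[OF has_derivative_compose[OF has_derivative_pd[OF f] h[unfolded has_field_derivative_def]], of k]
  show ?thesis by (simp add: sum_axis)
qed

lemma differentiable_vec_iff:
  "(u :: real^'n \<Rightarrow> real^'m) differentiable (at p) \<longleftrightarrow> (\<forall>i. (\<lambda>q. u q $ i) differentiable (at p))"
  (is "?l \<longleftrightarrow> ?r")
proof
  assume ?l
  then obtain D where "(u has_derivative D) (at p)" unfolding differentiable_def by blast
  then have "((\<lambda>q. u q $ i) has_derivative (\<lambda>v. D v $ i)) (at p)" for i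
    by (rule bounded_linear.has_derivative[OF bounded_linear_vec_nth])
  then show ?r unfolding differentiable_def by (intro allI exI)
next
  assume ?r
  then have "\<forall>i. \<exists>D. ((\<lambda>q. u q $ i) has_derivative D) (at p)"
    unfolding differentiable_def by blast
  then obtain D where D: "\<And>i. ((\<lambda>q. u q $ i) has_derivative D i) (at p)" by metis
  have "(u has_derivative (\<lambda>v. \<chi> i. D i v)) (at p)"
    unfolding has_derivative_componentwise_within[where f=u]
    using D by (auto simp: Basis_vec_def inner_axis)
  then show ?l unfolding differentiable_def by blast
qed

lemma pd_vec_comp:
  fixes u :: "real^'n \<Rightarrow> real^'m" and h :: "real^'m \<Rightarrow> real"
  assumes u: "\<And>i. (\<lambda>q. u q $ i) differentiable (at p)" and h: "h differentiable (at (u p))"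
  shows "pd k (\<lambda>q. h (u q)) p = (\<Sum>j\<in>UNIV. pd j h (u p) * pd k (\<lambda>q. u q $ j) p)"
proof -
  have "((\<lambda>q. u q) has_derivative (\<lambda>v. \<chi> i. \<Sum>k\<in>UNIV. v $ k * pd k (\<lambda>q. u q $ i) p)) (at p)"
    unfolding has_derivative_componentwise_within[where f=u]
    using has_derivative_pd[OF u] by (auto simp: Basis_vec_def inner_axis)
  from pd_eqI[OF has_derivative_compose[OF this has_derivative_pd[OF h]], of k]
  show ?thesis by (simp add: sum_axis mult.commute)
qed

section \<open>Closure properties of the class C1\<close>

lemma Ck1I:
  assumes "\<And>p. f differentiable (at p)" "\<And>k p. pd k f p = g k p" "\<And>k. continuous_on UNIV (g k)"
  shows "Ck 1 f"
proof -
  have "pd k f = g k" for k using assms(2) by blast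
  with assms show ?thesis by (simp add: Ck1_iff del: One_nat_def)
qed

lemma Ck1_const: "Ck 1 (\<lambda>_. c)"
  by (rule Ck1I[where g="\<lambda>_ _. 0"]) auto

lemma Ck1_coord: "Ck 1 (\<lambda>q. q $ j)"
  by (rule Ck1I[where g="\<lambda>k _. if k = j then 1 else 0"])
     (auto simp: pd_coord intro: bounded_linear_imp_differentiable bounded_linear_vec_nth)

lemma Ck1_add: "Ck 1 f \<Longrightarrow> Ck 1 g \<Longrightarrow> Ck 1 (\<lambda>q. f q + g q)"
  by (rule Ck1I[where g="\<lambda>k q. pd k f q + pd k g q"])
     (simp_all add: Ck1_differentiable pd_add Ck1_continuous_pd continuous_on_add del: One_nat_def)

lemma Ck1_diff: "Ck 1 f \<Longrightarrow> Ck 1 g \<Longrightarrow> Ck 1 (\<lambda>q. f q - g q)"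
  by (rule Ck1I[where g="\<lambda>k q. pd k f q - pd k g q"])
     (simp_all add: Ck1_differentiable pd_diff Ck1_continuous_pd continuous_on_diff del: One_nat_def)

lemma Ck1_mult: "Ck 1 f \<Longrightarrow> Ck 1 g \<Longrightarrow> Ck 1 (\<lambda>q. f q * g q)"
  by (rule Ck1I[where g="\<lambda>k q. pd k f q * g q + f q * pd k g q"])
     (simp_all add: Ck1_differentiable Ck1_continuous pd_mult Ck1_continuous_pd continuous_on_add continuous_on_mult del: One_nat_def)

lemma Ck1_cmult: "Ck 1 f \<Longrightarrow> Ck 1 (\<lambda>q. c * f q)"
  by (intro Ck1_mult Ck1_const)

lemma Ck1_power: "Ck 1 f \<Longrightarrow> Ck 1 (\<lambda>q. f q ^ n)"
  by (induction n) (auto intro: Ck1_const Ck1_mult simp del: One_nat_def Ck.simps)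

lemma Ck1_sum: "(\<And>i. i \<in> I \<Longrightarrow> Ck 1 (f i)) \<Longrightarrow> Ck 1 (\<lambda>q. \<Sum>i\<in>I. f i q)"
  by (induction I rule: infinite_finite_induct) (auto intro: Ck1_const Ck1_add simp del: One_nat_def Ck.simps)

lemma pd_sum:
  "(\<And>i. i \<in> I \<Longrightarrow> Ck 1 (f i)) \<Longrightarrow> pd k (\<lambda>q. \<Sum>i\<in>I. f i q) p = (\<Sum>i\<in>I. pd k (f i) p)"
proof (induction I rule: infinite_finite_induct)
  case (insert i I)
  then have "Ck 1 (f i)" "Ck 1 (\<lambda>q. \<Sum>i\<in>I. f i q)" by (auto intro: Ck1_sum simp del: One_nat_def Ck.simps)
  with insert show ?case by (simp add: pd_add Ck1_differentiable del: One_nat_def Ck.simps)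
qed auto

lemma differentiable_real_comp:
  fixes h :: "real \<Rightarrow> real"
  assumes "f differentiable (at p)" "(h has_real_derivative h') (at (f p))"
  shows "(\<lambda>q. h (f q)) differentiable (at p)"
  using has_derivative_compose[of f _ p UNIV h] assms
  unfolding differentiable_def has_field_derivative_def by blast

lemma Ck1_real_comp:
  assumes f: "Ck 1 f" and h: "\<And>x. (h has_real_derivative h' x) (at x)" and c: "continuous_on UNIV h'"
  shows "Ck 1 (\<lambda>q. h (f q))"
proof (rule Ck1I[where g="\<lambda>k q. h' (f q) * pd k f q"])
  show "continuous_on UNIV (\<lambda>q. h' (f q) * pd k f q)" for k
    by (intro continuous_on_mult continuous_on_compose2[OF c Ck1_continuous[OF f]] Ck1_continuous_pd f) auto
qed (use Ck1_differentiable[OF f] h differentiable_real_comp pd_real_comp in blast)+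

lemma Ck1_vec_comp:
  fixes u :: "real^'n \<Rightarrow> real^'m" and h :: "real^'m \<Rightarrow> real"
  assumes u: "\<And>i. Ck 1 (\<lambda>q. u q $ i)" and h: "Ck 1 h"
  shows "Ck 1 (\<lambda>q. h (u q))"
proof (rule Ck1I[where g="\<lambda>k q. \<Sum>j\<in>UNIV. pd j h (u q) * pd k (\<lambda>q. u q $ j) q"])
  have "u differentiable (at p)" for p
    using u by (simp add: differentiable_vec_iff Ck1_differentiable del: One_nat_def Ck.simps)
  then show "(\<lambda>q. h (u q)) differentiable (at p)" for p
    using differentiable_chain_at[of u p h] Ck1_differentiable[OF h] by (simp add: o_def)
  have "continuous_on UNIV u"
    using continuous_on_vec_lambda[of UNIV "\<lambda>i q. u q $ i"] Ck1_continuous[OF u] by simp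
  then show "continuous_on UNIV (\<lambda>q. \<Sum>j\<in>UNIV. pd j h (u q) * pd k (\<lambda>q. u q $ j) q)" for k
    by (intro continuous_on_sum continuous_on_mult Ck1_continuous_pd u
        continuous_on_compose2[OF Ck1_continuous_pd[OF h]]) auto
  show "pd k (\<lambda>q. h (u q)) p = (\<Sum>j\<in>UNIV. pd j h (u p) * pd k (\<lambda>q. u q $ j) p)" for k p
    by (intro pd_vec_comp Ck1_differentiable u h)
qed

lemma Ck2_iff: "Ck 2 f \<longleftrightarrow> Ck 1 f \<and> (\<forall>i. Ck 1 (pd i f))"
  by (auto simp: numeral_2_eq_2 differentiable_imp_continuous_on)

text \<open>The class of integrands: most integrals below exist because their integrand lies in
  \<open>Cc0\<close>. Bounding the support set itself and not its closure lets products and sums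
  inherit the property by plain set inclusion.\<close>

definition Cc0 :: "(real^'n::finite \<Rightarrow> real) \<Rightarrow> bool" where
  "Cc0 f \<longleftrightarrow> continuous_on UNIV f \<and> bounded {p. f p \<noteq> 0}"

section \<open>Functions of compact support\<close>

lemma Cc1_iff: "Cc1 f \<longleftrightarrow> Ck 1 f \<and> bounded {p. f p \<noteq> 0}"
  unfolding Cc1_def
  by (metis bounded_closure bounded_subset closure_subset compact_eq_bounded_closed closed_closure)

lemma Cc1_Ck1: "Cc1 f \<Longrightarrow> Ck 1 f"
  by (simp add: Cc1_iff del: One_nat_def)

lemma Cc1_Cc0: "Cc1 f \<Longrightarrow> Cc0 f"
  by (simp add: Cc1_iff Cc0_def Ck1_continuous del: One_nat_def)

lemma Cc0_mult1: "Cc0 f \<Longrightarrow> continuous_on UNIV g \<Longrightarrow> Cc0 (\<lambda>q. f q * g q)"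
  and Cc0_mult2: "Cc0 f \<Longrightarrow> continuous_on UNIV g \<Longrightarrow> Cc0 (\<lambda>q. g q * f q)"
  unfolding Cc0_def by (auto intro!: continuous_intros elim: bounded_subset)

lemma Cc1_mult1: "Cc1 f \<Longrightarrow> Ck 1 g \<Longrightarrow> Cc1 (\<lambda>q. f q * g q)"
  and Cc1_mult2: "Cc1 f \<Longrightarrow> Ck 1 g \<Longrightarrow> Cc1 (\<lambda>q. g q * f q)"
  unfolding Cc1_iff by (auto intro!: Ck1_mult elim: bounded_subset simp del: One_nat_def Ck.simps)

lemma bounded_support_add:
  fixes f g :: "'a::metric_space \<Rightarrow> real"
  assumes "bounded {p. f p \<noteq> 0}" "bounded {p. g p \<noteq> 0}"
  shows "bounded {p. f p + g p \<noteq> 0}" "bounded {p. f p - g p \<noteq> 0}"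
  using assms by (auto intro: bounded_subset[of "{p. f p \<noteq> 0} \<union> {p. g p \<noteq> 0}"])

lemma Cc0_add: "Cc0 f \<Longrightarrow> Cc0 g \<Longrightarrow> Cc0 (\<lambda>q. f q + g q)"
  unfolding Cc0_def using bounded_support_add(1)[of f g] continuous_on_add[of UNIV f g] by blast

lemma Cc0_diff: "Cc0 f \<Longrightarrow> Cc0 g \<Longrightarrow> Cc0 (\<lambda>q. f q - g q)"
  unfolding Cc0_def using bounded_support_add(2)[of f g] continuous_on_diff[of UNIV f g] by blast

lemma Cc1_add: "Cc1 f \<Longrightarrow> Cc1 g \<Longrightarrow> Cc1 (\<lambda>q. f q + g q)"
  by (simp add: Cc1_iff Ck1_add bounded_support_add del: One_nat_def Ck.simps)

lemma Cc0_zero: "Cc0 (\<lambda>_. 0)"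
  by (simp add: Cc0_def)

lemma Cc0_sum: "(\<And>i. i \<in> I \<Longrightarrow> Cc0 (f i)) \<Longrightarrow> Cc0 (\<lambda>q. \<Sum>i\<in>I. f i q)"
  by (induction I rule: infinite_finite_induct) (auto intro: Cc0_add Cc0_zero)

lemma Cc1_sum: "(\<And>i. i \<in> I \<Longrightarrow> Cc1 (f i)) \<Longrightarrow> Cc1 (\<lambda>q. \<Sum>i\<in>I. f i q)"
proof (induction I rule: infinite_finite_induct)
  case (insert i I)
  then show ?case by (simp add: Cc1_add)
qed (simp_all add: Cc1_iff Ck1_const del: One_nat_def Ck.simps)

lemma Cc0_integrable:
  assumes "Cc0 f" shows "integrable lborel f"
proof -
  let ?S = "closure {p. f p \<noteq> 0}"
  have "compact ?S" "continuous_on ?S f"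
    using assms by (auto simp: Cc0_def compact_eq_bounded_closed intro: continuous_on_subset)
  from borel_integrable_compact[OF this] have "integrable lborel (\<lambda>x. indicator ?S x *\<^sub>R f x)" .
  also have "(\<lambda>x. indicator ?S x *\<^sub>R f x) = f"
    using closure_subset[of "{p. f p \<noteq> 0}"] by (auto simp: fun_eq_iff indicator_def)
  finally show ?thesis .
qed

lemma Cc1_pd_Cc0:
  assumes "Cc1 f" shows "Cc0 (pd k f)"
proof -
  let ?S = "closure {p. f p \<noteq> 0}"
  have "pd k f p = 0" if "p \<notin> ?S" for p
  proof -
    have op: "open (- ?S)" by (simp only: open_Compl closed_closure)
    have "((\<lambda>_. 0) has_derivative (\<lambda>_. 0)) (at p)" by simp
    moreover have "p \<in> - ?S" using that by blast
    moreover have "0 = f q" if "q \<in> - ?S" for q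
      using closure_subset[of "{p. f p \<noteq> 0}"] that by (metis (mono_tags) ComplD mem_Collect_eq subsetD)
    ultimately have "(f has_derivative (\<lambda>_. 0)) (at p)"
      by (rule has_derivative_transform_within_open[OF _ op])
    from pd_eqI[OF this] show ?thesis by simp
  qed
  then have "{p. pd k f p \<noteq> 0} \<subseteq> ?S" by blast
  moreover have "bounded ?S" using assms by (intro bounded_closure) (simp add: Cc1_iff del: One_nat_def)
  ultimately have "bounded {p. pd k f p \<noteq> 0}" by (rule bounded_subset[rotated])
  then show ?thesis
    using Ck1_continuous_pd[OF Cc1_Ck1[OF assms]] by (simp add: Cc0_def)
qed


subsection \<open>Integration by parts\<close>

lemma Cc1_translate:
  fixes f :: "real^'n \<Rightarrow> real"
  assumes "Cc1 f"
  shows "Cc1 (\<lambda>q. f (q + a))" "pd k (\<lambda>q. f (q + a)) p = pd k f (p + a)"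
proof -
  have D: "((\<lambda>q. f (q + a)) has_derivative (\<lambda>v. \<Sum>k\<in>UNIV. v $ k * pd k f (q + a))) (at q)" for q
  proof -
    have 1: "((\<lambda>q. q + a) has_derivative (\<lambda>v. v)) (at q)"
      by (auto intro!: derivative_eq_intros)
    show ?thesis
      by (rule has_derivative_compose[OF 1 has_derivative_pd])
         (rule Ck1_differentiable[OF Cc1_Ck1[OF assms]])
  qed
  have pd: "pd k (\<lambda>q. f (q + a)) q = pd k f (q + a)" for k q
    using pd_eqI[OF D, of k] by (simp add: sum_axis)
  show "pd k (\<lambda>q. f (q + a)) p = pd k f (p + a)" by (rule pd)
  have "Ck 1 (\<lambda>q. f (q + a))"
  proof (rule Ck1I[where g="\<lambda>k q. pd k f (q + a)"])
    show "continuous_on UNIV (\<lambda>q. pd k f (q + a))" for k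
      by (rule continuous_on_compose2[OF Ck1_continuous_pd[OF Cc1_Ck1[OF assms], of k]])
         (auto intro!: continuous_intros)
    show "(\<lambda>q. f (q + a)) differentiable (at q)" for q
      using D[of q] unfolding differentiable_def by (intro exI)
  qed (rule pd)
  moreover have "bounded {q. f (q + a) \<noteq> 0}"
  proof -
    have "{q. f (q + a) \<noteq> 0} = (\<lambda>q. q - a) ` {q. f q \<noteq> 0}"
      by (force simp: image_iff intro: exI[of _ "_ + a"])
    moreover have "bounded ((\<lambda>q. q - a) ` {q. f q \<noteq> 0})"
      using assms bounded_translation_minus[of "{q. f q \<noteq> 0}" a] by (simp add: Cc1_iff del: One_nat_def)
    ultimately show ?thesis by simp
  qed
  ultimately show "Cc1 (\<lambda>q. f (q + a))" by (simp add: Cc1_iff del: One_nat_def)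
qed

lemma lborel_integral_translate:
  fixes f :: "'a::euclidean_space \<Rightarrow> real"
  assumes "continuous_on UNIV f"
  shows "(LINT p|lborel. f (p + a)) = (LINT p|lborel. f p)"
proof -
  have [measurable]: "f \<in> borel_measurable borel"
    by (rule borel_measurable_continuous_onI[OF assms])
  have "(LINT p|lborel. f p) = (LINT p|distr lborel borel ((+) a). f p)"
    by (simp add: lborel_distr_plus)
  also have "\<dots> = (LINT p|lborel. f (a + p))"
    by (rule integral_distr) simp_all
  finally show ?thesis by (simp add: add.commute)
qed

lemma Cc0_translate:
  assumes "Cc0 f" shows "Cc0 (\<lambda>q. f (q + a))"
proof -
  have "{q. f (q + a) \<noteq> 0} = (\<lambda>q. q - a) ` {q. f q \<noteq> 0}"
    by (force simp: image_iff intro: exI[of _ "_ + a"])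
  moreover have "bounded ((\<lambda>q. q - a) ` {q. f q \<noteq> 0})"
    using assms bounded_translation_minus[of "{q. f q \<noteq> 0}" a] by (simp add: Cc0_def)
  moreover have "continuous_on UNIV (\<lambda>q. f (q + a))"
    using assms by (intro continuous_on_compose2[of UNIV f UNIV "\<lambda>q. q + a"]) (auto intro!: continuous_intros simp: Cc0_def)
  ultimately show ?thesis by (simp add: Cc0_def)
qed

lemma diff_quotient_le:
  fixes v :: "real^'n \<Rightarrow> real"
  assumes v: "Ck 1 v" and M: "\<And>q. q \<in> cball 0 (r + 1) \<Longrightarrow> \<bar>pd k v q\<bar> \<le> M"
    and p: "norm p \<le> r" and h: "\<bar>h\<bar> \<le> 1"
  shows "\<bar>v (p + h *\<^sub>R axis k 1) - v p\<bar> \<le> \<bar>h\<bar> * M"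
proof -
  let ?g = "\<lambda>t. v (p + t *\<^sub>R axis k 1)" and ?g' = "\<lambda>t. pd k v (p + t *\<^sub>R axis k 1)"
  have D: "(?g has_real_derivative ?g' t) (at t)" for t
    by (rule has_real_derivative_pd[OF Ck1_differentiable[OF v]])
  have "\<bar>?g h - ?g 0\<bar> \<le> M * \<bar>h - 0\<bar>"
  proof (rule field_differentiable_bound[of "{-1..1}" ?g ?g', unfolded real_norm_def])
    show "\<bar>?g' t\<bar> \<le> M" if "t \<in> {-1..1}" for t
    proof (rule M)
      have "norm (p + t *\<^sub>R axis k 1) \<le> norm p + \<bar>t\<bar>"
        using norm_triangle_ineq[of p "t *\<^sub>R axis k 1"] by simp
      moreover have "\<bar>t\<bar> \<le> 1" using that by auto
      ultimately show "p + t *\<^sub>R axis k 1 \<in> cball 0 (r + 1)" using p by simp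
    qed
  qed (use D h in \<open>auto intro: has_field_derivative_at_within\<close>)
  then show ?thesis by (simp add: mult.commute)
qed

text \<open>Dominated convergence, with the majorant \<open>M * \<bar>w p\<bar>\<close> on a ball
  supplied by the mean value bound \<open>diff_quotient_le\<close>. The support hypothesis is
  imposed on the product, so that either \<open>v\<close> or \<open>w\<close> may be the compactly
  supported factor.\<close>

lemma diff_quotient_tendsto:
  fixes v w :: "real^'n \<Rightarrow> real"
  assumes v: "Ck 1 v" and w: "continuous_on UNIV w"
    and supp: "\<And>p t. norm p > r \<Longrightarrow> \<bar>t\<bar> \<le> 1 \<Longrightarrow> (v (p + t *\<^sub>R axis k 1) - v p) * w p = 0"
    and h: "\<And>n. h n \<noteq> 0" "\<And>n. \<bar>h n\<bar> \<le> 1" "h \<longlonglongrightarrow> 0"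
  shows "(\<lambda>n. LINT p|lborel. (v (p + h n *\<^sub>R axis k 1) - v p) / h n * w p) \<longlonglongrightarrow>
         (LINT p|lborel. pd k v p * w p)"
proof -
  have cv: "continuous_on UNIV v" by (rule Ck1_continuous[OF v])
  have cvt: "continuous_on UNIV (\<lambda>p. v (p + a))" for a
    by (rule continuous_on_compose2[OF cv]) (auto intro!: continuous_intros)
  have cpd: "continuous_on UNIV (pd k v)" by (rule Ck1_continuous_pd[OF v])
  have "bounded (pd k v ` cball 0 (r + 1))"
    by (intro compact_imp_bounded compact_continuous_image continuous_on_subset[OF cpd]) auto
  then obtain M where M: "\<And>q. q \<in> cball 0 (r + 1) \<Longrightarrow> \<bar>pd k v q\<bar> \<le> M"
    unfolding bounded_iff by (metis image_eqI real_norm_def)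
  have meas: "(\<lambda>p. (v (p + h n *\<^sub>R axis k 1) - v p) / h n * w p) \<in> borel_measurable lborel" for n
    unfolding measurable_lborel2
    by (intro borel_measurable_continuous_onI continuous_intros cvt cv w) (simp add: h)
  have int: "integrable lborel (\<lambda>p. indicator (cball 0 r) p *\<^sub>R (M * \<bar>w p\<bar>))"
    by (intro borel_integrable_compact continuous_intros continuous_on_subset[OF w]) auto
  show ?thesis
  proof (rule integral_dominated_convergence[OF _ meas int])
    show "(\<lambda>p. pd k v p * w p) \<in> borel_measurable lborel"
      unfolding measurable_lborel2 by (intro borel_measurable_continuous_onI continuous_intros cpd w)
    show "AE p in lborel. (\<lambda>n. (v (p + h n *\<^sub>R axis k 1) - v p) / h n * w p) \<longlonglongrightarrow> pd k v p * w p"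
    proof (rule AE_I2)
      fix p :: "real^'n"
      have "((\<lambda>t. v (p + t *\<^sub>R axis k 1)) has_real_derivative pd k v p) (at 0)"
        using has_real_derivative_pd[of v p 0 k] Ck1_differentiable[OF v] by simp
      then have "((\<lambda>t. (v (p + t *\<^sub>R axis k 1) - v p) / t) \<longlongrightarrow> pd k v p) (at 0)"
        by (simp add: has_field_derivative_iff)
      moreover have "filterlim h (at 0) sequentially"
        using h by (simp add: filterlim_at)
      ultimately have "(\<lambda>n. (v (p + h n *\<^sub>R axis k 1) - v p) / h n) \<longlonglongrightarrow> pd k v p"
        by (rule filterlim_compose)
      then show "(\<lambda>n. (v (p + h n *\<^sub>R axis k 1) - v p) / h n * w p) \<longlonglongrightarrow> pd k v p * w p"
        by (intro tendsto_intros)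
    qed
    show "AE p in lborel. norm ((v (p + h n *\<^sub>R axis k 1) - v p) / h n * w p) \<le> indicator (cball 0 r) p *\<^sub>R (M * \<bar>w p\<bar>)" for n
    proof (rule AE_I2)
      fix p :: "real^'n"
      show "norm ((v (p + h n *\<^sub>R axis k 1) - v p) / h n * w p) \<le> indicator (cball 0 r) p *\<^sub>R (M * \<bar>w p\<bar>)"
      proof (cases "norm p \<le> r")
        case True
        have "\<bar>(v (p + h n *\<^sub>R axis k 1) - v p) / h n\<bar> \<le> M"
          using diff_quotient_le[OF v M True h(2)[of n]] h(1)[of n] by (simp add: divide_le_eq mult.commute)
        then have "\<bar>(v (p + h n *\<^sub>R axis k 1) - v p) / h n\<bar> * \<bar>w p\<bar> \<le> M * \<bar>w p\<bar>"
          by (rule mult_right_mono) simp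
        then show ?thesis using True by (simp only: norm_mult real_norm_def abs_mult) (simp add: indicator_def)
      next
        case False
        then show ?thesis using supp[of p "h n"] h(2)[of n] by (auto simp: indicator_def)
      qed
    qed
  qed
qed

lemma inverse_Suc_seq:
  "\<And>n. inverse (real (Suc n)) \<noteq> 0" "\<And>n. \<bar>inverse (real (Suc n))\<bar> \<le> 1" "(\<lambda>n. inverse (real (Suc n))) \<longlonglongrightarrow> 0"
  using LIMSEQ_inverse_real_of_nat by (auto simp: field_simps)

lemma bounded_support_norm:
  assumes "bounded {p::'a::real_normed_vector. f p \<noteq> (0::real)}"
  obtains r where "r > 0" "\<And>p. norm p > r \<Longrightarrow> f p = 0"
  using assms unfolding bounded_pos by (metis (mono_tags, lifting) mem_Collect_eq not_le)

text \<open>Translation invariance of Lebesgue measure makes the integral of every difference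
  quotient zero, and passing to the limit avoids iterated integrals.\<close>

lemma integral_pd_zero:
  assumes f: "Cc1 f"
  shows "(LINT p|lborel. pd k f p) = 0"
proof -
  let ?h = "\<lambda>n. inverse (real (Suc n))"
  obtain r where r: "\<And>p. norm p > r \<Longrightarrow> f p = 0"
    using bounded_support_norm f unfolding Cc1_iff by metis
  have "f (p + t *\<^sub>R axis k 1) - f p = 0" if "norm p > r + 1" "\<bar>t\<bar> \<le> 1" for p t
  proof -
    have "norm p \<le> norm (p + t *\<^sub>R axis k 1) + \<bar>t\<bar>"
      using norm_triangle_ineq4[of "p + t *\<^sub>R axis k 1" "t *\<^sub>R axis k 1"] by simp
    with that r[of p] r[of "p + t *\<^sub>R axis k 1"] show ?thesis by simp
  qed
  then have "(\<lambda>n. LINT p|lborel. (f (p + ?h n *\<^sub>R axis k 1) - f p) / ?h n * 1) \<longlonglongrightarrow> (LINT p|lborel. pd k f p * 1)"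
    using f by (intro diff_quotient_tendsto[where r="r+1"] inverse_Suc_seq) (auto simp: Cc1_iff)
  moreover have "(LINT p|lborel. (f (p + ?h n *\<^sub>R axis k 1) - f p) / ?h n * 1) = 0" for n
    using lborel_integral_translate[of f "?h n *\<^sub>R axis k 1"] f
    by (simp add: Cc0_integrable Cc0_translate Cc1_Cc0 Ck1_continuous Cc1_Ck1 del: One_nat_def Ck.simps)
  ultimately show ?thesis by (simp add: LIMSEQ_const_iff)
qed

lemma integral_by_parts:
  assumes "Ck 1 v" "Cc1 w"
  shows "(LINT p|lborel. pd k v p * w p) = - (LINT p|lborel. v p * pd k w p)"
proof -
  have "0 = (LINT p|lborel. pd k (\<lambda>q. v q * w q) p)"
    using integral_pd_zero[OF Cc1_mult2[OF assms(2,1)]] by simp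
  also have "\<dots> = (LINT p|lborel. pd k v p * w p + v p * pd k w p)"
    using assms by (simp add: pd_mult Ck1_differentiable Cc1_Ck1 del: One_nat_def Ck.simps)
  also have "\<dots> = (LINT p|lborel. pd k v p * w p) + (LINT p|lborel. v p * pd k w p)"
    by (intro Bochner_Integration.integral_add Cc0_integrable Cc0_mult2 Cc1_Cc0 Cc1_pd_Cc0
        Ck1_continuous Ck1_continuous_pd assms)
  finally show ?thesis by simp
qed

text \<open>For \<open>w\<close> of class C2 this would be two integrations by parts. With both
  factors only C1, the derivative of \<open>w\<close> along \<open>b\<close> is replaced by a
  difference quotient, which is still \<open>Cc1\<close>: integrate by parts along \<open>a\<close>,
  shift the translation onto \<open>v\<close>, and let the step tend to zero.\<close>

lemma integral_pd_pd_commute: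
  fixes v w :: "real^'n \<Rightarrow> real"
  assumes v: "Ck 1 v" and w: "Cc1 w"
  shows "(LINT p|lborel. pd a v p * pd b w p) = (LINT p|lborel. pd b v p * pd a w p)"
proof -
  let ?h = "\<lambda>n. inverse (real (Suc n))" and ?e = "axis b 1 :: real^'n"
  obtain r where r: "\<And>p. norm p > r \<Longrightarrow> w p = 0"
    using bounded_support_norm w unfolding Cc1_iff by metis
  obtain r' where r': "\<And>p. norm p > r' \<Longrightarrow> pd a w p = 0"
    using bounded_support_norm Cc1_pd_Cc0[OF w] unfolding Cc0_def by metis
  have cv: "continuous_on UNIV v" by (rule Ck1_continuous[OF v])
  have w1: "Ck 1 w" by (rule Cc1_Ck1[OF w])
  have supp: "(w (p + t *\<^sub>R ?e) - w p) * pd a v p = 0" if "norm p > r + 1" "\<bar>t\<bar> \<le> 1" for p t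
  proof -
    have "norm p \<le> norm (p + t *\<^sub>R ?e) + \<bar>t\<bar>"
      using norm_triangle_ineq4[of "p + t *\<^sub>R ?e" "t *\<^sub>R ?e"] by simp
    with that r[of p] r[of "p + t *\<^sub>R ?e"] show ?thesis by simp
  qed
  have 1: "(\<lambda>n. LINT p|lborel. (w (p + ?h n *\<^sub>R ?e) - w p) / ?h n * pd a v p) \<longlonglongrightarrow> (LINT p|lborel. pd b w p * pd a v p)"
    by (intro diff_quotient_tendsto[OF w1 Ck1_continuous_pd[OF v] supp] inverse_Suc_seq)
  \<comment> \<open>The steps have the opposite sign here because moving the translation from
    \<open>w\<close> to \<open>v\<close> under the integral reverses it.\<close>
  have "(\<lambda>n. LINT p|lborel. (v (p + (- ?h n) *\<^sub>R ?e) - v p) / (- ?h n) * pd a w p) \<longlonglongrightarrow> (LINT p|lborel. pd b v p * pd a w p)"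
  proof (rule diff_quotient_tendsto[OF v Ck1_continuous_pd[OF w1], where r=r'])
    show "(\<lambda>n. - ?h n) \<longlonglongrightarrow> 0" using tendsto_minus[OF inverse_Suc_seq(3)] by simp
  qed (use r' inverse_Suc_seq in auto)
  moreover have "(LINT p|lborel. (w (p + h *\<^sub>R ?e) - w p) / h * pd a v p) =
      (LINT p|lborel. (v (p + (- h) *\<^sub>R ?e) - v p) / (- h) * pd a w p)" (is "?L = ?R") if "h \<noteq> 0" for h
  proof -
    note wt = Cc1_translate(1)[OF w, of "h *\<^sub>R ?e"] Cc1_translate(2)[OF w, where a="h *\<^sub>R ?e"]
    let ?D = "\<lambda>q. inverse h * (w (q + h *\<^sub>R ?e) + (- 1) * w q)"
    have D: "Cc1 ?D"
      by (intro Cc1_mult2 Cc1_add wt(1) w Ck1_const)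
    have pdD: "pd a ?D p = inverse h * (pd a w (p + h *\<^sub>R ?e) - pd a w p)" for p
      using wt w1 by (simp add: pd_cmult pd_diff Ck1_differentiable Cc1_Ck1 Ck1_diff Ck1_cmult
          del: One_nat_def Ck.simps)
    have cvt: "continuous_on UNIV (\<lambda>p. v (p - h *\<^sub>R ?e))"
      by (rule continuous_on_compose2[OF cv]) (auto intro!: continuous_intros)
    note ints = Cc0_integrable[OF Cc0_mult2[OF Cc0_translate[OF Cc1_pd_Cc0[OF w]] cv]]
      Cc0_integrable[OF Cc0_mult2[OF Cc1_pd_Cc0[OF w] cv]] Cc0_integrable[OF Cc0_mult2[OF Cc1_pd_Cc0[OF w] cvt]]
    have "?L = (LINT p|lborel. pd a v p * ?D p)"
      by (rule Bochner_Integration.integral_cong) (auto simp: field_simps)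
    also have "\<dots> = - (LINT p|lborel. v p * (inverse h * (pd a w (p + h *\<^sub>R ?e) - pd a w p)))"
      unfolding integral_by_parts[OF v D] pdD ..
    also have "\<dots> = - inverse h * (LINT p|lborel. v p * pd a w (p + h *\<^sub>R ?e) - v p * pd a w p)"
      by (subst Bochner_Integration.integral_mult_right_zero[symmetric]) (simp add: algebra_simps flip: Bochner_Integration.integral_minus)
    also have "\<dots> = - inverse h * ((LINT p|lborel. v p * pd a w (p + h *\<^sub>R ?e)) - (LINT p|lborel. v p * pd a w p))"
      by (simp add: ints)
    also have "(LINT p|lborel. v p * pd a w (p + h *\<^sub>R ?e)) = (LINT p|lborel. v (p - h *\<^sub>R ?e) * pd a w p)"
    proof -
      have "continuous_on UNIV (\<lambda>p. v (p - h *\<^sub>R ?e) * pd a w p)"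
        by (intro continuous_intros cvt Ck1_continuous_pd[OF w1])
      from lborel_integral_translate[OF this, of "h *\<^sub>R ?e"] show ?thesis by simp
    qed
    also have "- inverse h * ((LINT p|lborel. v (p - h *\<^sub>R ?e) * pd a w p) - (LINT p|lborel. v p * pd a w p)) =
        - inverse h * (LINT p|lborel. v (p - h *\<^sub>R ?e) * pd a w p - v p * pd a w p)"
      by (simp add: ints)
    also have "\<dots> = ?R"
      by (subst Bochner_Integration.integral_mult_right_zero[symmetric])
         (auto intro!: Bochner_Integration.integral_cong simp: field_simps)
    finally show ?thesis .
  qed
  ultimately have "(\<lambda>n. LINT p|lborel. (w (p + ?h n *\<^sub>R ?e) - w p) / ?h n * pd a v p) \<longlonglongrightarrow> (LINT p|lborel. pd b v p * pd a w p)"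
    using inverse_Suc_seq(1) by simp
  from LIMSEQ_unique[OF 1 this] show ?thesis by (simp add: mult.commute)
qed

text \<open>The squared positive part is C1, which is all the regularity that test functions need;
  it replaces a smooth bump in every cutoff below.\<close>

definition sqpos :: "real \<Rightarrow> real" where "sqpos t = (max 0 t)\<^sup>2"

lemma sqpos_deriv: "(sqpos has_real_derivative 2 * max 0 t) (at t)"
proof -
  consider "t > 0" | "t < 0" | "t = 0" by linarith
  then show ?thesis
  proof cases
    case 1
    have "((\<lambda>t. t\<^sup>2) has_real_derivative 2 * max 0 t) (at t)"
      using 1 by (auto intro!: derivative_eq_intros)
    then show ?thesis
      by (rule DERIV_cong_ev[THEN iffD1, rotated -1])
         (auto simp: sqpos_def intro!: eventually_mono[OF eventually_gt_at_top[of 0]] eventually_nhds_in_open[of "{0<..}", THEN eventually_mono] 1)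
  next
    case 2
    have "((\<lambda>t. 0) has_real_derivative 2 * max 0 t) (at t)"
      using 2 by (auto intro!: derivative_eq_intros)
    then show ?thesis
      by (rule DERIV_cong_ev[THEN iffD1, rotated -1])
         (auto simp: sqpos_def 2 intro!: eventually_nhds_in_open[of "{..<0}", THEN eventually_mono])
  next
    case 3
    have "((\<lambda>t::real. max 0 t * max 0 t / t) \<longlongrightarrow> 0) (at 0)"
      by (rule tendsto_0_le[OF tendsto_ident_at, of _ 1]) (auto simp: max_def)
    with 3 show ?thesis
      by (simp add: has_field_derivative_iff sqpos_def power2_eq_square)
  qed
qed

lemma Ck1_sqpos: "Ck 1 f \<Longrightarrow> Ck 1 (\<lambda>q. sqpos (f q))"
  by (rule Ck1_real_comp[OF _ sqpos_deriv]) (auto intro!: continuous_intros)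

lemma Ck1_bump: "Ck 1 (\<lambda>q::real^'n. sqpos (d\<^sup>2 - (norm (q - p))\<^sup>2))"
proof (rule Ck1_sqpos)
  have "(\<lambda>q::real^'n. d\<^sup>2 - (norm (q - p))\<^sup>2) = (\<lambda>q. d\<^sup>2 - (\<Sum>i\<in>UNIV. (q $ i - p $ i)\<^sup>2))"
    by (simp add: norm_vec_def L2_set_def sum_nonneg)
  then show "Ck 1 (\<lambda>q::real^'n. d\<^sup>2 - (norm (q - p))\<^sup>2)"
    by (simp only:) (intro Ck1_diff Ck1_const Ck1_sum Ck1_power Ck1_coord)
qed

lemma sqpos_eq_0_iff: "sqpos t = 0 \<longleftrightarrow> t \<le> 0" and sqpos_nonneg: "0 \<le> sqpos t"
  by (auto simp: sqpos_def max_def)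

lemma Cc0_integral_nonneg_eq_0:
  assumes f: "Cc0 f" and nn: "\<And>p. 0 \<le> f p" and 0: "(LINT p|lborel. f p) = 0"
  shows "f p = 0"
proof (rule ccontr)
  assume "f p \<noteq> 0"
  have "AE p in lborel. f p = 0"
    using integral_nonneg_eq_0_iff_AE[of lborel f] Cc0_integrable[OF f] nn 0 by simp
  moreover have "open {p. f p \<noteq> 0}"
    using f unfolding Cc0_def by (intro open_Collect_neq) auto
  ultimately have "{p. f p \<noteq> 0} \<in> null_sets lborel"
    by (simp add: AE_iff_null_sets)
  then have "negligible {p. f p \<noteq> 0}"
    by (simp add: negligible_iff_null_sets null_sets_completionI)
  with open_not_negligible \<open>open _\<close> \<open>f p \<noteq> 0\<close> show False by blast
qed

text \<open>Fundamental lemma of the calculus of variations. Were \<open>f\<close> positive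
  somewhere, testing with a bump on a ball of positivity would give a nonnegative continuous
  function with zero integral that is nonzero at the centre; the other sign follows from
  \<open>- f\<close>.\<close>

lemma integral_Cc1_eq_0_imp:
  fixes f :: "real^'n \<Rightarrow> real"
  assumes f: "continuous_on UNIV f" and 0: "\<And>w. Cc1 w \<Longrightarrow> (LINT p|lborel. f p * w p) = 0"
  shows "f p = 0"
proof -
  have aux: "g p \<le> 0" if g: "continuous_on UNIV g" and g0: "\<And>w. Cc1 w \<Longrightarrow> (LINT p|lborel. g p * w p) = 0"
    for g :: "real^'n \<Rightarrow> real"
  proof (rule ccontr)
    assume "\<not> g p \<le> 0"
    moreover have "open {q. g q > 0}" using g by (intro open_Collect_less) auto
    ultimately obtain d where d: "d > 0" "ball p d \<subseteq> {q. g q > 0}"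
      by (metis mem_Collect_eq not_le openE)
    let ?w = "\<lambda>q. sqpos (d\<^sup>2 - (norm (q - p))\<^sup>2)"
    have w0: "?w q = 0" if "q \<notin> ball p d" for q
    proof -
      from that d have "d \<le> norm (q - p)" by (simp add: dist_norm norm_minus_commute)
      then have "d\<^sup>2 \<le> (norm (q - p))\<^sup>2" using d by (intro power_mono) auto
      then show ?thesis by (simp add: sqpos_eq_0_iff)
    qed
    have "{q. ?w q \<noteq> 0} \<subseteq> ball p d" using w0 by blast
    then have w: "Cc1 ?w" using Ck1_bump bounded_subset[OF bounded_ball] by (auto simp: Cc1_iff simp del: One_nat_def Ck.simps)
    have "g p * ?w p = 0"
    proof (rule Cc0_integral_nonneg_eq_0[of "\<lambda>q. g q * ?w q"])
      show "0 \<le> g q * ?w q" for q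
      proof (cases "q \<in> ball p d")
        case True
        with d(2) have "g q > 0" by blast
        then show ?thesis by (simp add: sqpos_nonneg)
      qed (simp add: w0)
    qed (intro Cc0_mult2 Cc1_Cc0 w g g0)+
    moreover have "g p > 0" using d centre_in_ball[of p d] by blast
    moreover have "?w p > 0" using d by (simp add: sqpos_def)
    ultimately show False by simp
  qed
  have "f p \<le> 0" by (rule aux[OF f 0])
  moreover have "- f p \<le> 0"
    by (rule aux[of "\<lambda>q. - f q"]) (use f 0 in \<open>auto intro!: continuous_intros\<close>)
  ultimately show ?thesis by simp
qed


subsection \<open>The Heisenberg vector fields\<close>

text \<open>Schwarz's theorem read off from its weak form: tested against \<open>w\<close>, each
  side becomes minus a product of first derivatives, and \<open>integral_pd_pd_commute\<close>
  exchanges those.\<close>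

lemma pd_pd_commute:
  assumes f: "Ck 2 f"
  shows "pd a (pd b f) p = pd b (pd a f) p"
proof -
  have f1: "Ck 1 f" and pf: "\<And>i. Ck 1 (pd i f)" using f by (auto simp: Ck2_iff)
  have c: "continuous_on UNIV (pd i (pd j f))" for i j by (rule Ck1_continuous_pd[OF pf])
  have "pd a (pd b f) p - pd b (pd a f) p = 0"
  proof (rule integral_Cc1_eq_0_imp[where f="\<lambda>p. pd a (pd b f) p - pd b (pd a f) p"])
    fix w :: "real^'a \<Rightarrow> real" assume w: "Cc1 w"
    have "(LINT p|lborel. (pd a (pd b f) p - pd b (pd a f) p) * w p) =
        (LINT p|lborel. pd a (pd b f) p * w p) - (LINT p|lborel. pd b (pd a f) p * w p)"
      using Cc0_integrable[OF Cc0_mult2[OF Cc1_Cc0[OF w] c]] by (simp add: left_diff_distrib)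
    also have "\<dots> = 0"
      using integral_pd_pd_commute[OF f1 w, of a b] by (simp add: integral_by_parts[OF pf w])
    finally show "(LINT p|lborel. (pd a (pd b f) p - pd b (pd a f) p) * w p) = 0" .
  qed (intro continuous_intros c)
  then show ?thesis by simp
qed

section \<open>Calculus rules for X, Y and Z\<close>

lemma pd_half_coord_mult:
  assumes g: "Ck 1 g"
  shows "pd k (\<lambda>q. q $ j * g q / 2) p = ((if k = j then g p else 0) + p $ j * pd k g p) / 2"
proof -
  have "Ck 1 (\<lambda>q. q $ j * g q)" by (intro Ck1_mult Ck1_coord g)
  from pd_cmult[OF Ck1_differentiable[OF this], of k "1 / 2" p] show ?thesis
    by (simp add: pd_mult[OF Ck1_differentiable[OF Ck1_coord] Ck1_differentiable[OF g]] pd_coord)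
qed

lemma Ck1_half_coord_mult: "Ck 1 g \<Longrightarrow> Ck 1 (\<lambda>q. q $ j * g q / 2)"
  using Ck1_cmult[OF Ck1_mult[OF Ck1_coord, of g j], of "1 / 2"] by simp

lemma XH_mult: "Ck 1 f \<Longrightarrow> Ck 1 g \<Longrightarrow> XH (\<lambda>q. f q * g q) p = XH f p * g p + f p * XH g p"
  and YH_mult: "Ck 1 f \<Longrightarrow> Ck 1 g \<Longrightarrow> YH (\<lambda>q. f q * g q) p = YH f p * g p + f p * YH g p"
  by (simp_all add: XH_def YH_def pd_mult Ck1_differentiable algebra_simps del: One_nat_def Ck.simps)

lemma XH_add: "Ck 1 f \<Longrightarrow> Ck 1 g \<Longrightarrow> XH (\<lambda>q. f q + g q) p = XH f p + XH g p"
  and YH_add: "Ck 1 f \<Longrightarrow> Ck 1 g \<Longrightarrow> YH (\<lambda>q. f q + g q) p = YH f p + YH g p"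
  by (simp_all add: XH_def YH_def pd_add Ck1_differentiable algebra_simps del: One_nat_def Ck.simps)

lemma XH_diff: "Ck 1 f \<Longrightarrow> Ck 1 g \<Longrightarrow> XH (\<lambda>q. f q - g q) p = XH f p - XH g p"
  and YH_diff: "Ck 1 f \<Longrightarrow> Ck 1 g \<Longrightarrow> YH (\<lambda>q. f q - g q) p = YH f p - YH g p"
  by (simp_all add: XH_def YH_def pd_diff Ck1_differentiable algebra_simps del: One_nat_def Ck.simps)

lemma XH_cmult: "Ck 1 f \<Longrightarrow> XH (\<lambda>q. c * f q) p = c * XH f p"
  and YH_cmult: "Ck 1 f \<Longrightarrow> YH (\<lambda>q. c * f q) p = c * YH f p"
  by (simp_all add: XH_def YH_def pd_cmult Ck1_differentiable algebra_simps del: One_nat_def Ck.simps)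

lemma XH_sum: "(\<And>i. i \<in> I \<Longrightarrow> Ck 1 (f i)) \<Longrightarrow> XH (\<lambda>q. \<Sum>i\<in>I. f i q) p = (\<Sum>i\<in>I. XH (f i) p)"
  and YH_sum: "(\<And>i. i \<in> I \<Longrightarrow> Ck 1 (f i)) \<Longrightarrow> YH (\<lambda>q. \<Sum>i\<in>I. f i q) p = (\<Sum>i\<in>I. YH (f i) p)"
  by (simp_all add: XH_def YH_def pd_sum sum_distrib_left sum_subtractf sum.distrib del: One_nat_def Ck.simps)

lemma XH_real_comp:
  assumes "Ck 1 f" "(h has_real_derivative h') (at (f p))"
  shows "XH (\<lambda>q. h (f q)) p = h' * XH f p" "YH (\<lambda>q. h (f q)) p = h' * YH f p"
  using assms by (simp_all add: XH_def YH_def pd_real_comp[OF Ck1_differentiable] algebra_simps del: One_nat_def Ck.simps)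

lemma XH_coord:
  "XH (\<lambda>q. q $ 1) p = 1" "XH (\<lambda>q. q $ 2) p = 0" "XH (\<lambda>q. q $ 3) p = - p $ 2 / 2"
  "YH (\<lambda>q. q $ 1) p = 0" "YH (\<lambda>q. q $ 2) p = 1" "YH (\<lambda>q. q $ 3) p = p $ 1 / 2"
  by (simp_all add: XH_def YH_def pd_coord)

lemma continuous_XH: "Ck 1 f \<Longrightarrow> continuous_on UNIV (XH f)"
  and continuous_YH: "Ck 1 f \<Longrightarrow> continuous_on UNIV (YH f)"
  and continuous_ZH: "Ck 1 f \<Longrightarrow> continuous_on UNIV (ZH f)"
  unfolding XH_def[abs_def] YH_def[abs_def] ZH_def
  by (intro continuous_intros Ck1_continuous_pd; simp del: One_nat_def Ck.simps)+

lemma Cc0_XH: "Cc1 f \<Longrightarrow> Cc0 (XH f)" and Cc0_YH: "Cc1 f \<Longrightarrow> Cc0 (YH f)"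
  unfolding XH_def[abs_def] YH_def[abs_def]
  by (intro Cc0_diff Cc0_add Cc0_mult2 Cc1_pd_Cc0 continuous_intros; simp)+

lemma Ck1_XH: "Ck 2 f \<Longrightarrow> Ck 1 (XH f)" and Ck1_YH: "Ck 2 f \<Longrightarrow> Ck 1 (YH f)"
  and Ck1_ZH: "Ck 2 f \<Longrightarrow> Ck 1 (ZH f)"
  by (simp_all add: XH_def[abs_def] YH_def[abs_def] ZH_def Ck2_iff Ck1_add Ck1_diff Ck1_half_coord_mult
      del: One_nat_def Ck.simps)

lemma Ck2_Ck1: "Ck 2 f \<Longrightarrow> Ck 1 f"
  by (simp add: Ck2_iff)

lemma pd_XH:
  assumes f: "Ck 2 f"
  shows "pd k (XH f) p = pd k (pd 1 f) p - (if k = 2 then 1 / 2 else 0) * pd 3 f p - p $ 2 / 2 * pd k (pd 3 f) p"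
    and "pd k (YH f) p = pd k (pd 2 f) p + (if k = 1 then 1 / 2 else 0) * pd 3 f p + p $ 1 / 2 * pd k (pd 3 f) p"
proof -
  have f1: "Ck 1 f" and pf: "\<And>i. Ck 1 (pd i f)" using f by (auto simp: Ck2_iff)
  show "pd k (XH f) p = pd k (pd 1 f) p - (if k = 2 then 1 / 2 else 0) * pd 3 f p - p $ 2 / 2 * pd k (pd 3 f) p"
    "pd k (YH f) p = pd k (pd 2 f) p + (if k = 1 then 1 / 2 else 0) * pd 3 f p + p $ 1 / 2 * pd k (pd 3 f) p"
    unfolding XH_def[abs_def] YH_def[abs_def]
    by (simp_all add: pd_diff pd_add pd_half_coord_mult Ck1_differentiable pf Ck1_half_coord_mult add_divide_distrib
        del: One_nat_def Ck.simps)
qed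

text \<open>Z is the bracket of X and Y and is central. Each identity involves only second
  derivatives of \<open>f\<close>, so \<open>Ck 2\<close> suffices.\<close>

lemma HH_commutator:
  assumes f: "Ck 2 f"
  shows "YH (XH f) p = XH (YH f) p - ZH f p" "ZH (XH f) p = XH (ZH f) p" "ZH (YH f) p = YH (ZH f) p"
  unfolding ZH_def
  by (simp_all add: XH_def[of "XH f"] XH_def[of "YH f"] YH_def[of "XH f"] YH_def[of "YH f"] pd_XH[OF f],
      simp_all add: XH_def YH_def pd_pd_commute[OF f, of 2 1] pd_pd_commute[OF f, of 3 1] pd_pd_commute[OF f, of 3 2] field_simps)

text \<open>The coefficient of \<open>pd 3\<close> in X and Y does not depend on z (the case
  \<open>j \<noteq> 3\<close> in the proof), so both fields are divergence free and formally
  antisymmetric.\<close>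

lemma integral_by_parts_H:
  assumes v: "Ck 1 v" and w: "Cc1 w"
  shows "(LINT p|lborel. XH v p * w p) = - (LINT p|lborel. v p * XH w p)"
    and "(LINT p|lborel. YH v p * w p) = - (LINT p|lborel. v p * YH w p)"
proof -
  have w1: "Ck 1 w" by (rule Cc1_Ck1[OF w])
  have I: "(LINT p|lborel. pd k v p * w p) = - (LINT p|lborel. v p * pd k w p)" for k
    by (rule integral_by_parts[OF v w])
  have J: "(LINT p|lborel. pd 3 v p * (p $ j / 2 * w p)) = - (LINT p|lborel. v p * (p $ j / 2 * pd 3 w p))" if "j \<noteq> 3" for j
  proof -
    have "Cc1 (\<lambda>p. (1 / 2 * p $ j) * w p)" by (intro Cc1_mult2 w Ck1_cmult Ck1_coord)
    then have "Cc1 (\<lambda>p. p $ j * w p / 2)" by simp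
    from integral_by_parts[OF v this, of 3] show ?thesis using that
      by (simp add: pd_half_coord_mult w1 del: One_nat_def Ck.simps)
  qed
  have i1: "integrable lborel (\<lambda>p. pd k v p * w p)" "integrable lborel (\<lambda>p. v p * pd k w p)"
    "integrable lborel (\<lambda>p. pd k v p * (p $ j / 2 * w p))" "integrable lborel (\<lambda>p. v p * (p $ j / 2 * pd k w p))" for k j
    by (intro Cc0_integrable Cc0_mult2 Cc1_Cc0 Cc1_pd_Cc0 w Ck1_continuous Ck1_continuous_pd v continuous_intros; simp)+
  show "(LINT p|lborel. XH v p * w p) = - (LINT p|lborel. v p * XH w p)"
    using I[of 1] J[of 2] i1 by (simp add: XH_def algebra_simps)
  show "(LINT p|lborel. YH v p * w p) = - (LINT p|lborel. v p * YH w p)"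
    using I[of 2] J[of 1] i1 by (simp add: YH_def algebra_simps)
qed

text \<open>Formally the left side is minus the integral of \<open>v\<close> times
  \<open>[X, Y] w\<close>. As \<open>v\<close> and \<open>w\<close> are only C1, the integrand is
  instead expanded into Euclidean 2 by 2 minors of first derivatives, which are null Lagrangians by
  \<open>integral_pd_pd_commute\<close>.\<close>

lemma integral_XH_YH_null:
  assumes v: "Ck 1 v" and w: "Cc1 w"
  shows "(LINT p|lborel. XH v p * YH w p - YH v p * XH w p) = (LINT p|lborel. ZH v p * w p)"
proof -
  have w1: "Ck 1 w" by (rule Cc1_Ck1[OF w])
  have cw: "Cc1 (\<lambda>p. p $ j * w p)" for j by (intro Cc1_mult2 w Ck1_coord)
  have pdw: "pd k (\<lambda>p. p $ j * w p) p = (if k = j then 1 else 0) * w p + p $ j * pd k w p" for k j p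
    by (simp add: pd_mult pd_coord Ck1_differentiable w1 Ck1_coord del: One_nat_def Ck.simps)
  have N: "(LINT p|lborel. pd a v p * pd b w p - pd b v p * pd a w p) = 0" if w: "Cc1 w" for w a b
  proof -
    have "integrable lborel (\<lambda>p. pd a v p * pd b w p)" for a b
      by (intro Cc0_integrable Cc0_mult2 Cc1_pd_Cc0 w Ck1_continuous_pd v)
    then show ?thesis using integral_pd_pd_commute[OF v w, of a b] by simp
  qed
  let ?N = "\<lambda>a b w p. pd a v p * pd b w p - pd b v p * pd a w p"
  have iN: "integrable lborel (?N a b w)" if "Cc1 w" for a b w
    by (intro Bochner_Integration.integrable_diff Cc0_integrable Cc0_mult2 Cc1_pd_Cc0 that Ck1_continuous_pd v)
  have iz: "integrable lborel (\<lambda>p. ZH v p * w p)"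
    unfolding ZH_def by (intro Cc0_integrable Cc0_mult2 Cc1_Cc0 w Ck1_continuous_pd v)
  \<comment> \<open>Putting the coordinate inside the test function costs
    \<open>- ZH v p * w p / 2\<close> in each of the two weighted minors; the last summand
    compensates both.\<close>
  have "XH v p * YH w p - YH v p * XH w p =
      ?N 1 2 w p - 1 / 2 * ?N 3 2 (\<lambda>p. p $ 2 * w p) p + 1 / 2 * ?N 1 3 (\<lambda>p. p $ 1 * w p) p + ZH v p * w p" for p
    unfolding pdw by (simp add: XH_def YH_def ZH_def field_simps)
  then have "(LINT p|lborel. XH v p * YH w p - YH v p * XH w p) =
    (LINT p|lborel. ?N 1 2 w p - 1 / 2 * ?N 3 2 (\<lambda>p. p $ 2 * w p) p + 1 / 2 * ?N 1 3 (\<lambda>p. p $ 1 * w p) p + ZH v p * w p)"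
    by simp
  also have "\<dots> = (LINT p|lborel. ?N 1 2 w p) - 1 / 2 * (LINT p|lborel. ?N 3 2 (\<lambda>p. p $ 2 * w p) p)
      + 1 / 2 * (LINT p|lborel. ?N 1 3 (\<lambda>p. p $ 1 * w p) p) + (LINT p|lborel. ZH v p * w p)"
    using iN[OF w, of 1 2] iN[OF cw, of 3 2 2] iN[OF cw, of 1 3 1] iz
    by (simp only: Bochner_Integration.integral_add Bochner_Integration.integral_diff Bochner_Integration.integrable_add
        Bochner_Integration.integrable_diff integrable_mult_right integral_mult_right_zero simp_thms)
  finally show ?thesis by (simp only: N[OF w] N[OF cw])
qed

text \<open>The X and Y derivatives of the equation in weak form, since third derivatives of
  \<open>f\<close> need not exist. The factor 2 has two sources: one Z term comes from
  \<open>integral_XH_YH_null\<close>, the other from integrating by parts the commutator in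
  \<open>YH (XH f)\<close> or \<open>XH (YH f)\<close>.\<close>

lemma weak_commuted_equation:
  assumes f: "Ck 2 f" and h: "Ck 1 h" and eq: "\<And>p. XH (XH f) p + YH (YH f) p = h p" and w: "Cc1 w"
  shows "(LINT p|lborel. XH (XH f) p * XH w p + YH (XH f) p * YH w p) =
      - (LINT p|lborel. XH h p * w p) + 2 * (LINT p|lborel. ZH (YH f) p * w p)" (is ?A)
    and "(LINT p|lborel. XH (YH f) p * XH w p + YH (YH f) p * YH w p) =
      - (LINT p|lborel. YH h p * w p) - 2 * (LINT p|lborel. ZH (XH f) p * w p)" (is ?B)
proof -
  note w1 = Cc1_Ck1[OF w] and X = Ck1_XH[OF f] and Y = Ck1_YH[OF f] and Z = Ck1_ZH[OF f]
  note ci = Cc0_integrable[OF Cc0_mult2] Cc0_XH[OF w] Cc0_YH[OF w] Cc1_Cc0[OF w] Ck1_continuous[OF h]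
    continuous_XH[OF X] continuous_XH[OF Y] continuous_YH[OF X] continuous_YH[OF Y] continuous_ZH[OF Ck2_Ck1[OF f]]
    continuous_ZH[OF X] continuous_ZH[OF Y] continuous_YH[OF Z] continuous_XH[OF Z]
  have "XH (XH f) p * XH w p + YH (XH f) p * YH w p =
      h p * XH w p + (XH (YH f) p * YH w p - YH (YH f) p * XH w p) - ZH f p * YH w p" for p
    by (simp add: HH_commutator[OF f] algebra_simps flip: eq)
  then have "(LINT p|lborel. XH (XH f) p * XH w p + YH (XH f) p * YH w p) =
      (LINT p|lborel. h p * XH w p) + (LINT p|lborel. XH (YH f) p * YH w p - YH (YH f) p * XH w p) - (LINT p|lborel. ZH f p * YH w p)"
    by (simp add: ci)
  also have "\<dots> = - (LINT p|lborel. XH h p * w p) + 2 * (LINT p|lborel. ZH (YH f) p * w p)"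
    using integral_by_parts_H(1)[OF h w] integral_by_parts_H(2)[OF Z w] integral_XH_YH_null[OF Y w]
    by (simp add: HH_commutator[OF f])
  finally show ?A .
  have "XH (YH f) p * XH w p + YH (YH f) p * YH w p =
      h p * YH w p - (XH (XH f) p * YH w p - YH (XH f) p * XH w p) + ZH f p * XH w p" for p
    by (simp add: HH_commutator[OF f] algebra_simps flip: eq)
  then have "(LINT p|lborel. XH (YH f) p * XH w p + YH (YH f) p * YH w p) =
      (LINT p|lborel. h p * YH w p) - (LINT p|lborel. XH (XH f) p * YH w p - YH (XH f) p * XH w p) + (LINT p|lborel. ZH f p * XH w p)"
    by (simp add: ci)
  also have "\<dots> = - (LINT p|lborel. YH h p * w p) - 2 * (LINT p|lborel. ZH (XH f) p * w p)"
    using integral_by_parts_H(2)[OF h w] integral_by_parts_H(1)[OF Z w] integral_XH_YH_null[OF X w]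
    by (simp add: HH_commutator[OF f])
  finally show ?B .
qed

text \<open>Removes the second derivatives from the current that multiplies \<lambda> in the energy
  of the rotated fields. Up to first order terms the integrand is
  \<open>w p * (XH f p * YH T p - YH f p * XH T p)\<close>, which \<open>integral_XH_YH_null\<close>
  integrates with test function \<open>w * T\<close>; the terms left over produce the positive
  density \<open>(XH f p)\<^sup>2 + (YH f p)\<^sup>2\<close>.\<close>

lemma integral_rotation_current:
  assumes f: "Ck 2 f" and w: "Cc1 w"
  defines "T \<equiv> \<lambda>p. p $ 1 * YH f p - p $ 2 * XH f p"
  shows "(LINT p|lborel. w p * (XH f p * (p $ 1 * YH (YH f) p - p $ 2 * XH (YH f) p)
                              - YH f p * (p $ 1 * YH (XH f) p - p $ 2 * XH (XH f) p)))
    = (LINT p|lborel. w p * ((XH f p)\<^sup>2 + (YH f p)\<^sup>2) + 2 * (w p * T p * ZH f p) - T p * (XH f p * YH w p - YH f p * XH w p))"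
proof -
  note w1 = Cc1_Ck1[OF w] and X = Ck1_XH[OF f] and Y = Ck1_YH[OF f] and Z = Ck1_ZH[OF f]
  have T: "Ck 1 T" unfolding T_def by (intro Ck1_diff Ck1_mult Ck1_coord X Y)
  have wT: "Cc1 (\<lambda>q. w q * T q)" by (rule Cc1_mult1[OF w T])
  note c = continuous_XH[OF X] continuous_XH[OF Y] continuous_YH[OF X] continuous_YH[OF Y] continuous_ZH[OF Ck2_Ck1[OF f]]
    Ck1_continuous[OF T] Ck1_continuous[OF X] Ck1_continuous[OF Y]
  have XT: "XH T p = YH f p + p $ 1 * XH (YH f) p - p $ 2 * XH (XH f) p"
    and YT: "YH T p = p $ 1 * YH (YH f) p - XH f p - p $ 2 * YH (XH f) p" for p
    unfolding T_def by (simp_all add: XH_diff XH_mult YH_diff YH_mult Ck1_mult Ck1_coord X Y XH_coord del: One_nat_def Ck.simps)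
  let ?L = "\<lambda>p. w p * (XH f p * (p $ 1 * YH (YH f) p - p $ 2 * XH (YH f) p)
                              - YH f p * (p $ 1 * YH (XH f) p - p $ 2 * XH (XH f) p))"
  let ?R = "\<lambda>p. w p * ((XH f p)\<^sup>2 + (YH f p)\<^sup>2) + 2 * (w p * T p * ZH f p) - T p * (XH f p * YH w p - YH f p * XH w p)"
  let ?N = "\<lambda>p. XH f p * YH (\<lambda>q. w q * T q) p - YH f p * XH (\<lambda>q. w q * T q) p" and ?Z = "\<lambda>p. ZH f p * (w p * T p)"
  have pt: "?L p = ?R p + ?N p - ?Z p" for p
    by (simp add: XH_mult YH_mult w1 T XT YT HH_commutator[OF f] del: One_nat_def Ck.simps)
       (simp add: T_def algebra_simps power2_eq_square)
  have iN: "integrable lborel ?N" "integrable lborel ?Z" "integrable lborel ?R"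
    by (intro Cc0_integrable Cc0_diff Cc0_add Cc0_mult2 Cc0_mult1 Cc0_XH Cc0_YH wT w Cc1_Cc0 continuous_intros c)+
  have "(LINT p|lborel. ?L p) = (LINT p|lborel. ?R p) + (LINT p|lborel. ?N p) - (LINT p|lborel. ?Z p)"
    unfolding pt using iN by (simp only: Bochner_Integration.integral_add Bochner_Integration.integral_diff Bochner_Integration.integrable_add simp_thms)
  also have "(LINT p|lborel. ?N p) = (LINT p|lborel. ?Z p)"
    by (rule integral_XH_YH_null[OF Ck2_Ck1[OF f] wT])
  finally show ?thesis by simp
qed


subsection \<open>Cutoff functions adapted to the gauge balls\<close>

text \<open>A C1 profile that equals 1 up to 1 and 0 from 16 on. It is applied to the fourth power
  of the gauge, so 16 = 2^4 corresponds to doubling the radius.\<close>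

definition hcut :: "real \<Rightarrow> real" where
  "hcut s = sqpos (1 - sqpos ((s - 1) / 15))"

definition hcut' :: "real \<Rightarrow> real" where
  "hcut' s = - (2 * max 0 (1 - sqpos ((s - 1) / 15)) * (2 * max 0 ((s - 1) / 15) / 15))"

lemma hcut_deriv: "(hcut has_real_derivative hcut' s) (at s)"
proof -
  have 1: "((\<lambda>s. (s - 1) / 15) has_real_derivative 1 / 15) (at s)"
    by (auto intro!: derivative_eq_intros)
  have "((\<lambda>s. 1 - sqpos ((s - 1) / 15)) has_real_derivative 0 - 2 * max 0 ((s - 1) / 15) * (1 / 15)) (at s)"
    by (intro DERIV_diff DERIV_const DERIV_chain2[OF sqpos_deriv 1])
  from DERIV_chain2[OF sqpos_deriv this] show ?thesis
    by (simp add: hcut_def[abs_def] hcut'_def)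
qed

lemma hcut_nonneg: "0 \<le> hcut s" and hcut_le_1: "hcut s \<le> 1"
  and hcut_eq_1: "s \<le> 1 \<Longrightarrow> hcut s = 1" and hcut_eq_0: "16 \<le> s \<Longrightarrow> hcut s = 0"
proof -
  show "0 \<le> hcut s" by (simp add: hcut_def sqpos_nonneg)
  have "max 0 (1 - sqpos ((s - 1) / 15)) \<le> 1" using sqpos_nonneg[of "(s - 1) / 15"] by simp
  then show "hcut s \<le> 1" by (simp add: hcut_def sqpos_def[of "1 - _"] power_le_one)
  show "hcut s = 1" if "s \<le> 1" using that by (simp add: hcut_def sqpos_def)
  show "hcut s = 0" if "16 \<le> s"
  proof -
    have "1\<^sup>2 \<le> (max 0 ((s - 1) / 15))\<^sup>2" using that by (intro power_mono) auto
    then show ?thesis by (simp add: hcut_def sqpos_def)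
  qed
qed

lemma hcut_antimono: "s \<le> t \<Longrightarrow> hcut t \<le> hcut s"
  unfolding hcut_def sqpos_def by (intro power_mono diff_mono max.mono) auto

lemma hcut'_eq_0: "s \<le> 1 \<or> 16 \<le> s \<Longrightarrow> hcut' s = 0"
proof (elim disjE)
  assume "16 \<le> s"
  then have "1\<^sup>2 \<le> (max 0 ((s - 1) / 15))\<^sup>2" by (intro power_mono) auto
  then show "hcut' s = 0" by (simp add: hcut'_def sqpos_def)
qed (simp add: hcut'_def)

lemma hcut'_le: "\<bar>hcut' s\<bar> \<le> 1"
proof (cases "s \<le> 1 \<or> 16 \<le> s")
  case False
  then have "0 \<le> (s - 1) / 15" "(s - 1) / 15 \<le> 1" by auto
  moreover have "max 0 (1 - sqpos ((s - 1) / 15)) \<le> 1" using sqpos_nonneg[of "(s - 1) / 15"] by simp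
  ultimately have "max 0 (1 - sqpos ((s - 1) / 15)) * ((s - 1) / 15) \<le> 1 * 1"
    by (intro mult_mono) auto
  moreover have "\<bar>hcut' s\<bar> = 4 / 15 * (max 0 (1 - sqpos ((s - 1) / 15)) * ((s - 1) / 15))"
    using False by (simp add: hcut'_def abs_mult max_def)
  ultimately show ?thesis by simp
qed (simp add: hcut'_eq_0)

lemma continuous_hcut': "continuous_on UNIV hcut'"
  unfolding hcut'_def[abs_def] sqpos_def by (intro continuous_intros) auto

abbreviation (input) rsq :: "real^3 \<Rightarrow> real" where "rsq p \<equiv> (p $ 1)\<^sup>2 + (p $ 2)\<^sup>2"

text \<open>The fourth power of the homogeneous gauge defining \<open>ballH\<close>; as a polynomial
  it is C1 at the origin too, which the gauge itself is not.\<close>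

definition gauge4 :: "real^3 \<Rightarrow> real" where
  "gauge4 p = (rsq p)\<^sup>2 + (p $ 3)\<^sup>2"

definition cutoff :: "real \<Rightarrow> real^3 \<Rightarrow> real" where
  "cutoff R p = hcut (gauge4 p / R ^ 4)"

lemma ballH_iff: "p \<in> ballH R \<longleftrightarrow> gauge4 p < R ^ 4"
  by (simp add: ballH_def gauge4_def)

lemma Ck1_gauge4: "Ck 1 gauge4"
  unfolding gauge4_def[abs_def] by (intro Ck1_add Ck1_power Ck1_coord)

lemma pd_gauge4:
  "pd 1 gauge4 p = 4 * rsq p * p $ 1" "pd 2 gauge4 p = 4 * rsq p * p $ 2" "pd 3 gauge4 p = 2 * p $ 3"
  unfolding gauge4_def[abs_def] power2_eq_square
  by (simp_all add: pd_add pd_mult pd_coord Ck1_differentiable Ck1_add Ck1_mult Ck1_coord algebra_simps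
      del: One_nat_def Ck.simps)

lemma bounded_gauge4: "bounded {p. gauge4 p \<le> K}"
proof -
  have "norm p \<le> 3 * (1 + \<bar>K\<bar>)" if "gauge4 p \<le> K" for p
  proof -
    have sq: "\<bar>t\<bar> \<le> 1 + \<bar>K\<bar>" if "t\<^sup>2 \<le> K" for t :: real
    proof (rule ccontr)
      assume "\<not> \<bar>t\<bar> \<le> 1 + \<bar>K\<bar>"
      then have "(1 + \<bar>K\<bar>) * 1 < \<bar>t\<bar> * \<bar>t\<bar>" by (intro mult_strict_mono) auto
      then show False using that by (simp add: power2_eq_square abs_mult_self_eq)
    qed
    have r: "(rsq p)\<^sup>2 \<le> K" and z: "(p $ 3)\<^sup>2 \<le> K" using that by (simp_all add: gauge4_def add_increasing add_increasing2) (smt (verit) zero_le_power2)+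
    have "rsq p \<le> 1 + \<bar>K\<bar>" using sq[OF r] by simp
    then have "(p $ j)\<^sup>2 \<le> (1 + \<bar>K\<bar>)\<^sup>2" if "j \<in> {1, 2}" for j
      using that mult_mono[of 1 "1 + \<bar>K\<bar>" "1 + \<bar>K\<bar>" "1 + \<bar>K\<bar>"] by (auto simp: power2_eq_square) (smt (verit) zero_le_square)+
    then have "\<bar>p $ j\<bar> \<le> 1 + \<bar>K\<bar>" if "j \<in> {1, 2}" for j
      using that abs_le_square_iff[of "p $ j" "1 + \<bar>K\<bar>"] by auto
    with sq[OF z] have "\<bar>p $ j\<bar> \<le> 1 + \<bar>K\<bar>" for j using exhaust_3[of j] by auto
    then have "(\<Sum>j\<in>UNIV. \<bar>p $ j\<bar>) \<le> (\<Sum>j\<in>(UNIV::3 set). 1 + \<bar>K\<bar>)" by (intro sum_mono)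
    with norm_le_l1_cart[of p] show ?thesis by (simp add: sum_constant)
  qed
  then show ?thesis unfolding bounded_iff by blast
qed

text \<open>Places any given point, or any bounded support, inside a gauge ball of explicit
  radius.\<close>

lemma gauge4_le_norm: "gauge4 p \<le> (1 + norm p) ^ 4"
proof -
  have "(norm p)\<^sup>2 = rsq p + (p $ 3)\<^sup>2"
    unfolding power2_norm_eq_inner inner_vec_def sum_3 by (simp add: power2_eq_square)
  then have "gauge4 p \<le> ((norm p)\<^sup>2)\<^sup>2 + (norm p)\<^sup>2"
    unfolding gauge4_def by (intro add_mono[OF power_mono]) auto
  also have "\<dots> \<le> (1 + norm p) ^ 4"
  proof -
    have "0 \<le> norm p" by simp
    then have "0 \<le> 4 * norm p + 4 * norm p ^ 3 + 5 * (norm p)\<^sup>2" by simp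
    then show ?thesis by (simp add: power2_eq_square power4_eq_xxxx algebra_simps power3_eq_cube)
  qed
  finally show ?thesis .
qed

context
  fixes R :: real assumes R: "R > 0"
begin

lemma Ck1_cutoff: "Ck 1 (cutoff R)"
  unfolding cutoff_def[abs_def] divide_inverse
  by (intro Ck1_real_comp[OF _ hcut_deriv continuous_hcut'] Ck1_mult Ck1_const Ck1_gauge4)

lemma cutoff_eq_0: "16 * R ^ 4 \<le> gauge4 p \<Longrightarrow> cutoff R p = 0"
  unfolding cutoff_def using R by (intro hcut_eq_0) (simp add: field_simps)

lemma cutoff_eq_1: "gauge4 p \<le> R ^ 4 \<Longrightarrow> cutoff R p = 1"
  unfolding cutoff_def using R by (intro hcut_eq_1) (simp add: field_simps)

lemma Cc1_cutoff: "Cc1 (cutoff R)"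
  unfolding Cc1_iff
  by (intro conjI Ck1_cutoff bounded_subset[OF bounded_gauge4[of "16 * R ^ 4"]]) (use cutoff_eq_0 linear in blast)

lemma pd_cutoff: "pd k (cutoff R) p = hcut' (gauge4 p / R ^ 4) * (pd k gauge4 p / R ^ 4)"
proof -
  have "(\<lambda>q. gauge4 q / R ^ 4) = (\<lambda>q. inverse (R ^ 4) * gauge4 q)" by (simp add: field_simps)
  then have 1: "Ck 1 (\<lambda>q. gauge4 q / R ^ 4)" "pd k (\<lambda>q. gauge4 q / R ^ 4) p = pd k gauge4 p / R ^ 4"
    using Ck1_cmult[OF Ck1_gauge4, of "inverse (R ^ 4)"] pd_cmult[OF Ck1_differentiable[OF Ck1_gauge4], of k "inverse (R ^ 4)" p]
    by (simp_all only:) (simp add: field_simps)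
  show ?thesis
    unfolding cutoff_def[abs_def] pd_real_comp[OF Ck1_differentiable[OF 1(1)] hcut_deriv] 1(2) ..
qed

lemma XH_cutoff:
  "XH (cutoff R) p = hcut' (gauge4 p / R ^ 4) * (XH gauge4 p / R ^ 4)"
  "YH (cutoff R) p = hcut' (gauge4 p / R ^ 4) * (YH gauge4 p / R ^ 4)"
  using R by (simp_all add: XH_def YH_def pd_cutoff field_simps)

lemma grad_cutoff_eq_0:
  assumes "gauge4 p \<le> R ^ 4 \<or> 16 * R ^ 4 \<le> gauge4 p"
  shows "XH (cutoff R) p = 0" "YH (cutoff R) p = 0"
proof -
  have "hcut' (gauge4 p / R ^ 4) = 0"
    using assms R by (intro hcut'_eq_0) (auto simp: field_simps)
  then show "XH (cutoff R) p = 0" "YH (cutoff R) p = 0" by (simp_all add: XH_cutoff)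
qed

text \<open>The squared horizontal gradient of the gauge polynomial is
  \<open>rsq p * (16 * (rsq p)\<^sup>2 + (p $ 3)\<^sup>2)\<close>. The factor \<open>rsq p\<close>
  is what matches the weight x^2 + y^2 of the growth hypothesis. The constant is 16 * 16: one factor
  from this polynomial, one from \<open>gauge4 p < 16 * R ^ 4\<close>.\<close>

lemma grad_cutoff_le:
  "(XH (cutoff R) p)\<^sup>2 + (YH (cutoff R) p)\<^sup>2 \<le> 256 / R ^ 4 * (indicator (ballH (2 * R)) p * rsq p)"
proof (cases "gauge4 p < 16 * R ^ 4")
  case True
  have "(XH gauge4 p)\<^sup>2 + (YH gauge4 p)\<^sup>2 = rsq p * (16 * (rsq p)\<^sup>2 + (p $ 3)\<^sup>2)"
    by (simp add: XH_def YH_def pd_gauge4 power2_eq_square algebra_simps)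
  also have "\<dots> \<le> rsq p * (16 * gauge4 p)"
    by (intro mult_left_mono) (auto simp: gauge4_def)
  also have "\<dots> \<le> rsq p * (16 * (16 * R ^ 4))"
    using True by (intro mult_left_mono) auto
  finally have g: "(XH gauge4 p)\<^sup>2 + (YH gauge4 p)\<^sup>2 \<le> 256 * R ^ 4 * rsq p" by (simp add: mult.commute)
  have "(hcut' (gauge4 p / R ^ 4))\<^sup>2 \<le> 1"
    using hcut'_le[of "gauge4 p / R ^ 4"] by (simp add: abs_square_le_1)
  then have "(hcut' (gauge4 p / R ^ 4))\<^sup>2 * (((XH gauge4 p)\<^sup>2 + (YH gauge4 p)\<^sup>2) / (R ^ 4)\<^sup>2) \<le>
      1 * (256 * R ^ 4 * rsq p / (R ^ 4)\<^sup>2)"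
    using R by (intro mult_mono divide_right_mono g) auto
  also have "\<dots> = 256 / R ^ 4 * rsq p"
  proof -
    have "k * c * r / c\<^sup>2 = k / c * r" if "c \<noteq> 0" for k c r :: real
      using that by (simp add: power2_eq_square)
    from this[of "R ^ 4" 256 "rsq p"] show ?thesis using R by simp
  qed
  finally have "(hcut' (gauge4 p / R ^ 4))\<^sup>2 * (((XH gauge4 p)\<^sup>2 + (YH gauge4 p)\<^sup>2) / (R ^ 4)\<^sup>2) \<le> 256 / R ^ 4 * rsq p" .
  moreover have "p \<in> ballH (2 * R)" using True by (simp add: ballH_iff power_mult_distrib)
  ultimately show ?thesis by (simp add: XH_cutoff power_mult_distrib power_divide distrib_left add_divide_distrib)
next
  case False
  then show ?thesis using grad_cutoff_eq_0[of p] by simp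
qed

lemma cutoff_sq_le: "(cutoff R p)\<^sup>2 \<le> indicator (ballH (2 * R)) p"
proof (cases "gauge4 p < 16 * R ^ 4")
  case True
  then show ?thesis using hcut_nonneg hcut_le_1 by (simp add: ballH_iff power_mult_distrib cutoff_def power_le_one)
qed (simp add: cutoff_eq_0)

end

lemma integrable_on_ballH:
  fixes f :: "real^3 \<Rightarrow> real"
  assumes "continuous_on UNIV f"
  shows "integrable lborel (\<lambda>p. indicator (ballH R) p * f p)"
proof -
  let ?S = "{p. gauge4 p \<le> R ^ 4}"
  have c: "continuous_on UNIV gauge4" by (rule Ck1_continuous[OF Ck1_gauge4])
  have "closed ?S" by (intro closed_Collect_le c continuous_intros)
  then have "compact ?S" using bounded_gauge4 by (simp add: compact_eq_bounded_closed)
  then have "set_integrable lborel ?S f"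
    unfolding set_integrable_def by (rule borel_integrable_compact) (rule continuous_on_subset[OF assms], simp)
  moreover have "open (ballH R)"
    using open_Collect_less[OF c continuous_on_const, of "R ^ 4"] ballH_iff by (metis (lifting) Collect_cong Collect_mem_eq)
  ultimately have "set_integrable lborel (ballH R) f"
    by (intro set_integrable_subset[where A="?S" and B="ballH R"]) (auto simp: ballH_iff)
  then show ?thesis by (simp add: set_integrable_def)
qed

text \<open>Dilation of z by \<open>s\<close>, written as a translation along the third axis by a
  point-dependent amount, so that z-invariance of a factor applies to it verbatim.\<close>

lemma lborel_integral_scale_z:
  fixes f :: "real^3 \<Rightarrow> real"
  assumes [measurable]: "f \<in> borel_measurable borel" and s: "s > 0"
  shows "(LINT p|lborel. f p) = s * (LINT p|lborel. f (p + ((s - 1) * p $ 3) *\<^sub>R axis 3 1))"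
proof -
  let ?c = "\<lambda>j::real^3. if j = axis 3 1 then s else 1"
  let ?T = "\<lambda>x::real^3. 0 + (\<Sum>j\<in>Basis. (?c j * (x \<bullet> j)) *\<^sub>R j)"
  have B: "axis 3 1 \<in> (Basis :: (real^3) set)" by (simp add: axis_in_Basis_iff)
  have T: "?T x = x + ((s - 1) * x $ 3) *\<^sub>R axis 3 1" for x
  proof -
    have "?T x = (\<Sum>j\<in>Basis. (x \<bullet> j) *\<^sub>R j + (if j = axis 3 1 then ((s - 1) * (x \<bullet> j)) *\<^sub>R j else 0))"
      unfolding add_0_left by (intro sum.cong) (auto simp: algebra_simps)
    also have "\<dots> = x + (\<Sum>j\<in>Basis. if j = axis 3 1 then ((s - 1) * (x \<bullet> j)) *\<^sub>R j else 0)"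
      by (simp only: sum.distrib euclidean_representation)
    also have "(\<Sum>j\<in>Basis. if j = axis 3 1 then ((s - 1) * (x \<bullet> j)) *\<^sub>R j else 0) = ((s - 1) * x $ 3) *\<^sub>R axis 3 (1::real)"
      using B by (simp add: inner_axis)
    finally show ?thesis .
  qed
  have prod: "(\<Prod>j\<in>Basis. \<bar>?c j\<bar>) = s"
  proof -
    have "(\<Prod>j\<in>Basis. \<bar>?c j\<bar>) = (\<Prod>j\<in>(Basis::(real^3) set). if j = axis 3 1 then s else 1)"
      using s by (intro prod.cong) auto
    also have "\<dots> = s" using B by simp
    finally show ?thesis .
  qed
  have [measurable]: "?T \<in> borel_measurable borel" by simp
  have "(LINT p|lborel. f p) = (LINT p|density (distr lborel borel ?T) (\<lambda>_. ennreal (\<Prod>j\<in>Basis. \<bar>?c j\<bar>)). f p)"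
    using lborel_affine_euclidean[of ?c 0] s by (simp del: add_0_left)
  also have "\<dots> = (LINT p|density (distr lborel borel ?T) (\<lambda>_. ennreal s). f p)"
    unfolding prod ..
  also have "\<dots> = (LINT p|distr lborel borel ?T. s *\<^sub>R f p)"
    using s by (intro integral_density) auto
  also have "\<dots> = (LINT p|lborel. s *\<^sub>R f (?T p))"
    by (intro integral_distr) auto
  also have "\<dots> = s * (LINT p|lborel. f (?T p))" by simp
  finally show ?thesis unfolding T .
qed


subsection \<open>The stability form\<close>

locale stable_solution =
  fixes H :: "'m::finite \<Rightarrow> real^'m \<Rightarrow> real"
    and u :: "real^3 \<Rightarrow> real^'m"
  assumes H_C1: "\<And>i. Ck 1 (H i)"
    and u_C2: "\<And>i. Ck 2 (\<lambda>p. u p $ i)"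
    and solution: "solutionH H u"
    and symmetric: "symmetric_system H u"
    and stable: "stableH H u"
begin

abbreviation Xu :: "'m \<Rightarrow> real^3 \<Rightarrow> real" where "Xu i \<equiv> XH (\<lambda>q. u q $ i)"
abbreviation Yu :: "'m \<Rightarrow> real^3 \<Rightarrow> real" where "Yu i \<equiv> YH (\<lambda>q. u q $ i)"

definition DH :: "'m \<Rightarrow> 'm \<Rightarrow> real^3 \<Rightarrow> real" where
  "DH i j p = pd i (H j) (u p)"

text \<open>Density of the polarised stability form. Stability makes the integral of its diagonal
  nonnegative on \<open>Cc1\<close> fields, and symmetry of the system makes it a symmetric
  form.\<close>

definition qform :: "('m \<Rightarrow> real^3 \<Rightarrow> real) \<Rightarrow> ('m \<Rightarrow> real^3 \<Rightarrow> real) \<Rightarrow> real^3 \<Rightarrow> real" where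
  "qform v w p = (\<Sum>i\<in>UNIV. XH (v i) p * XH (w i) p + YH (v i) p * YH (w i) p)
           + (\<Sum>i\<in>UNIV. \<Sum>j\<in>UNIV. DH i j p * v i p * w j p)"

definition energy :: "real^3 \<Rightarrow> real" where
  "energy p = (\<Sum>i\<in>UNIV. (Xu i p)\<^sup>2 + (Yu i p)\<^sup>2)"

lemma Xu_C1: "Ck 1 (Xu i)" and Yu_C1: "Ck 1 (Yu i)" and u_C1: "Ck 1 (\<lambda>p. u p $ i)"
  using u_C2 by (auto intro: Ck1_XH Ck1_YH Ck2_Ck1 simp del: One_nat_def Ck.simps)

lemma continuous_DH: "continuous_on UNIV (DH i j)"
proof -
  have "continuous_on UNIV u"
    using continuous_on_vec_lambda[of UNIV "\<lambda>i q. u q $ i"] Ck1_continuous[OF u_C1] by simp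
  then show ?thesis
    unfolding DH_def[abs_def] by (intro continuous_on_compose2[OF Ck1_continuous_pd[OF H_C1]]) auto
qed

lemma DH_sym: "DH i j p = DH j i p"
  using symmetric by (simp add: DH_def symmetric_system_def)

lemma qform_sym: "qform v w p = qform w v p"
proof -
  have "(\<Sum>i\<in>UNIV. \<Sum>j\<in>UNIV. DH i j p * v i p * w j p) = (\<Sum>j\<in>UNIV. \<Sum>i\<in>UNIV. DH i j p * v i p * w j p)"
    by (rule sum.swap)
  also have "\<dots> = (\<Sum>i\<in>UNIV. \<Sum>j\<in>UNIV. DH i j p * w i p * v j p)"
    by (intro sum.cong) (auto simp: DH_sym mult_ac)
  finally show ?thesis by (simp add: qform_def mult.commute)
qed

lemma qform_add_right:
  assumes "\<And>i. Ck 1 (w i)" "\<And>i. Ck 1 (w' i)"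
  shows "qform v (\<lambda>i q. w i q + w' i q) p = qform v w p + qform v w' p"
  using assms by (simp add: qform_def XH_add YH_add algebra_simps sum.distrib del: One_nat_def Ck.simps)

lemma qform_cmult_right:
  assumes "\<And>i. Ck 1 (w i)"
  shows "qform v (\<lambda>i q. c * w i q) p = c * qform v w p"
  using assms by (simp add: qform_def XH_cmult YH_cmult algebra_simps sum_distrib_left sum.distrib del: One_nat_def Ck.simps)

lemma qform_quadratic:
  assumes v: "\<And>i. Ck 1 (v i)" and w: "\<And>i. Ck 1 (w i)"
  shows "qform (\<lambda>i q. v i q + t * w i q) (\<lambda>i q. v i q + t * w i q) p = qform v v p + 2 * t * qform v w p + t\<^sup>2 * qform w w p"
proof -
  have tw: "Ck 1 (\<lambda>q. t * w i q)" for i by (intro Ck1_cmult w)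
  have "qform (\<lambda>i q. v i q + t * w i q) v p = qform v v p + t * qform v w p"
    by (subst qform_sym) (simp add: qform_add_right[OF v tw] qform_cmult_right[OF w])
  moreover have "qform (\<lambda>i q. v i q + t * w i q) w p = qform v w p + t * qform w w p"
    by (subst qform_sym) (simp add: qform_add_right[OF v tw] qform_cmult_right[OF w] qform_sym[of w v])
  ultimately show ?thesis
    by (simp add: qform_add_right[OF v tw] qform_cmult_right[OF w] algebra_simps power2_eq_square)
qed

lemma Cc0_qform:
  assumes v: "\<And>i. Ck 1 (v i)" and w: "\<And>i. Cc1 (w i)"
  shows "Cc0 (qform v w)"
  unfolding qform_def[abs_def]
  by (intro Cc0_add Cc0_sum Cc0_mult2 Cc0_XH Cc0_YH Cc1_Cc0 w continuous_XH continuous_YH v continuous_on_mult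
      continuous_DH Ck1_continuous)

lemma qform_nonneg:
  assumes w: "\<And>i. Cc1 (w i)"
  shows "0 \<le> (LINT p|lborel. qform w w p)"
proof -
  have w1: "Ck 1 (w i)" for i by (rule Cc1_Ck1[OF w])
  have n: "(norm (gradH (w i) p))\<^sup>2 = XH (w i) p * XH (w i) p + YH (w i) p * YH (w i) p" for i p
    unfolding power2_norm_eq_inner inner_vec_def sum_2 gradH_def by simp
  have i1: "integrable lborel (\<lambda>p. XH (w i) p * XH (w i) p + YH (w i) p * YH (w i) p)" for i
    by (intro Cc0_integrable Cc0_add Cc0_mult2 Cc0_XH Cc0_YH w continuous_XH continuous_YH w1)
  have i2: "integrable lborel (\<lambda>p. DH i j p * w i p * w j p)" for i j
    by (intro Cc0_integrable Cc0_mult2 Cc1_Cc0 w continuous_on_mult continuous_DH Ck1_continuous w1)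
  have "(LINT p|lborel. qform w w p) = (\<Sum>i\<in>UNIV. LINT p|lborel. (norm (gradH (w i) p))\<^sup>2)
      + (\<Sum>i\<in>UNIV. \<Sum>j\<in>UNIV. LINT p|lborel. DH i j p * w i p * w j p)"
    unfolding qform_def n using i1 i2
    by (subst Bochner_Integration.integral_add) (simp_all add: Bochner_Integration.integral_sum del: Bochner_Integration.integral_add)
  moreover have "- (\<Sum>i\<in>UNIV. \<Sum>j\<in>UNIV. LINT p|lborel. DH i j p * w i p * w j p)
      \<le> (\<Sum>i\<in>UNIV. LINT p|lborel. (norm (gradH (w i) p))\<^sup>2)"
    using stable w unfolding stableH_def DH_def by blast
  ultimately show ?thesis by simp
qed

text \<open>By the chain rule the zeroth order part of the form at \<open>Xu\<close> is X applied to
  the right hand side of the system, which cancels against the differentiated equation. Only the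
  commutator terms of \<open>weak_commuted_equation\<close> survive.\<close>

lemma qform_weak:
  assumes w: "\<And>i. Cc1 (w i)"
  shows "(LINT p|lborel. qform Xu w p) = 2 * (LINT p|lborel. (\<Sum>i\<in>UNIV. ZH (Yu i) p * w i p))"
    and "(LINT p|lborel. qform Yu w p) = - 2 * (LINT p|lborel. (\<Sum>i\<in>UNIV. ZH (Xu i) p * w i p))"
proof -
  let ?h = "\<lambda>i q. H i (u q)"
  have h: "Ck 1 (?h i)" for i by (rule Ck1_vec_comp[OF u_C1 H_C1])
  have pdh: "pd k (?h j) p = (\<Sum>i\<in>UNIV. DH i j p * pd k (\<lambda>q. u q $ i) p)" for k j p
    unfolding DH_def by (intro pd_vec_comp Ck1_differentiable u_C1 H_C1)
  have Xh: "XH (?h j) p = (\<Sum>i\<in>UNIV. DH i j p * Xu i p)" and Yh: "YH (?h j) p = (\<Sum>i\<in>UNIV. DH i j p * Yu i p)" for j p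
    by (simp_all add: XH_def YH_def pdh sum_distrib_left sum.distrib sum_subtractf algebra_simps)
  have eq: "XH (Xu i) p + YH (Yu i) p = ?h i p" for i p
    using solution by (simp add: solutionH_def)
  note W = weak_commuted_equation[OF u_C2 h eq w]
  note c = Xu_C1 Yu_C1 w continuous_XH continuous_YH continuous_ZH Ck1_continuous
  \<comment> \<open>The double sum is regrouped by the second index, since the chain rule for
    component \<open>j\<close> of the system sums \<open>DH i j\<close> over
    \<open>i\<close>.\<close>
  have E1: "qform v w p = (\<Sum>j\<in>UNIV. (XH (v j) p * XH (w j) p + YH (v j) p * YH (w j) p) + (\<Sum>i\<in>UNIV. DH i j p * v i p) * w j p)" for v p
  proof -
    have "(\<Sum>i\<in>UNIV. \<Sum>j\<in>UNIV. DH i j p * v i p * w j p) = (\<Sum>j\<in>UNIV. \<Sum>i\<in>UNIV. DH i j p * v i p * w j p)"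
      by (rule sum.swap)
    then show ?thesis by (simp add: qform_def sum.distrib sum_distrib_right)
  qed
  have i1: "integrable lborel (\<lambda>p. XH (v j) p * XH (w j) p + YH (v j) p * YH (w j) p)" if "\<And>j. Ck 1 (v j)" for v j
    by (intro Cc0_integrable Cc0_add Cc0_mult2 Cc0_XH Cc0_YH w continuous_XH continuous_YH that)
  have i2: "integrable lborel (\<lambda>p. XH (?h j) p * w j p)" "integrable lborel (\<lambda>p. YH (?h j) p * w j p)"
    "integrable lborel (\<lambda>p. ZH (Xu j) p * w j p)" "integrable lborel (\<lambda>p. ZH (Yu j) p * w j p)" for j
    by (intro Cc0_integrable Cc0_mult2 Cc1_Cc0 w continuous_XH continuous_YH continuous_ZH h Xu_C1 Yu_C1)+
  have S: "(LINT p|lborel. (\<Sum>j\<in>UNIV. f j p + g j p)) = (\<Sum>j\<in>UNIV. (LINT p|lborel. f j p) + (LINT p|lborel. g j p))"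
    if "\<And>j. integrable lborel (f j)" "\<And>j. integrable lborel (g j)" for f g :: "'m \<Rightarrow> real^3 \<Rightarrow> real"
    using that by (simp add: Bochner_Integration.integral_sum)
  have "(LINT p|lborel. qform Xu w p) = (\<Sum>j\<in>UNIV. (LINT p|lborel. XH (Xu j) p * XH (w j) p + YH (Xu j) p * YH (w j) p) + (LINT p|lborel. XH (?h j) p * w j p))"
    unfolding E1 Xh[symmetric] by (rule S[OF i1[of Xu, OF Xu_C1] i2(1)])
  also have "\<dots> = 2 * (LINT p|lborel. (\<Sum>i\<in>UNIV. ZH (Yu i) p * w i p))"
    unfolding W using i2 by (simp add: Bochner_Integration.integral_sum sum_distrib_left)
  finally show "(LINT p|lborel. qform Xu w p) = 2 * (LINT p|lborel. (\<Sum>i\<in>UNIV. ZH (Yu i) p * w i p))" .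
  have "(LINT p|lborel. qform Yu w p) = (\<Sum>j\<in>UNIV. (LINT p|lborel. XH (Yu j) p * XH (w j) p + YH (Yu j) p * YH (w j) p) + (LINT p|lborel. YH (?h j) p * w j p))"
    unfolding E1 Yh[symmetric] by (rule S[OF i1[of Yu, OF Yu_C1] i2(2)])
  also have "\<dots> = - 2 * (LINT p|lborel. (\<Sum>i\<in>UNIV. ZH (Xu i) p * w i p))"
    unfolding W using i2 by (simp add: Bochner_Integration.integral_sum sum_distrib_left sum_negf)
  finally show "(LINT p|lborel. qform Yu w p) = - 2 * (LINT p|lborel. (\<Sum>i\<in>UNIV. ZH (Xu i) p * w i p))" .
qed

text \<open>A scalar factor changes slots at the price of first order terms only; the zeroth order
  part of the form does not see the move.\<close>

lemma qform_mult_left: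
  assumes \<alpha>: "Ck 1 \<alpha>" and c: "\<And>i. Ck 1 (c i)" and w: "\<And>i. Ck 1 (w i)"
  shows "qform (\<lambda>i q. \<alpha> q * c i q) w p = qform c (\<lambda>i q. \<alpha> q * w i q) p
    + (\<Sum>i\<in>UNIV. XH \<alpha> p * (c i p * XH (w i) p - w i p * XH (c i) p) + YH \<alpha> p * (c i p * YH (w i) p - w i p * YH (c i) p))"
proof -
  have 1: "(\<Sum>i\<in>UNIV. \<Sum>j\<in>UNIV. DH i j p * (\<alpha> p * c i p) * w j p) = (\<Sum>i\<in>UNIV. \<Sum>j\<in>UNIV. DH i j p * c i p * (\<alpha> p * w j p))"
    by (simp add: mult_ac)
  show ?thesis
    unfolding qform_def 1 using \<alpha> c w
    by (simp add: XH_mult YH_mult algebra_simps sum.distrib sum_subtractf del: One_nat_def Ck.simps)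
qed

text \<open>On the diagonal the terms containing derivatives of \<open>c\<close> cancel, so
  multiplying by a cutoff costs just its gradient. This is what makes \<open>qform_weak\<close>
  usable: \<open>c\<close> then stands in the form against a multiple of itself.\<close>

lemma qform_mult_diag:
  assumes \<alpha>: "Ck 1 \<alpha>" and c: "\<And>i. Ck 1 (c i)"
  shows "qform (\<lambda>i q. \<alpha> q * c i q) (\<lambda>i q. \<alpha> q * c i q) p = qform c (\<lambda>i q. (\<alpha> q)\<^sup>2 * c i q) p
    + ((XH \<alpha> p)\<^sup>2 + (YH \<alpha> p)\<^sup>2) * (\<Sum>i\<in>UNIV. (c i p)\<^sup>2)"
proof -
  have "qform (\<lambda>i q. \<alpha> q * c i q) (\<lambda>i q. \<alpha> q * c i q) p = qform c (\<lambda>i q. \<alpha> q * (\<alpha> q * c i q)) p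
    + (\<Sum>i\<in>UNIV. XH \<alpha> p * (c i p * XH (\<lambda>q. \<alpha> q * c i q) p - (\<alpha> p * c i p) * XH (c i) p)
                + YH \<alpha> p * (c i p * YH (\<lambda>q. \<alpha> q * c i q) p - (\<alpha> p * c i p) * YH (c i) p))"
    using \<alpha> c by (intro qform_mult_left Ck1_mult)
  also have "(\<lambda>i q. \<alpha> q * (\<alpha> q * c i q)) = (\<lambda>i q. (\<alpha> q)\<^sup>2 * c i q)"
    by (simp add: power2_eq_square mult.assoc)
  also have "(\<Sum>i\<in>UNIV. XH \<alpha> p * (c i p * XH (\<lambda>q. \<alpha> q * c i q) p - (\<alpha> p * c i p) * XH (c i) p)
                + YH \<alpha> p * (c i p * YH (\<lambda>q. \<alpha> q * c i q) p - (\<alpha> p * c i p) * YH (c i) p))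
      = (\<Sum>i\<in>UNIV. ((XH \<alpha> p)\<^sup>2 + (YH \<alpha> p)\<^sup>2) * (c i p)\<^sup>2)"
    using \<alpha> c by (intro sum.cong) (simp_all add: XH_mult YH_mult algebra_simps power2_eq_square del: One_nat_def Ck.simps)
  finally show ?thesis by (simp add: sum_distrib_left)
qed

lemma qform_sum_diag:
  assumes \<alpha>: "Cc1 \<alpha>" and sign: "\<And>i p. ZH (Yu i) p * Xu i p - ZH (Xu i) p * Yu i p \<le> 0"
  shows "(LINT p|lborel. qform (\<lambda>i q. \<alpha> q * Xu i q) (\<lambda>i q. \<alpha> q * Xu i q) p) + (LINT p|lborel. qform (\<lambda>i q. \<alpha> q * Yu i q) (\<lambda>i q. \<alpha> q * Yu i q) p)
     \<le> (LINT p|lborel. ((XH \<alpha> p)\<^sup>2 + (YH \<alpha> p)\<^sup>2) * energy p)"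
proof -
  note \<alpha>1 = Cc1_Ck1[OF \<alpha>]
  have \<alpha>2: "Cc1 (\<lambda>q. (\<alpha> q)\<^sup>2)" using Cc1_mult1[OF \<alpha> \<alpha>1] by (simp add: power2_eq_square)
  have wa: "Cc1 (\<lambda>q. (\<alpha> q)\<^sup>2 * Xu i q)" and wb: "Cc1 (\<lambda>q. (\<alpha> q)\<^sup>2 * Yu i q)" for i
    by (intro Cc1_mult1 \<alpha>2 Xu_C1 Yu_C1)+
  have cg: "Cc0 (\<lambda>p. ((XH \<alpha> p)\<^sup>2 + (YH \<alpha> p)\<^sup>2) * (\<Sum>i\<in>UNIV. (c i p)\<^sup>2))" if "\<And>i. Ck 1 (c i)" for c :: "'m \<Rightarrow> real^3 \<Rightarrow> real"
    unfolding power2_eq_square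
    by (intro Cc0_mult1 Cc0_add Cc0_mult2 Cc0_XH Cc0_YH \<alpha> continuous_XH continuous_YH \<alpha>1 continuous_intros Ck1_continuous that)
  have Cc0_Z: "Cc0 (\<lambda>p. \<Sum>i\<in>UNIV. ZH (c i) p * w i p)" if "\<And>i. Ck 1 (c i)" "\<And>i. Cc1 (w i)" for c w :: "'m \<Rightarrow> real^3 \<Rightarrow> real"
    by (intro Cc0_sum Cc0_mult2 Cc1_Cc0 continuous_ZH that)
  have "(LINT p|lborel. qform (\<lambda>i q. \<alpha> q * Xu i q) (\<lambda>i q. \<alpha> q * Xu i q) p) + (LINT p|lborel. qform (\<lambda>i q. \<alpha> q * Yu i q) (\<lambda>i q. \<alpha> q * Yu i q) p)
     = 2 * (LINT p|lborel. (\<Sum>i\<in>UNIV. ZH (Yu i) p * ((\<alpha> p)\<^sup>2 * Xu i p))) - 2 * (LINT p|lborel. (\<Sum>i\<in>UNIV. ZH (Xu i) p * ((\<alpha> p)\<^sup>2 * Yu i p)))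
       + ((LINT p|lborel. ((XH \<alpha> p)\<^sup>2 + (YH \<alpha> p)\<^sup>2) * (\<Sum>i\<in>UNIV. (Xu i p)\<^sup>2)) + (LINT p|lborel. ((XH \<alpha> p)\<^sup>2 + (YH \<alpha> p)\<^sup>2) * (\<Sum>i\<in>UNIV. (Yu i p)\<^sup>2)))"
    unfolding qform_mult_diag[OF \<alpha>1 Xu_C1] qform_mult_diag[OF \<alpha>1 Yu_C1]
    using qform_weak(1)[OF wa] qform_weak(2)[OF wb] Cc0_integrable[OF Cc0_qform[OF Xu_C1 wa]] Cc0_integrable[OF Cc0_qform[OF Yu_C1 wb]]
      Cc0_integrable[OF cg[OF Xu_C1]] Cc0_integrable[OF cg[OF Yu_C1]]
    by simp
  also have "(LINT p|lborel. ((XH \<alpha> p)\<^sup>2 + (YH \<alpha> p)\<^sup>2) * (\<Sum>i\<in>UNIV. (Xu i p)\<^sup>2)) + (LINT p|lborel. ((XH \<alpha> p)\<^sup>2 + (YH \<alpha> p)\<^sup>2) * (\<Sum>i\<in>UNIV. (Yu i p)\<^sup>2))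
     = (LINT p|lborel. ((XH \<alpha> p)\<^sup>2 + (YH \<alpha> p)\<^sup>2) * energy p)"
    using Cc0_integrable[OF cg[OF Xu_C1]] Cc0_integrable[OF cg[OF Yu_C1]]
    by (simp add: energy_def sum.distrib distrib_left[of _ "sum _ _"] flip: Bochner_Integration.integral_add)
  also have "2 * (LINT p|lborel. (\<Sum>i\<in>UNIV. ZH (Yu i) p * ((\<alpha> p)\<^sup>2 * Xu i p))) - 2 * (LINT p|lborel. (\<Sum>i\<in>UNIV. ZH (Xu i) p * ((\<alpha> p)\<^sup>2 * Yu i p)))
     = 2 * (LINT p|lborel. (\<Sum>i\<in>UNIV. ZH (Yu i) p * ((\<alpha> p)\<^sup>2 * Xu i p)) - (\<Sum>i\<in>UNIV. ZH (Xu i) p * ((\<alpha> p)\<^sup>2 * Yu i p)))"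
    using Cc0_integrable[OF Cc0_Z[OF Yu_C1 wa]] Cc0_integrable[OF Cc0_Z[OF Xu_C1 wb]] by simp
  also have "\<dots> = 2 * (LINT p|lborel. (\<alpha> p)\<^sup>2 * (\<Sum>i\<in>UNIV. ZH (Yu i) p * Xu i p - ZH (Xu i) p * Yu i p))"
    by (simp add: sum_distrib_left sum_subtractf algebra_simps)
  also have "(LINT p|lborel. (\<alpha> p)\<^sup>2 * (\<Sum>i\<in>UNIV. ZH (Yu i) p * Xu i p - ZH (Xu i) p * Yu i p)) \<le> 0"
  proof -
    have "0 \<le> (LINT p|lborel. - ((\<alpha> p)\<^sup>2 * (\<Sum>i\<in>UNIV. ZH (Yu i) p * Xu i p - ZH (Xu i) p * Yu i p)))"
      by (intro integral_nonneg_AE AE_I2) (auto intro!: mult_nonneg_nonpos sum_nonpos sign simp del: sum_subtractf)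
    then show ?thesis by simp
  qed
  finally show ?thesis by simp
qed

end


subsection \<open>The horizontal gradient does not depend on z\<close>

text \<open>A discrete logarithmic cutoff. The average of dyadic C1 cutoffs plays the role of a
  truncated logarithm of the gauge and stays within \<open>Cc1\<close>.\<close>

definition avg_cutoff :: "nat \<Rightarrow> real \<Rightarrow> real^3 \<Rightarrow> real" where
  "avg_cutoff n R p = inverse (real n) * (\<Sum>j<n. cutoff (2 ^ j * R) p)"

lemma Cc1_avg_cutoff: "R > 0 \<Longrightarrow> Cc1 (avg_cutoff n R)"
  unfolding avg_cutoff_def[abs_def] by (intro Cc1_mult2 Cc1_sum Cc1_cutoff Ck1_const) simp

lemma avg_cutoff_on_ball:
  assumes R: "R > 0" and n: "n > 0" and p: "gauge4 p \<le> R ^ 4"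
  shows "avg_cutoff n R p = 1" "XH (avg_cutoff n R) p = 0" "YH (avg_cutoff n R) p = 0"
proof -
  have p': "gauge4 p \<le> (2 ^ j * R) ^ 4" for j :: nat
  proof -
    have "1 * R \<le> 2 ^ j * R" using R by (intro mult_right_mono) auto
    then have "R ^ 4 \<le> (2 ^ j * R) ^ 4" using R by (intro power_mono) auto
    with p show ?thesis by linarith
  qed
  have C: "Ck 1 (cutoff (2 ^ j * R))" "Ck 1 (\<lambda>p. \<Sum>j<n. cutoff (2 ^ j * R) p)" for j :: nat
    using R by (auto intro!: Ck1_sum Ck1_cutoff simp del: One_nat_def Ck.simps)
  have "cutoff (2 ^ j * R) p = 1" "XH (cutoff (2 ^ j * R)) p = 0" "YH (cutoff (2 ^ j * R)) p = 0" for j :: nat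
    using R p'[of j] by (auto intro!: cutoff_eq_1 grad_cutoff_eq_0)
  then show "avg_cutoff n R p = 1" "XH (avg_cutoff n R) p = 0" "YH (avg_cutoff n R) p = 0"
    unfolding avg_cutoff_def[abs_def] using C n
    by (simp_all add: XH_cmult YH_cmult XH_sum YH_sum del: One_nat_def Ck.simps)
qed

lemma sum_orthogonal_sq:
  fixes f :: "'a \<Rightarrow> real"
  assumes "finite I" "\<And>i j. i \<in> I \<Longrightarrow> j \<in> I \<Longrightarrow> i \<noteq> j \<Longrightarrow> f i * f j = 0"
  shows "(\<Sum>i\<in>I. f i)\<^sup>2 = (\<Sum>i\<in>I. (f i)\<^sup>2)"
proof -
  have "(\<Sum>i\<in>I. f i)\<^sup>2 = (\<Sum>i\<in>I. \<Sum>j\<in>I. f i * f j)"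
    by (simp add: power2_eq_square sum_product)
  also have "\<dots> = (\<Sum>i\<in>I. \<Sum>j\<in>I. if i = j then (f i)\<^sup>2 else 0)"
    using assms(2) by (intro sum.cong) (auto simp: power2_eq_square)
  also have "\<dots> = (\<Sum>i\<in>I. (f i)\<^sup>2)" using assms(1) by simp
  finally show ?thesis .
qed

text \<open>The gradients of dyadic cutoffs have disjoint supports, so averaging \<open>n\<close> of them gains the factor \<open>1/n\<close>.\<close>

lemma grad_avg_cutoff:
  assumes R: "R > 0"
  shows "(XH (avg_cutoff n R) p)\<^sup>2 + (YH (avg_cutoff n R) p)\<^sup>2
    = (inverse (real n))\<^sup>2 * (\<Sum>j<n. (XH (cutoff (2 ^ j * R)) p)\<^sup>2 + (YH (cutoff (2 ^ j * R)) p)\<^sup>2)"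
proof -
  have C: "Ck 1 (cutoff (2 ^ j * R))" "Ck 1 (\<lambda>p. \<Sum>j<n. cutoff (2 ^ j * R) p)" for j :: nat
    using R by (auto intro!: Ck1_sum Ck1_cutoff simp del: One_nat_def Ck.simps)
  have lt: "XH (cutoff (2 ^ j * R)) p * XH (cutoff (2 ^ k * R)) p = 0 \<and> YH (cutoff (2 ^ j * R)) p * YH (cutoff (2 ^ k * R)) p = 0"
    if "j < k" for j k :: nat
  proof (cases "16 * (2 ^ j * R) ^ 4 \<le> gauge4 p")
    case True
    then show ?thesis using R grad_cutoff_eq_0[of "2 ^ j * R" p] by simp
  next
    case False
    have "2 * (2 ^ j * R) \<le> 2 ^ k * R"
      using that R power_increasing[of "Suc j" k "2::real"] by simp
    then have "(2 * (2 ^ j * R)) ^ 4 \<le> (2 ^ k * R) ^ 4" using R by (intro power_mono) auto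
    then have "16 * (2 ^ j * R) ^ 4 \<le> (2 ^ k * R) ^ 4" by (simp add: power_mult_distrib)
    with False show ?thesis using R grad_cutoff_eq_0[of "2 ^ k * R" p] by simp
  qed
  have "XH (cutoff (2 ^ j * R)) p * XH (cutoff (2 ^ k * R)) p = 0" "YH (cutoff (2 ^ j * R)) p * YH (cutoff (2 ^ k * R)) p = 0"
    if "j \<noteq> k" for j k :: nat
    using lt[of j k] lt[of k j] that by (cases j k rule: linorder_cases; auto)+
  then have "(\<Sum>j<n. XH (cutoff (2 ^ j * R)) p)\<^sup>2 = (\<Sum>j<n. (XH (cutoff (2 ^ j * R)) p)\<^sup>2)"
    "(\<Sum>j<n. YH (cutoff (2 ^ j * R)) p)\<^sup>2 = (\<Sum>j<n. (YH (cutoff (2 ^ j * R)) p)\<^sup>2)"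
    by (intro sum_orthogonal_sq; simp)+
  then show ?thesis
    unfolding avg_cutoff_def[abs_def] using C
    by (simp add: XH_cmult YH_cmult XH_sum YH_sum power_mult_distrib sum.distrib distrib_left del: One_nat_def Ck.simps)
qed

lemma quadratic_nonneg_imp_linear_zero:
  fixes l Q :: real
  assumes nn: "\<And>t. 0 \<le> 2 * t * l + t\<^sup>2 * Q" and Q: "0 \<le> Q"
  shows "l = 0"
proof -
  \<comment> \<open>Nearly the minimiser \<open>- l / Q\<close>; the denominator
    \<open>1 + Q\<close> covers the degenerate case \<open>Q = 0\<close> as well.\<close>
  define t where "t = - l / (1 + Q)"
  have t: "t * (1 + Q) = - l" using Q by (simp add: t_def)
  have "0 \<le> (1 + Q)\<^sup>2 * (2 * t * l + t\<^sup>2 * Q)" by (intro mult_nonneg_nonneg nn) simp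
  also have "\<dots> = 2 * (t * (1 + Q)) * l * (1 + Q) + (t * (1 + Q))\<^sup>2 * Q" by algebra
  also have "\<dots> = - (l\<^sup>2 * (2 + Q))" unfolding t by algebra
  finally have "l\<^sup>2 * (2 + Q) \<le> 0" by simp
  with Q show ?thesis by (simp add: mult_le_0_iff)
qed

section \<open>Horizontal derivatives in the kernel of the stability form\<close>

locale stable_solution_growth = stable_solution H u
  for H :: "'m::finite \<Rightarrow> real^'m \<Rightarrow> real" and u :: "real^3 \<Rightarrow> real^'m" +
  assumes sign: "\<And>i p. ZH (Yu i) p * Xu i p - ZH (Xu i) p * Yu i p \<le> 0"
    and growth: "\<exists>C. \<forall>R>1. \<forall>i.
      (LINT p:ballH R|lborel. ((p $ 1)\<^sup>2 + (p $ 2)\<^sup>2) * (norm (gradH (\<lambda>q. u q $ i) p))\<^sup>2) \<le> C * R ^ 4"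
begin

definition moment :: "real \<Rightarrow> real" where
  "moment R = (LINT p|lborel. indicator (ballH R) p * (rsq p * energy p))"

lemma continuous_energy: "continuous_on UNIV energy"
  unfolding energy_def[abs_def] by (intro continuous_intros Ck1_continuous Xu_C1 Yu_C1)

lemma energy_nonneg: "0 \<le> energy p"
  unfolding energy_def by (intro sum_nonneg) simp

lemma integrable_moment: "integrable lborel (\<lambda>p. indicator (ballH R) p * (rsq p * energy p))"
  by (intro integrable_on_ballH continuous_intros continuous_energy)

lemma moment_le: "\<exists>C\<ge>0. \<forall>R>1. moment R \<le> C * R ^ 4"
proof -
  obtain C where C: "\<And>R i. R > 1 \<Longrightarrow> (LINT p:ballH R|lborel. rsq p * (norm (gradH (\<lambda>q. u q $ i) p))\<^sup>2) \<le> C * R ^ 4"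
    using growth by blast
  have n: "(norm (gradH v p))\<^sup>2 = (XH v p)\<^sup>2 + (YH v p)\<^sup>2" for v p
    unfolding power2_norm_eq_inner inner_vec_def sum_2 gradH_def by (simp add: power2_eq_square)
  have "moment R \<le> (CARD('m) * \<bar>C\<bar>) * R ^ 4" if R: "R > 1" for R
  proof -
    have i: "integrable lborel (\<lambda>p. indicator (ballH R) p * (rsq p * ((Xu i p)\<^sup>2 + (Yu i p)\<^sup>2)))" for i
      by (intro integrable_on_ballH continuous_intros Ck1_continuous Xu_C1 Yu_C1)
    have "moment R = (LINT p|lborel. (\<Sum>i\<in>UNIV. indicator (ballH R) p * (rsq p * ((Xu i p)\<^sup>2 + (Yu i p)\<^sup>2))))"
      unfolding moment_def energy_def by (simp only: sum_distrib_left)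
    also have "\<dots> = (\<Sum>i\<in>UNIV. LINT p:ballH R|lborel. rsq p * (norm (gradH (\<lambda>q. u q $ i) p))\<^sup>2)"
      using i by (simp only: Bochner_Integration.integral_sum set_lebesgue_integral_def n real_scaleR_def)
    also have "\<dots> \<le> (\<Sum>i\<in>(UNIV::'m set). \<bar>C\<bar> * R ^ 4)"
      using R by (intro sum_mono order_trans[OF C[OF R]] mult_right_mono) auto
    finally show ?thesis by (simp add: sum_constant)
  qed
  then show ?thesis by (intro exI[of _ "CARD('m) * \<bar>C\<bar>"]) auto
qed

lemma integrable_grad_energy:
  assumes "Cc1 \<alpha>" shows "integrable lborel (\<lambda>p. ((XH \<alpha> p)\<^sup>2 + (YH \<alpha> p)\<^sup>2) * energy p)"
  unfolding power2_eq_square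
  by (intro Cc0_integrable Cc0_mult1 Cc0_add Cc0_mult2 Cc0_XH Cc0_YH assms continuous_XH continuous_YH Cc1_Ck1 continuous_energy)

lemma grad_cutoff_energy:
  assumes R: "R > 0"
  shows "(LINT p|lborel. ((XH (cutoff R) p)\<^sup>2 + (YH (cutoff R) p)\<^sup>2) * energy p) \<le> 256 / R ^ 4 * moment (2 * R)"
proof -
  have "(LINT p|lborel. ((XH (cutoff R) p)\<^sup>2 + (YH (cutoff R) p)\<^sup>2) * energy p)
      \<le> (LINT p|lborel. 256 / R ^ 4 * (indicator (ballH (2 * R)) p * (rsq p * energy p)))"
  proof (rule integral_mono)
    fix p :: "real^3"
    show "((XH (cutoff R) p)\<^sup>2 + (YH (cutoff R) p)\<^sup>2) * energy p \<le> 256 / R ^ 4 * (indicator (ballH (2 * R)) p * (rsq p * energy p))"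
      using mult_right_mono[OF grad_cutoff_le[OF R, of p] energy_nonneg[of p]] by (simp only: mult.assoc)
  qed (intro integrable_grad_energy Cc1_cutoff R integrable_mult_right integrable_moment)+
  then show ?thesis by (simp add: moment_def)
qed

text \<open>Each dyadic scale contributes at most 256 * 2^4 * C = 4096 * C, the powers of the radius
  cancelling exactly; \<open>n\<close> such terms with the prefactor 1/n^2 leave 1/n. That
  \<open>K\<close> is independent of \<open>R\<close> matters, since \<open>R\<close> is chosen
  later according to the support of a test field.\<close>

lemma grad_avg_cutoff_energy:
  "\<exists>K. \<forall>R\<ge>1. \<forall>n>0. (LINT p|lborel. ((XH (avg_cutoff n R) p)\<^sup>2 + (YH (avg_cutoff n R) p)\<^sup>2) * energy p) \<le> K / real n"
proof -
  obtain C where C: "C \<ge> 0" "\<And>R. R > 1 \<Longrightarrow> moment R \<le> C * R ^ 4" using moment_le by blast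
  have "(LINT p|lborel. ((XH (avg_cutoff n R) p)\<^sup>2 + (YH (avg_cutoff n R) p)\<^sup>2) * energy p) \<le> (4096 * C) / real n"
    if R: "R \<ge> 1" and n: "n > 0" for R and n :: nat
  proof -
    let ?g = "\<lambda>j p. ((XH (cutoff (2 ^ j * R)) p)\<^sup>2 + (YH (cutoff (2 ^ j * R)) p)\<^sup>2) * energy p"
    have Rj: "2 ^ j * R \<ge> 1" for j :: nat
      using R mult_mono[of 1 "2 ^ j" 1 R] by simp
    have i: "integrable lborel (?g j)" for j :: nat
      using Rj[of j] by (intro integrable_grad_energy Cc1_cutoff) linarith
    have "(LINT p|lborel. ((XH (avg_cutoff n R) p)\<^sup>2 + (YH (avg_cutoff n R) p)\<^sup>2) * energy p)
        = (LINT p|lborel. (inverse (real n))\<^sup>2 * (\<Sum>j<n. ?g j p))"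
      using R by (simp add: grad_avg_cutoff sum_distrib_right mult.assoc)
    also have "\<dots> = (inverse (real n))\<^sup>2 * (\<Sum>j<n. LINT p|lborel. ?g j p)"
      using i by (simp add: Bochner_Integration.integral_sum)
    also have "\<dots> \<le> (inverse (real n))\<^sup>2 * (\<Sum>j<n. 4096 * C)"
    proof (intro mult_left_mono sum_mono)
      fix j
      have "(LINT p|lborel. ?g j p) \<le> 256 / (2 ^ j * R) ^ 4 * moment (2 * (2 ^ j * R))"
        using Rj[of j] by (intro grad_cutoff_energy) linarith
      also have "\<dots> \<le> 256 / (2 ^ j * R) ^ 4 * (C * (2 * (2 ^ j * R)) ^ 4)"
        using Rj[of j] by (intro mult_left_mono C) auto
      also have "\<dots> = 4096 * C"
      proof -
        have "256 / s ^ 4 * (C * (2 * s) ^ 4) = 4096 * C" if "s \<noteq> 0" for s :: real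
          using that by (simp add: power_mult_distrib)
        then show ?thesis using Rj[of j] by fastforce
      qed
      finally show "(LINT p|lborel. ?g j p) \<le> 4096 * C" .
    qed simp
    also have "\<dots> = (4096 * C) / real n" using n by (simp add: power2_eq_square field_simps)
    finally show ?thesis .
  qed
  then show ?thesis by blast
qed

text \<open>A field whose cut-offs have vanishing energy lies in the kernel of the nonnegative form, by Cauchy-Schwarz.\<close>

lemma qform_kernel:
  assumes c: "\<And>i. Ck 1 (c i)" and w: "\<And>i. Cc1 (w i)"
    and le: "\<And>\<alpha>. Cc1 \<alpha> \<Longrightarrow> (LINT p|lborel. qform (\<lambda>i q. \<alpha> q * c i q) (\<lambda>i q. \<alpha> q * c i q) p)
      \<le> (LINT p|lborel. ((XH \<alpha> p)\<^sup>2 + (YH \<alpha> p)\<^sup>2) * energy p)"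
  shows "(LINT p|lborel. qform c w p) = 0"
proof -
  from grad_avg_cutoff_energy obtain K where "\<forall>R\<ge>1. \<forall>n>0.
    (LINT p|lborel. ((XH (avg_cutoff n R) p)\<^sup>2 + (YH (avg_cutoff n R) p)\<^sup>2) * energy p) \<le> K / real n" ..
  note K = this[rule_format]
  have w1: "Ck 1 (w i)" for i by (rule Cc1_Ck1[OF w])
  \<comment> \<open>A single function whose support contains those of all components of
    \<open>w\<close> and of their horizontal gradients, so that one radius serves for
    everything.\<close>
  define s where "s p = (\<Sum>i\<in>UNIV. w i p * w i p + (XH (w i) p * XH (w i) p + YH (w i) p * YH (w i) p))" for p
  have "Cc0 s"
    unfolding s_def[abs_def]
    by (intro Cc0_sum Cc0_add Cc0_mult2 Cc0_XH Cc0_YH Cc1_Cc0 w continuous_XH continuous_YH Ck1_continuous w1)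
  then obtain r where r: "r > 0" "\<And>p. norm p > r \<Longrightarrow> s p = 0"
    using bounded_support_norm unfolding Cc0_def by metis
  have s0: "w i p = 0 \<and> XH (w i) p = 0 \<and> YH (w i) p = 0" if "s p = 0" for i p
  proof -
    have "w i p * w i p + (XH (w i) p * XH (w i) p + YH (w i) p * YH (w i) p) = 0"
      using that unfolding s_def by (subst (asm) sum_nonneg_eq_0_iff) auto
    then show ?thesis by (smt (verit) not_sum_squares_lt_zero sum_squares_eq_zero_iff zero_le_square)
  qed
  define R where "R = 1 + r"
  have R: "R \<ge> 1" "R > 0" using r by (auto simp: R_def)
  have out: "w i p = 0 \<and> XH (w i) p = 0 \<and> YH (w i) p = 0" if "\<not> gauge4 p \<le> R ^ 4" for i p
  proof (rule s0, rule r(2), rule ccontr)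
    assume "\<not> r < norm p"
    then have "(1 + norm p) ^ 4 \<le> R ^ 4" unfolding R_def by (intro power_mono) auto
    with gauge4_le_norm[of p] that show False by linarith
  qed
  let ?Q = "LINT p|lborel. qform w w p" and ?l = "LINT p|lborel. qform c w p"
  \<comment> \<open>On the support of \<open>w\<close> the cutoff is 1, so cutting off
    \<open>c\<close> changes nothing in its pairing with \<open>w\<close>, while its diagonal term
    is at most \<open>K / real (Suc n)\<close>. Letting \<open>n\<close> grow leaves a quadratic
    polynomial in \<open>t\<close> without constant term.\<close>
  have ineq: "0 \<le> K / real (Suc n) + (2 * t * ?l + t\<^sup>2 * ?Q)" for t n
  proof -
    let ?\<alpha> = "avg_cutoff (Suc n) R"
    have \<alpha>: "Cc1 ?\<alpha>" by (rule Cc1_avg_cutoff[OF R(2)])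
    let ?v = "\<lambda>i q. ?\<alpha> q * c i q"
    have v: "Cc1 (?v i)" for i by (intro Cc1_mult1 \<alpha> c)
    have \<alpha>w: "(\<lambda>i q. ?\<alpha> q * w i q) = w"
      using out avg_cutoff_on_ball(1)[OF R(2), of "Suc n"] by (auto simp: fun_eq_iff)
    have Evw: "qform ?v w p = qform c w p" for p
    proof -
      have "(XH ?\<alpha> p * (c i p * XH (w i) p - w i p * XH (c i) p) + YH ?\<alpha> p * (c i p * YH (w i) p - w i p * YH (c i) p)) = 0" for i
        using out[of p i] avg_cutoff_on_ball[OF R(2), of "Suc n" p] by (cases "gauge4 p \<le> R ^ 4") auto
      then show ?thesis by (simp add: qform_mult_left[OF Cc1_Ck1[OF \<alpha>] c w1] \<alpha>w)
    qed
    have "Cc1 (\<lambda>q. ?v i q + t * w i q)" for i by (intro Cc1_add v Cc1_mult2 w Ck1_const)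
    then have "0 \<le> (LINT p|lborel. qform (\<lambda>i q. ?v i q + t * w i q) (\<lambda>i q. ?v i q + t * w i q) p)"
      by (rule qform_nonneg)
    also have "\<dots> = (LINT p|lborel. qform ?v ?v p) + 2 * t * ?l + t\<^sup>2 * ?Q"
      unfolding qform_quadratic[OF Cc1_Ck1[OF v] w1] Evw
      using Cc0_integrable[OF Cc0_qform[OF Cc1_Ck1[OF v] v]] Cc0_integrable[OF Cc0_qform[OF c w]] Cc0_integrable[OF Cc0_qform[OF w1 w]]
      by simp
    also have "(LINT p|lborel. qform ?v ?v p) \<le> K / real (Suc n)"
      using le[OF \<alpha>] K[OF R(1), of "Suc n"] by simp
    finally show ?thesis by simp
  qed
  have lim: "0 \<le> 2 * t * ?l + t\<^sup>2 * ?Q" for t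
  proof (rule LIMSEQ_le_const)
    have "(\<lambda>n. K * inverse (real (Suc n)) + (2 * t * ?l + t\<^sup>2 * ?Q)) \<longlonglongrightarrow> K * 0 + (2 * t * ?l + t\<^sup>2 * ?Q)"
      by (intro tendsto_intros LIMSEQ_inverse_real_of_nat)
    then show "(\<lambda>n. K / real (Suc n) + (2 * t * ?l + t\<^sup>2 * ?Q)) \<longlonglongrightarrow> 2 * t * ?l + t\<^sup>2 * ?Q"
      by (simp add: divide_inverse)
  qed (use ineq in blast)
  have Q: "0 \<le> ?Q" by (rule qform_nonneg[OF w])
  show ?thesis by (rule quadratic_nonneg_imp_linear_zero[OF lim Q])
qed

text \<open>The gradient energy bounds the sum of the two diagonal terms. Each of them is
  nonnegative by stability, so it bounds either one separately, as \<open>qform_kernel\<close>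
  requires.\<close>

lemma qform_Xu_zero: "(\<And>i. Cc1 (w i)) \<Longrightarrow> (LINT p|lborel. qform Xu w p) = 0"
  and qform_Yu_zero: "(\<And>i. Cc1 (w i)) \<Longrightarrow> (LINT p|lborel. qform Yu w p) = 0"
proof -
  have nn: "0 \<le> (LINT p|lborel. qform (\<lambda>i q. \<alpha> q * c i q) (\<lambda>i q. \<alpha> q * c i q) p)" if "Cc1 \<alpha>" "\<And>i. Ck 1 (c i)"
    for \<alpha> and c :: "'m \<Rightarrow> real^3 \<Rightarrow> real"
    by (intro qform_nonneg Cc1_mult1 that)
  show "(LINT p|lborel. qform Xu w p) = 0" if "\<And>i. Cc1 (w i)"
  proof (rule qform_kernel[OF Xu_C1 that])
    fix \<alpha> :: "real^3 \<Rightarrow> real" assume \<alpha>: "Cc1 \<alpha>"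
    from qform_sum_diag[OF this sign] nn[OF \<alpha>, of Yu, OF Yu_C1]
    show "(LINT p|lborel. qform (\<lambda>i q. \<alpha> q * Xu i q) (\<lambda>i q. \<alpha> q * Xu i q) p)
      \<le> (LINT p|lborel. ((XH \<alpha> p)\<^sup>2 + (YH \<alpha> p)\<^sup>2) * energy p)" by linarith
  qed
  show "(LINT p|lborel. qform Yu w p) = 0" if "\<And>i. Cc1 (w i)"
  proof (rule qform_kernel[OF Yu_C1 that])
    fix \<alpha> :: "real^3 \<Rightarrow> real" assume \<alpha>: "Cc1 \<alpha>"
    from qform_sum_diag[OF this sign] nn[OF \<alpha>, of Xu, OF Xu_C1]
    show "(LINT p|lborel. qform (\<lambda>i q. \<alpha> q * Yu i q) (\<lambda>i q. \<alpha> q * Yu i q) p)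
      \<le> (LINT p|lborel. ((XH \<alpha> p)\<^sup>2 + (YH \<alpha> p)\<^sup>2) * energy p)" by linarith
  qed
qed

text \<open>\<open>qform_weak\<close> identifies the pairing with a test field, now known to vanish,
  as a multiple of the integral of that field against the Z derivatives.\<close>

lemma ZH_grad_zero: "ZH (Xu i) p = 0" "ZH (Yu i) p = 0"
proof -
  have *: "f i p = 0" if f: "\<And>i. continuous_on UNIV (f i)"
    and 0: "\<And>w. (\<And>i. Cc1 (w i)) \<Longrightarrow> (LINT p|lborel. (\<Sum>i\<in>UNIV. f i p * w i p)) = 0"
  for f :: "'m \<Rightarrow> real^3 \<Rightarrow> real"
  proof (rule integral_Cc1_eq_0_imp[OF f])
    fix w :: "real^3 \<Rightarrow> real" assume w: "Cc1 w"
    \<comment> \<open>A test field with a single nonzero component isolates the summand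
      \<open>i\<close>.\<close>
    let ?w = "\<lambda>j. if j = i then w else (\<lambda>_. 0)"
    have "Cc1 (?w j)" for j
      using w by (simp add: Cc1_iff Ck1_const del: One_nat_def Ck.simps)
    from 0[of ?w, OF this] have "(LINT p|lborel. (\<Sum>j\<in>UNIV. f j p * ?w j p)) = 0" .
    moreover have "(\<Sum>j\<in>UNIV. f j p * ?w j p) = f i p * w p" for p
      by (subst sum.remove[of _ i]) (auto intro!: sum.neutral)
    ultimately show "(LINT p|lborel. f i p * w p) = 0" by simp
  qed
  show "ZH (Xu i) p = 0"
    by (rule *) (use continuous_ZH[OF Xu_C1] qform_weak(2) qform_Yu_zero in auto)
  show "ZH (Yu i) p = 0"
    by (rule *) (use continuous_ZH[OF Yu_C1] qform_weak(1) qform_Xu_zero in auto)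
qed

end


subsection \<open>Rotating test fields\<close>

lemma ZH_zero_imp_z_invariant:
  assumes f: "Ck 1 f" and 0: "\<And>p. ZH f p = 0"
  shows "f (p + t *\<^sub>R axis 3 1) = f p"
proof -
  have "((\<lambda>t. f (p + t *\<^sub>R axis 3 1)) has_real_derivative 0) (at s)" for s
    using has_real_derivative_pd[OF Ck1_differentiable[OF f], where p=p and s=s and k=3] 0[unfolded ZH_def] by simp
  then have "\<forall>s. ((\<lambda>t. f (p + t *\<^sub>R axis 3 1)) has_real_derivative 0) (at s)" ..
  from DERIV_isconst_all[OF this, of t 0] show ?thesis by simp
qed

lemma pd_z_invariant:
  assumes "\<And>p t. f (p + t *\<^sub>R axis 3 1) = f p"
  shows "pd k f (p + t *\<^sub>R axis 3 1) = pd k f p"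
proof -
  have "f (p + t *\<^sub>R axis 3 1 + s *\<^sub>R axis k 1) = f (p + s *\<^sub>R axis k 1)" for s
    using assms[of "p + s *\<^sub>R axis k 1" t] by (simp add: algebra_simps)
  then show ?thesis by (simp add: pd_def)
qed

lemma pd_zero_imp_const:
  fixes f :: "real^'n \<Rightarrow> real"
  assumes f: "Ck 1 f" and 0: "\<And>k p. pd k f p = 0"
  shows "f p = f q"
proof -
  have "(f has_derivative (\<lambda>_. 0)) (at p within UNIV)" for p
    using has_derivative_pd[OF Ck1_differentiable[OF f], of p] 0 by simp
  then have "\<exists>c. \<forall>x\<in>UNIV. f x = c" by (intro has_derivative_zero_constant) auto
  then show ?thesis by auto
qed

text \<open>The rotation field x \<partial>y - y \<partial>x is divergence free, and
  \<open>rot\<close> says that it annihilates \<open>w\<close>.\<close>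

lemma integral_rotation_zero:
  assumes f: "Ck 1 f" and w: "Cc1 w" and rot: "\<And>p. p $ 1 * pd 2 w p = p $ 2 * pd 1 w p"
  shows "(LINT p|lborel. w p * (p $ 1 * pd 2 f p - p $ 2 * pd 1 f p)) = 0"
proof -
  note w1 = Cc1_Ck1[OF w]
  have cw: "Cc1 (\<lambda>p. p $ j * w p)" for j by (intro Cc1_mult2 w Ck1_coord)
  have pdw: "pd k (\<lambda>p. p $ j * w p) p = (if k = j then 1 else 0) * w p + p $ j * pd k w p" for k j p
    by (simp add: pd_mult pd_coord Ck1_differentiable w1 Ck1_coord del: One_nat_def Ck.simps)
  have i: "integrable lborel (\<lambda>p. pd k f p * (p $ j * w p))" for k j
    by (intro Cc0_integrable Cc0_mult2 Cc1_Cc0 w Ck1_continuous_pd f continuous_intros)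
  have "(LINT p|lborel. w p * (p $ 1 * pd 2 f p - p $ 2 * pd 1 f p))
      = (LINT p|lborel. pd 2 f p * (p $ 1 * w p) - pd 1 f p * (p $ 2 * w p))"
    by (intro Bochner_Integration.integral_cong) (auto simp: algebra_simps)
  also have "\<dots> = (LINT p|lborel. pd 2 f p * (p $ 1 * w p)) - (LINT p|lborel. pd 1 f p * (p $ 2 * w p))"
    by (intro Bochner_Integration.integral_diff i)
  also have "\<dots> = 0"
    unfolding integral_by_parts[OF f cw] pdw by (simp add: rot)
  finally show ?thesis .
qed

lemma cutoff_sq_rotation:
  assumes R: "R > 0"
  shows "p $ 1 * pd 2 (\<lambda>q. cutoff R q * cutoff R q) p = p $ 2 * pd 1 (\<lambda>q. cutoff R q * cutoff R q) p"
  using R by (simp add: pd_mult Ck1_differentiable Ck1_cutoff pd_cutoff pd_gauge4 del: One_nat_def Ck.simps)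

section \<open>Energy of the rotated fields\<close>

context stable_solution
begin

text \<open>The factors \<open>1\<close> and \<open>- 1\<close> make both fields instances of the shape in \<open>qform_quadratic\<close>.\<close>

lemma qform_rotate:
  assumes \<alpha>: "Ck 1 \<alpha>" and \<beta>: "Ck 1 \<beta>"
  shows "qform (\<lambda>i q. \<alpha> q * Xu i q + 1 * (\<beta> q * Yu i q)) (\<lambda>i q. \<alpha> q * Xu i q + 1 * (\<beta> q * Yu i q)) p
       + qform (\<lambda>i q. \<alpha> q * Yu i q + (- 1) * (\<beta> q * Xu i q)) (\<lambda>i q. \<alpha> q * Yu i q + (- 1) * (\<beta> q * Xu i q)) p
     = qform Xu (\<lambda>i q. (\<alpha> q)\<^sup>2 * Xu i q) p + qform Xu (\<lambda>i q. (\<beta> q)\<^sup>2 * Xu i q) p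
     + qform Yu (\<lambda>i q. (\<alpha> q)\<^sup>2 * Yu i q) p + qform Yu (\<lambda>i q. (\<beta> q)\<^sup>2 * Yu i q) p
     + ((XH \<alpha> p)\<^sup>2 + (YH \<alpha> p)\<^sup>2 + (XH \<beta> p)\<^sup>2 + (YH \<beta> p)\<^sup>2) * energy p
     + 2 * (\<Sum>i\<in>UNIV. (\<beta> p * XH \<alpha> p - \<alpha> p * XH \<beta> p) * (Xu i p * XH (Yu i) p - Yu i p * XH (Xu i) p)
                      + (\<beta> p * YH \<alpha> p - \<alpha> p * YH \<beta> p) * (Xu i p * YH (Yu i) p - Yu i p * YH (Xu i) p))"
proof -
  have C: "Ck 1 (\<lambda>q. \<alpha> q * Xu i q)" "Ck 1 (\<lambda>q. \<beta> q * Xu i q)" "Ck 1 (\<lambda>q. \<alpha> q * Yu i q)" "Ck 1 (\<lambda>q. \<beta> q * Yu i q)" for i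
    by (intro Ck1_mult \<alpha> \<beta> Xu_C1 Yu_C1)+
  let ?X = "\<lambda>\<alpha> \<beta> i. XH \<alpha> p * (Xu i p * XH (\<lambda>q. \<beta> q * Yu i q) p - (\<beta> p * Yu i p) * XH (Xu i) p)
                + YH \<alpha> p * (Xu i p * YH (\<lambda>q. \<beta> q * Yu i q) p - (\<beta> p * Yu i p) * YH (Xu i) p)"
  have 1: "qform (\<lambda>i q. \<alpha> q * Xu i q) (\<lambda>i q. \<beta> q * Yu i q) p = qform Xu (\<lambda>i q. \<alpha> q * (\<beta> q * Yu i q)) p + (\<Sum>i\<in>UNIV. ?X \<alpha> \<beta> i)"
    by (intro qform_mult_left \<alpha> Xu_C1 C)
  have "qform (\<lambda>i q. \<alpha> q * Yu i q) (\<lambda>i q. \<beta> q * Xu i q) p = qform (\<lambda>i q. \<beta> q * Xu i q) (\<lambda>i q. \<alpha> q * Yu i q) p"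
    by (rule qform_sym)
  also have "\<dots> = qform Xu (\<lambda>i q. \<beta> q * (\<alpha> q * Yu i q)) p + (\<Sum>i\<in>UNIV. ?X \<beta> \<alpha> i)"
    by (intro qform_mult_left \<beta> Xu_C1 C)
  also have "(\<lambda>i q. \<beta> q * (\<alpha> q * Yu i q)) = (\<lambda>i q. \<alpha> q * (\<beta> q * Yu i q))" by (simp add: mult_ac)
  finally have 2: "qform (\<lambda>i q. \<alpha> q * Yu i q) (\<lambda>i q. \<beta> q * Xu i q) p = qform Xu (\<lambda>i q. \<alpha> q * (\<beta> q * Yu i q)) p + (\<Sum>i\<in>UNIV. ?X \<beta> \<alpha> i)" .
  \<comment> \<open>The terms
    \<open>qform Xu (\<lambda>i q. \<alpha> q * (\<beta> q * Yu i q))\<close> in facts 1 and 2 agree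
    and enter with opposite signs. What remains is antisymmetric in \<alpha> and \<beta>, hence a
    multiple of the derivative of the rotation angle.\<close>
  have 3: "(\<Sum>i\<in>UNIV. ?X \<alpha> \<beta> i) - (\<Sum>i\<in>UNIV. ?X \<beta> \<alpha> i) =
     (\<Sum>i\<in>UNIV. (\<beta> p * XH \<alpha> p - \<alpha> p * XH \<beta> p) * (Xu i p * XH (Yu i) p - Yu i p * XH (Xu i) p)
                      + (\<beta> p * YH \<alpha> p - \<alpha> p * YH \<beta> p) * (Xu i p * YH (Yu i) p - Yu i p * YH (Xu i) p))"
    unfolding sum_subtractf[symmetric] using \<alpha> \<beta> Yu_C1
    by (intro sum.cong refl) (simp add: XH_mult YH_mult algebra_simps del: One_nat_def Ck.simps)
  have 4: "qform (\<lambda>i q. \<alpha> q * Xu i q) (\<lambda>i q. \<alpha> q * Xu i q) p + qform (\<lambda>i q. \<beta> q * Yu i q) (\<lambda>i q. \<beta> q * Yu i q) p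
     + qform (\<lambda>i q. \<alpha> q * Yu i q) (\<lambda>i q. \<alpha> q * Yu i q) p + qform (\<lambda>i q. \<beta> q * Xu i q) (\<lambda>i q. \<beta> q * Xu i q) p
   = qform Xu (\<lambda>i q. (\<alpha> q)\<^sup>2 * Xu i q) p + qform Xu (\<lambda>i q. (\<beta> q)\<^sup>2 * Xu i q) p
     + qform Yu (\<lambda>i q. (\<alpha> q)\<^sup>2 * Yu i q) p + qform Yu (\<lambda>i q. (\<beta> q)\<^sup>2 * Yu i q) p
     + ((XH \<alpha> p)\<^sup>2 + (YH \<alpha> p)\<^sup>2 + (XH \<beta> p)\<^sup>2 + (YH \<beta> p)\<^sup>2) * energy p"
    unfolding qform_mult_diag[OF \<alpha> Xu_C1] qform_mult_diag[OF \<alpha> Yu_C1] qform_mult_diag[OF \<beta> Xu_C1] qform_mult_diag[OF \<beta> Yu_C1]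
      energy_def sum.distrib by (simp add: algebra_simps)
  show ?thesis
    unfolding qform_quadratic[OF C(1) C(4)] qform_quadratic[OF C(3) C(2)] 3[symmetric] using 4 1 2 by simp
qed

end

context stable_solution_growth
begin

lemma Xu_z_invariant: "Xu i (p + t *\<^sub>R axis 3 1) = Xu i p" and Yu_z_invariant: "Yu i (p + t *\<^sub>R axis 3 1) = Yu i p"
  by (intro ZH_zero_imp_z_invariant Xu_C1 Yu_C1 ZH_grad_zero)+

lemma energy_z_invariant: "energy (p + t *\<^sub>R axis 3 1) = energy p"
  by (simp add: energy_def Xu_z_invariant Yu_z_invariant)

definition slope :: "'m \<Rightarrow> real" where "slope i = ZH (\<lambda>q. u q $ i) 0"

text \<open>X and Y annihilate Zu because Z is central. The z derivative needs another argument, as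
  Zu is only C1 and the bracket cannot be applied to it: Zu is the commutator expression in
  \<open>Xu\<close> and \<open>Yu\<close>, both of which are invariant in z.\<close>

lemma ZH_eq_slope: "ZH (\<lambda>q. u q $ i) p = slope i"
proof -
  let ?f = "\<lambda>q. u q $ i"
  have Z1: "Ck 1 (ZH ?f)" by (rule Ck1_ZH[OF u_C2])
  have eq: "ZH ?f p = pd 1 (Yu i) p - pd 2 (Xu i) p" for p
    using HH_commutator(1)[OF u_C2, of i p] ZH_grad_zero[of i p]
    by (simp add: XH_def[of "YH _"] YH_def[of "XH _"] ZH_def[of "XH _"] ZH_def[of "YH _"])
  have "ZH ?f (p + t *\<^sub>R axis 3 1) = ZH ?f p" for p t
    unfolding eq using pd_z_invariant[of "Xu i", OF Xu_z_invariant] pd_z_invariant[of "Yu i", OF Yu_z_invariant] by simp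
  then have 3: "pd 3 (ZH ?f) p = 0" for p by (simp add: pd_def)
  have "XH (ZH ?f) p = 0" "YH (ZH ?f) p = 0" for p
    using HH_commutator(2,3)[OF u_C2, of i p] ZH_grad_zero[of i p] by simp_all
  then have "pd 1 (ZH ?f) p = 0" "pd 2 (ZH ?f) p = 0" for p
    using 3 by (simp_all add: XH_def YH_def)
  with 3 have "pd k (ZH ?f) p = 0" for k p using exhaust_3[of k] by auto
  from pd_zero_imp_const[OF Z1 this] show ?thesis unfolding slope_def .
qed

text \<open>The combination x Yu - y Xu is the rotational derivative of u plus (x^2 + y^2)/2 times
  Zu. The first part integrates to zero against the rotationally invariant \<open>w\<close>, and Zu
  is constant.\<close>

lemma integral_rotation_slope:
  assumes R: "R > 0"
  defines "w \<equiv> \<lambda>p. cutoff R p * cutoff R p"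
  shows "(LINT p|lborel. w p * (p $ 1 * Yu i p - p $ 2 * Xu i p)) = slope i / 2 * (LINT p|lborel. w p * rsq p)"
proof -
  have w: "Cc1 w" unfolding w_def using R by (intro Cc1_mult1 Cc1_cutoff Ck1_cutoff)
  let ?f = "\<lambda>q. u q $ i"
  have "w p * (p $ 1 * Yu i p - p $ 2 * Xu i p) = w p * (p $ 1 * pd 2 ?f p - p $ 2 * pd 1 ?f p) + slope i / 2 * (w p * rsq p)" for p
    by (simp add: XH_def YH_def ZH_eq_slope[unfolded ZH_def] power2_eq_square algebra_simps)
  then have "(LINT p|lborel. w p * (p $ 1 * Yu i p - p $ 2 * Xu i p)) =
     (LINT p|lborel. w p * (p $ 1 * pd 2 ?f p - p $ 2 * pd 1 ?f p) + slope i / 2 * (w p * rsq p))" by simp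
  also have "\<dots> = (LINT p|lborel. w p * (p $ 1 * pd 2 ?f p - p $ 2 * pd 1 ?f p)) + (LINT p|lborel. slope i / 2 * (w p * rsq p))"
    by (intro Bochner_Integration.integral_add integrable_mult_right Cc0_integrable Cc0_mult1 Cc1_Cc0 w continuous_intros
        Ck1_continuous_pd u_C1)
  also have "(LINT p|lborel. w p * (p $ 1 * pd 2 ?f p - p $ 2 * pd 1 ?f p)) = 0"
    by (rule integral_rotation_zero[OF u_C1 w]) (simp only: w_def cutoff_sq_rotation[OF R])
  finally show ?thesis by simp
qed

text \<open>Lagrange's identity bounds both factors, so each yields one power of |\<nabla>u| and one
  of the radius. The constant 32 is the square root of 1024 = 4 * 256, where 4 comes from
  differentiating the square of the cutoff.\<close>

lemma rotation_boundary_term_le: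
  assumes R: "R > 0"
  defines "w \<equiv> \<lambda>p. cutoff R p * cutoff R p"
  shows "\<bar>(p $ 1 * Yu i p - p $ 2 * Xu i p) * (Xu i p * YH w p - Yu i p * XH w p)\<bar>
     \<le> 32 / R\<^sup>2 * (indicator (ballH (2 * R)) p * (rsq p * ((Xu i p)\<^sup>2 + (Yu i p)\<^sup>2)))"
proof -
  let ?e = "(Xu i p)\<^sup>2 + (Yu i p)\<^sup>2" and ?I = "indicator (ballH (2 * R)) p :: real"
  have lagrange: "(x * y' - y * x')\<^sup>2 \<le> (x\<^sup>2 + y\<^sup>2) * (x'\<^sup>2 + y'\<^sup>2)" for x y x' y' :: real
  proof -
    have "(x\<^sup>2 + y\<^sup>2) * (x'\<^sup>2 + y'\<^sup>2) - (x * y' - y * x')\<^sup>2 = (x * x' + y * y')\<^sup>2"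
      by (simp add: power2_eq_square algebra_simps)
    then show ?thesis using zero_le_power2[of "x * x' + y * y'"] by linarith
  qed
  have "XH w p = 2 * cutoff R p * XH (cutoff R) p" "YH w p = 2 * cutoff R p * YH (cutoff R) p"
    unfolding w_def using R by (simp_all add: XH_mult YH_mult Ck1_cutoff del: One_nat_def Ck.simps)
  then have "(XH w p)\<^sup>2 + (YH w p)\<^sup>2 = 4 * ((cutoff R p)\<^sup>2 * ((XH (cutoff R) p)\<^sup>2 + (YH (cutoff R) p)\<^sup>2))"
    by (simp add: power_mult_distrib algebra_simps)
  also have "\<dots> \<le> 4 * (?I * (256 / R ^ 4 * (?I * rsq p)))"
    using R by (intro mult_left_mono mult_mono cutoff_sq_le grad_cutoff_le) auto
  also have "\<dots> = 1024 / R ^ 4 * (?I * rsq p)" by (simp add: indicator_def)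
  finally have g: "(XH w p)\<^sup>2 + (YH w p)\<^sup>2 \<le> 1024 / R ^ 4 * (?I * rsq p)" .
  have "((p $ 1 * Yu i p - p $ 2 * Xu i p) * (Xu i p * YH w p - Yu i p * XH w p))\<^sup>2
      = (p $ 1 * Yu i p - p $ 2 * Xu i p)\<^sup>2 * (Xu i p * YH w p - Yu i p * XH w p)\<^sup>2"
    by (rule power_mult_distrib)
  also have "\<dots> \<le> (rsq p * ?e) * (?e * (1024 / R ^ 4 * (?I * rsq p)))"
    by (intro mult_mono lagrange order_trans[OF lagrange mult_left_mono[OF g]]) auto
  also have "\<dots> = (32 / R\<^sup>2 * (?I * (rsq p * ?e)))\<^sup>2"
  proof -
    have "(r * e) * (e * (1024 / R ^ 4 * (I * r))) = (32 / R\<^sup>2 * (I * (r * e)))\<^sup>2" if "I * I = I" for I r e :: real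
      by (simp add: power_mult_distrib power_divide power2_eq_square[of I] that) (simp add: power2_eq_square)
    from this[of ?I] show ?thesis by (simp add: indicator_def)
  qed
  finally have "\<bar>(p $ 1 * Yu i p - p $ 2 * Xu i p) * (Xu i p * YH w p - Yu i p * XH w p)\<bar> \<le> \<bar>32 / R\<^sup>2 * (?I * (rsq p * ?e))\<bar>"
    by (rule iffD2[OF abs_le_square_iff])
  also have "\<bar>32 / R\<^sup>2 * (?I * (rsq p * ?e))\<bar> = 32 / R\<^sup>2 * (?I * (rsq p * ?e))"
    by (rule abs_of_nonneg) simp
  finally show ?thesis .
qed

text \<open>By \<open>integral_rotation_slope\<close> the term of the current that is linear in Zu
  integrates to a square of the slope, so it has the same sign as the energy and can be kept in the
  lower bound.\<close>

lemma rotation_current_ge: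
  assumes R: "R > 0"
  defines "w \<equiv> \<lambda>p. cutoff R p * cutoff R p"
  defines "L \<equiv> \<lambda>i p. w p * (Xu i p * (p $ 1 * YH (Yu i) p - p $ 2 * XH (Yu i) p) - Yu i p * (p $ 1 * YH (Xu i) p - p $ 2 * XH (Xu i) p))"
  shows "(LINT p|lborel. w p * (energy p + (\<Sum>i\<in>UNIV. (slope i)\<^sup>2) * rsq p)) \<le>
     (\<Sum>i\<in>UNIV. LINT p|lborel. L i p) + 32 / R\<^sup>2 * moment (2 * R)"
proof -
  have w: "Cc1 w" unfolding w_def using R by (intro Cc1_mult1 Cc1_cutoff Ck1_cutoff)
  let ?T = "\<lambda>i p. p $ 1 * Yu i p - p $ 2 * Xu i p"
  let ?B = "\<lambda>i p. ?T i p * (Xu i p * YH w p - Yu i p * XH w p)"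
  let ?e = "\<lambda>i p. (Xu i p)\<^sup>2 + (Yu i p)\<^sup>2"
  note ci = continuous_intros Ck1_continuous Xu_C1 Yu_C1
  have i1: "integrable lborel (\<lambda>p. w p * ?e i p)" "integrable lborel (\<lambda>p. w p * ?T i p)" "integrable lborel (\<lambda>p. w p * rsq p)" for i
    by (intro Cc0_integrable Cc0_mult1 Cc1_Cc0 w ci)+
  have i2: "integrable lborel (?B i)" for i
    by (intro Cc0_integrable Cc0_mult2 Cc0_diff Cc0_XH Cc0_YH w ci)
  have i3: "integrable lborel (\<lambda>p. indicator (ballH (2 * R)) p * (rsq p * ?e i p))" for i
    by (intro integrable_on_ballH ci)
  have "(LINT p|lborel. w p * ?e i p) + (slope i)\<^sup>2 * (LINT p|lborel. w p * rsq p)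
      \<le> (LINT p|lborel. L i p) + 32 / R\<^sup>2 * (LINT p|lborel. indicator (ballH (2 * R)) p * (rsq p * ?e i p))" for i
  proof -
    have "(LINT p|lborel. L i p) = (LINT p|lborel. w p * ?e i p + 2 * slope i * (w p * ?T i p) - ?B i p)"
      unfolding L_def integral_rotation_current[OF u_C2 w] ZH_eq_slope
      by (intro Bochner_Integration.integral_cong) (auto simp: algebra_simps)
    also have "\<dots> = (LINT p|lborel. w p * ?e i p) + 2 * slope i * (LINT p|lborel. w p * ?T i p) - (LINT p|lborel. ?B i p)"
      using i1 i2 by (simp only: Bochner_Integration.integral_add Bochner_Integration.integral_diff Bochner_Integration.integrable_add
          integrable_mult_right integral_mult_right_zero simp_thms)
    also have "(LINT p|lborel. w p * ?T i p) = slope i / 2 * (LINT p|lborel. w p * rsq p)"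
      unfolding w_def by (rule integral_rotation_slope[OF R])
    finally have 1: "(LINT p|lborel. L i p) = (LINT p|lborel. w p * ?e i p) + (slope i)\<^sup>2 * (LINT p|lborel. w p * rsq p) - (LINT p|lborel. ?B i p)"
      by (simp add: power2_eq_square)
    have "(LINT p|lborel. ?B i p) \<le> (LINT p|lborel. 32 / R\<^sup>2 * (indicator (ballH (2 * R)) p * (rsq p * ?e i p)))"
    proof (rule integral_mono[OF i2 integrable_mult_right[OF i3]])
      show "?B i p \<le> 32 / R\<^sup>2 * (indicator (ballH (2 * R)) p * (rsq p * ?e i p))" for p
        using rotation_boundary_term_le[OF R, of p i] unfolding w_def by linarith
    qed
    with 1 show ?thesis by simp
  qed
  then have "(\<Sum>i\<in>UNIV. (LINT p|lborel. w p * ?e i p) + (slope i)\<^sup>2 * (LINT p|lborel. w p * rsq p))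
     \<le> (\<Sum>i\<in>UNIV. (LINT p|lborel. L i p) + 32 / R\<^sup>2 * (LINT p|lborel. indicator (ballH (2 * R)) p * (rsq p * ?e i p)))"
    by (rule sum_mono)
  moreover have "(\<Sum>i\<in>UNIV. (LINT p|lborel. w p * ?e i p) + (slope i)\<^sup>2 * (LINT p|lborel. w p * rsq p)) =
      (LINT p|lborel. w p * (energy p + (\<Sum>i\<in>UNIV. (slope i)\<^sup>2) * rsq p))"
  proof -
    have "w p * (energy p + (\<Sum>i\<in>UNIV. (slope i)\<^sup>2) * rsq p) = (\<Sum>i\<in>UNIV. w p * ?e i p) + (\<Sum>i\<in>UNIV. (slope i)\<^sup>2) * (w p * rsq p)" for p
      by (simp only: energy_def sum_distrib_left distrib_left mult.left_commute)
    then show ?thesis using i1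
      by (simp only: Bochner_Integration.integral_add Bochner_Integration.integral_sum Bochner_Integration.integrable_sum
          integrable_mult_right integral_mult_right_zero simp_thms sum.distrib sum_distrib_right)
  qed
  moreover have "(\<Sum>i\<in>UNIV. LINT p|lborel. indicator (ballH (2 * R)) p * (rsq p * ?e i p)) = moment (2 * R)"
    unfolding moment_def energy_def sum_distrib_left using i3
    by (simp only: Bochner_Integration.integral_sum)
  ultimately show ?thesis by (simp only: sum.distrib sum_distrib_left[symmetric])
qed

text \<open>Stability of the two rotated fields bounds the current from above, and
  \<open>rotation_current_ge\<close> bounds it from below. The constant is 257 + 32, where 257
  rounds up 256 + 1/4: the cost of the cutoff plus that of the rotation.\<close>

lemma weighted_energy_le:
  assumes R: "R > 0"
  shows "(LINT p|lborel. (cutoff R p)\<^sup>2 * (energy p + (\<Sum>i\<in>UNIV. (slope i)\<^sup>2) * rsq p)) \<le> 289 / R\<^sup>2 * moment (2 * R)"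
proof -
  \<comment> \<open>The cost of rotating is of order \<open>l\<^sup>2 * rsq p\<close> and that of
    the cutoff of order \<open>rsq p / R ^ 4\<close>; this choice balances them.\<close>
  define l where "l = 1 / R\<^sup>2"
  define \<phi> where "\<phi> = cutoff R"
  define \<alpha> where "\<alpha> p = \<phi> p * cos (l * p $ 3)" for p
  define \<beta> where "\<beta> p = \<phi> p * sin (l * p $ 3)" for p
  have \<phi>: "Cc1 \<phi>" "Ck 1 \<phi>" unfolding \<phi>_def using R by (auto intro: Cc1_cutoff Ck1_cutoff simp del: One_nat_def Ck.simps)
  have lz: "Ck 1 (\<lambda>p::real^3. l * p $ 3)" by (intro Ck1_cmult Ck1_coord)
  have C: "Ck 1 (\<lambda>p::real^3. cos (l * p $ 3))" "Ck 1 (\<lambda>p::real^3. sin (l * p $ 3))"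
    by (rule Ck1_real_comp[OF lz DERIV_cos], intro continuous_intros) (rule Ck1_real_comp[OF lz DERIV_sin], intro continuous_intros)
  have \<alpha>: "Cc1 \<alpha>" and \<beta>: "Cc1 \<beta>" unfolding \<alpha>_def[abs_def] \<beta>_def[abs_def] by (intro Cc1_mult1 \<phi> C)+
  have Xlz: "XH (\<lambda>p::real^3. l * p $ 3) p = - l * p $ 2 / 2" "YH (\<lambda>p::real^3. l * p $ 3) p = l * p $ 1 / 2" for p
    by (simp_all add: XH_cmult YH_cmult Ck1_coord XH_coord del: One_nat_def Ck.simps)
  have grad: "XH \<alpha> p = XH \<phi> p * cos (l * p $ 3) + \<phi> p * sin (l * p $ 3) * (l * p $ 2 / 2)"
    "YH \<alpha> p = YH \<phi> p * cos (l * p $ 3) - \<phi> p * sin (l * p $ 3) * (l * p $ 1 / 2)"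
    "XH \<beta> p = XH \<phi> p * sin (l * p $ 3) - \<phi> p * cos (l * p $ 3) * (l * p $ 2 / 2)"
    "YH \<beta> p = YH \<phi> p * sin (l * p $ 3) + \<phi> p * cos (l * p $ 3) * (l * p $ 1 / 2)" for p
    unfolding \<alpha>_def[abs_def] \<beta>_def[abs_def] XH_mult[OF \<phi>(2) C(1)] XH_mult[OF \<phi>(2) C(2)] YH_mult[OF \<phi>(2) C(1)] YH_mult[OF \<phi>(2) C(2)]
      XH_real_comp[OF lz DERIV_cos] XH_real_comp[OF lz DERIV_sin] Xlz
    by (simp_all add: algebra_simps)
  \<comment> \<open>Taking the cosine and sine fields together removes the terms that mix the
    gradients of the cutoff and of the angle, and makes the current free of trigonometric
    factors.\<close>
  have sq: "(XH \<alpha> p)\<^sup>2 + (YH \<alpha> p)\<^sup>2 + (XH \<beta> p)\<^sup>2 + (YH \<beta> p)\<^sup>2 = (XH \<phi> p)\<^sup>2 + (YH \<phi> p)\<^sup>2 + (\<phi> p)\<^sup>2 * (l\<^sup>2 * rsq p / 4)"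
    and cur: "\<beta> p * XH \<alpha> p - \<alpha> p * XH \<beta> p = l / 2 * (\<phi> p * \<phi> p) * p $ 2"
    "\<beta> p * YH \<alpha> p - \<alpha> p * YH \<beta> p = - (l / 2 * (\<phi> p * \<phi> p) * p $ 1)" for p
  proof -
    have 1: "(x * c + f * s * m)\<^sup>2 + (y * c - f * s * n)\<^sup>2 + (x * s - f * c * m)\<^sup>2 + (y * s + f * c * n)\<^sup>2
      = (x\<^sup>2 + y\<^sup>2 + f\<^sup>2 * (m\<^sup>2 + n\<^sup>2)) * (s\<^sup>2 + c\<^sup>2)"
      "f * s * (x * c + f * s * m) - f * c * (x * s - f * c * m) = (f * f * m) * (s\<^sup>2 + c\<^sup>2)"
      "f * s * (y * c - f * s * n) - f * c * (y * s + f * c * n) = - (f * f * n) * (s\<^sup>2 + c\<^sup>2)"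
      for x y c s f m n :: real
      by (simp_all add: power2_eq_square algebra_simps)
    show "(XH \<alpha> p)\<^sup>2 + (YH \<alpha> p)\<^sup>2 + (XH \<beta> p)\<^sup>2 + (YH \<beta> p)\<^sup>2 = (XH \<phi> p)\<^sup>2 + (YH \<phi> p)\<^sup>2 + (\<phi> p)\<^sup>2 * (l\<^sup>2 * rsq p / 4)"
      "\<beta> p * XH \<alpha> p - \<alpha> p * XH \<beta> p = l / 2 * (\<phi> p * \<phi> p) * p $ 2"
      "\<beta> p * YH \<alpha> p - \<alpha> p * YH \<beta> p = - (l / 2 * (\<phi> p * \<phi> p) * p $ 1)"
      unfolding grad \<alpha>_def \<beta>_def 1 sin_cos_squared_add
      by (simp_all add: power_mult_distrib power_divide field_simps)
  qed
  define L where "L i p = (\<phi> p * \<phi> p) * (Xu i p * (p $ 1 * YH (Yu i) p - p $ 2 * XH (Yu i) p) - Yu i p * (p $ 1 * YH (Xu i) p - p $ 2 * XH (Xu i) p))" for i p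
  let ?v = "\<lambda>i q. \<alpha> q * Xu i q + 1 * (\<beta> q * Yu i q)" and ?w = "\<lambda>i q. \<alpha> q * Yu i q + (- 1) * (\<beta> q * Xu i q)"
  have vw: "Cc1 (?v i)" "Cc1 (?w i)" for i by (intro Cc1_add Cc1_mult1 Cc1_mult2 \<alpha> \<beta> Xu_C1 Yu_C1 Ck1_const)+
  have s2: "Cc1 (\<lambda>q. (\<alpha> q)\<^sup>2 * c i q)" "Cc1 (\<lambda>q. (\<beta> q)\<^sup>2 * c i q)" if "\<And>i. Ck 1 (c i)" for c :: "'m \<Rightarrow> real^3 \<Rightarrow> real" and i
    unfolding power2_eq_square by (intro Cc1_mult1 \<alpha> \<beta> Cc1_Ck1 that)+
  have iL: "integrable lborel (L i)" for i
    unfolding L_def[abs_def] by (intro Cc0_integrable Cc0_mult1 Cc1_Cc0 \<phi> continuous_intros Ck1_continuous continuous_XH continuous_YH Xu_C1 Yu_C1)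
  let ?g = "\<lambda>p. ((XH \<phi> p)\<^sup>2 + (YH \<phi> p)\<^sup>2 + (\<phi> p)\<^sup>2 * (l\<^sup>2 * rsq p / 4)) * energy p"
  have ig: "integrable lborel ?g"
  proof (intro Cc0_integrable Cc0_mult1[OF Cc0_add[OF Cc0_add] continuous_energy])
    show "Cc0 (\<lambda>p. (XH \<phi> p)\<^sup>2)" "Cc0 (\<lambda>p. (YH \<phi> p)\<^sup>2)"
      unfolding power2_eq_square by (intro Cc0_mult1 Cc0_XH Cc0_YH \<phi> continuous_XH continuous_YH)+
    have "Cc0 (\<lambda>p. (\<phi> p)\<^sup>2)"
      unfolding power2_eq_square by (intro Cc0_mult1 Cc1_Cc0 \<phi> Ck1_continuous)
    moreover have "continuous_on UNIV (\<lambda>p::real^3. l\<^sup>2 * rsq p / 4)"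
      by (intro continuous_intros) simp
    ultimately show "Cc0 (\<lambda>p. (\<phi> p)\<^sup>2 * (l\<^sup>2 * rsq p / 4))" by (rule Cc0_mult1)
  qed
  have pt: "qform ?v ?v p + qform ?w ?w p = qform Xu (\<lambda>i q. (\<alpha> q)\<^sup>2 * Xu i q) p + qform Xu (\<lambda>i q. (\<beta> q)\<^sup>2 * Xu i q) p
     + qform Yu (\<lambda>i q. (\<alpha> q)\<^sup>2 * Yu i q) p + qform Yu (\<lambda>i q. (\<beta> q)\<^sup>2 * Yu i q) p + ?g p - l * (\<Sum>i\<in>UNIV. L i p)" for p
  proof -
    have "2 * (\<Sum>i\<in>UNIV. (\<beta> p * XH \<alpha> p - \<alpha> p * XH \<beta> p) * (Xu i p * XH (Yu i) p - Yu i p * XH (Xu i) p)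
                      + (\<beta> p * YH \<alpha> p - \<alpha> p * YH \<beta> p) * (Xu i p * YH (Yu i) p - Yu i p * YH (Xu i) p)) = - l * (\<Sum>i\<in>UNIV. L i p)"
      unfolding cur sum_distrib_left by (intro sum.cong) (auto simp: L_def field_simps)
    then show ?thesis unfolding qform_rotate[OF Cc1_Ck1[OF \<alpha>] Cc1_Ck1[OF \<beta>]] sq by simp
  qed
  note iE = Cc0_integrable[OF Cc0_qform]
  have "0 \<le> (LINT p|lborel. qform ?v ?v p) + (LINT p|lborel. qform ?w ?w p)"
    by (intro add_nonneg_nonneg qform_nonneg vw)
  also have "\<dots> = (LINT p|lborel. qform ?v ?v p + qform ?w ?w p)"
    by (intro Bochner_Integration.integral_add[symmetric] iE Cc1_Ck1 vw)
  \<comment> \<open>The four terms pairing \<open>Xu\<close> or \<open>Yu\<close> with a compactly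
    supported field drop out because both lie in the kernel. Only the cost \<open>?g\<close> and the
    term linear in \<open>l\<close> remain.\<close>
  also have "\<dots> = (LINT p|lborel. ?g p) - l * (\<Sum>i\<in>UNIV. LINT p|lborel. L i p)"
    unfolding pt using iE[OF Xu_C1 s2(1)[of Xu, OF Xu_C1]] iE[OF Xu_C1 s2(2)[of Xu, OF Xu_C1]]
      iE[OF Yu_C1 s2(1)[of Yu, OF Yu_C1]] iE[OF Yu_C1 s2(2)[of Yu, OF Yu_C1]] ig iL
    by (simp add: qform_Xu_zero[OF s2(1)[of Xu, OF Xu_C1]] qform_Xu_zero[OF s2(2)[of Xu, OF Xu_C1]]
        qform_Yu_zero[OF s2(1)[of Yu, OF Yu_C1]] qform_Yu_zero[OF s2(2)[of Yu, OF Yu_C1]] Bochner_Integration.integral_sum)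
  finally have 1: "l * (\<Sum>i\<in>UNIV. LINT p|lborel. L i p) \<le> (LINT p|lborel. ?g p)" by simp
  have "(LINT p|lborel. ?g p) \<le> (LINT p|lborel. 257 / R ^ 4 * (indicator (ballH (2 * R)) p * (rsq p * energy p)))"
  proof (rule integral_mono[OF ig integrable_mult_right[OF integrable_moment]])
    fix p :: "real^3"
    let ?I = "indicator (ballH (2 * R)) p :: real"
    have "(XH \<phi> p)\<^sup>2 + (YH \<phi> p)\<^sup>2 + (\<phi> p)\<^sup>2 * (l\<^sup>2 * rsq p / 4) \<le> 256 / R ^ 4 * (?I * rsq p) + ?I * (l\<^sup>2 * rsq p / 4)"
      unfolding \<phi>_def using R by (intro add_mono mult_right_mono grad_cutoff_le cutoff_sq_le) auto
    also have "\<dots> \<le> 257 / R ^ 4 * (?I * rsq p)"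
    proof -
      have l2: "l\<^sup>2 = 1 / R ^ 4" by (simp add: l_def power_divide)
      have "256 / c * (J * r) + J * (1 / c * r / 4) = (256 + 1 / 4) / c * (J * r)" for c J r :: real
        by (cases "c = 0") (simp_all add: field_simps)
      then have "256 / R ^ 4 * (?I * rsq p) + ?I * (l\<^sup>2 * rsq p / 4) = (256 + 1 / 4) / R ^ 4 * (?I * rsq p)"
        unfolding l2 .
      also have "\<dots> \<le> 257 / R ^ 4 * (?I * rsq p)"
        using R by (intro mult_right_mono divide_right_mono) auto
      finally show ?thesis .
    qed
    finally have "?g p \<le> 257 / R ^ 4 * (?I * rsq p) * energy p"
      by (rule mult_right_mono[OF _ energy_nonneg])
    then show "?g p \<le> 257 / R ^ 4 * (?I * (rsq p * energy p))" by (simp only: mult.assoc)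
  qed
  then have 2: "(LINT p|lborel. ?g p) \<le> 257 / R ^ 4 * moment (2 * R)" by (simp add: moment_def)
  have l: "l > 0" using R by (simp add: l_def)
  have "(\<Sum>i\<in>UNIV. LINT p|lborel. L i p) = R\<^sup>2 * (l * (\<Sum>i\<in>UNIV. LINT p|lborel. L i p))"
    using R by (simp add: l_def)
  also have "\<dots> \<le> R\<^sup>2 * (257 / R ^ 4 * moment (2 * R))"
    using 1 2 by (intro mult_left_mono) auto
  also have "\<dots> = 257 / R\<^sup>2 * moment (2 * R)"
    using R by (simp add: power2_eq_square power4_eq_xxxx)
  finally have 3: "(\<Sum>i\<in>UNIV. LINT p|lborel. L i p) \<le> 257 / R\<^sup>2 * moment (2 * R)" .
  have "(LINT p|lborel. (\<phi> p * \<phi> p) * (energy p + (\<Sum>i\<in>UNIV. (slope i)\<^sup>2) * rsq p)) \<le> (\<Sum>i\<in>UNIV. LINT p|lborel. L i p) + 32 / R\<^sup>2 * moment (2 * R)"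
    using rotation_current_ge[OF R] unfolding L_def \<phi>_def .
  also have "\<dots> \<le> 257 / R\<^sup>2 * moment (2 * R) + 32 / R\<^sup>2 * moment (2 * R)" using 3 by simp
  also have "\<dots> = 289 / R\<^sup>2 * moment (2 * R)" by (simp add: field_simps)
  finally show ?thesis by (simp add: \<phi>_def power2_eq_square)
qed

end


subsection \<open>Decay of the energy\<close>

text \<open>\<open>cutoff R\<close> after the dilation of z by R^2. In this form it increases with R
  to \<open>hcut ((p $ 3)\<^sup>2)\<close>, a cutoff to a slab of fixed height.\<close>

definition kcut :: "real \<Rightarrow> real^3 \<Rightarrow> real" where
  "kcut R p = hcut ((rsq p)\<^sup>2 / R ^ 4 + (p $ 3)\<^sup>2)"

lemma continuous_hcut: "continuous_on UNIV hcut"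
  by (rule DERIV_continuous_on[OF has_field_derivative_at_within[OF hcut_deriv]])

lemma integral_cutoff_sq:
  assumes R: "R > 0" and g: "continuous_on UNIV g"
    and inv: "\<And>p t. g (p + t *\<^sub>R axis 3 1) = g p"
  shows "(LINT p|lborel. (cutoff R p)\<^sup>2 * g p) = R\<^sup>2 * (LINT p|lborel. (kcut R p)\<^sup>2 * g p)"
proof -
  let ?T = "\<lambda>p::real^3. p + ((R\<^sup>2 - 1) * p $ 3) *\<^sub>R axis 3 1"
  have [measurable]: "(\<lambda>p. (cutoff R p)\<^sup>2 * g p) \<in> borel_measurable borel"
    by (intro borel_measurable_continuous_onI continuous_intros g Ck1_continuous Ck1_cutoff R)
  have T: "?T p $ 1 = p $ 1" "?T p $ 2 = p $ 2" "?T p $ 3 = R\<^sup>2 * p $ 3" for p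
    by (simp_all add: axis_def algebra_simps)
  have "cutoff R (?T p) = kcut R p" for p
  proof -
    have "gauge4 (?T p) / R ^ 4 = (rsq p)\<^sup>2 / R ^ 4 + (p $ 3)\<^sup>2"
      unfolding gauge4_def T using R by (simp add: add_divide_distrib power_mult_distrib)
    then show ?thesis by (simp only: cutoff_def kcut_def)
  qed
  then show ?thesis
    using lborel_integral_scale_z[of "\<lambda>p. (cutoff R p)\<^sup>2 * g p" "R\<^sup>2"] R by (simp only: inv) simp
qed

lemma kcut_nonneg: "0 \<le> kcut R p"
  by (simp add: kcut_def hcut_nonneg)

lemma kcut_mono:
  assumes "0 < R" "R \<le> S" shows "kcut R p \<le> kcut S p"
  unfolding kcut_def
  by (intro hcut_antimono add_right_mono divide_left_mono power_mono) (use assms in auto)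

lemma kcut_le: "kcut R p \<le> hcut ((p $ 3)\<^sup>2)"
  unfolding kcut_def by (intro hcut_antimono) simp

lemma Cc0_kcut_sq:
  assumes R: "R > 0" and g: "continuous_on UNIV g"
  shows "Cc0 (\<lambda>p. (kcut R p)\<^sup>2 * g p)"
proof (rule Cc0_mult1[OF _ g])
  have "continuous_on UNIV (kcut R)"
    unfolding kcut_def[abs_def] using R by (intro continuous_on_compose2[OF continuous_hcut] continuous_intros) auto
  moreover have "gauge4 p \<le> 16 * R ^ 4 + 16" if "(kcut R p)\<^sup>2 \<noteq> 0" for p
  proof -
    have "(rsq p)\<^sup>2 / R ^ 4 + (p $ 3)\<^sup>2 < 16"
      using that hcut_eq_0[of "(rsq p)\<^sup>2 / R ^ 4 + (p $ 3)\<^sup>2"] by (force simp: kcut_def)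
    moreover have "0 \<le> (rsq p)\<^sup>2 / R ^ 4" using R by simp
    ultimately have "(rsq p)\<^sup>2 / R ^ 4 \<le> 16" "(p $ 3)\<^sup>2 \<le> 16" using zero_le_power2[of "p $ 3"] by linarith+
    moreover from this(1) have "(rsq p)\<^sup>2 \<le> 16 * R ^ 4" using R by (simp add: divide_le_eq)
    ultimately show ?thesis by (simp add: gauge4_def)
  qed
  ultimately show "Cc0 (\<lambda>p. (kcut R p)\<^sup>2)"
    unfolding Cc0_def by (auto intro!: continuous_intros bounded_subset[OF bounded_gauge4[of "16 * R ^ 4 + 16"]])
qed

text \<open>On the support of \<open>kcut R\<close> the ratio \<open>rsq p / R\<^sup>2\<close> has
  square below 16. Hence the normalised weight is bounded uniformly in R, even though the slab is
  unbounded.\<close>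

lemma kcut_rsq_le:
  assumes R: "R > 0" shows "(kcut R p)\<^sup>2 * (rsq p / R\<^sup>2) \<le> 4 * (hcut ((p $ 3)\<^sup>2))\<^sup>2"
proof (cases "kcut R p = 0")
  case False
  have "(rsq p)\<^sup>2 / R ^ 4 + (p $ 3)\<^sup>2 < 16"
    using False hcut_eq_0[of "(rsq p)\<^sup>2 / R ^ 4 + (p $ 3)\<^sup>2"] by (force simp: kcut_def)
  moreover have "(rsq p / R\<^sup>2)\<^sup>2 = (rsq p)\<^sup>2 / R ^ 4" by (simp add: power_divide flip: power_mult)
  moreover have "0 \<le> (p $ 3)\<^sup>2" by simp
  ultimately have "(rsq p / R\<^sup>2)\<^sup>2 \<le> 16" by linarith
  then have "(rsq p / R\<^sup>2)\<^sup>2 \<le> 4\<^sup>2" by simp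
  then have "rsq p / R\<^sup>2 \<le> 4" by (rule power2_le_imp_le) simp
  then have "(kcut R p)\<^sup>2 * (rsq p / R\<^sup>2) \<le> (hcut ((p $ 3)\<^sup>2))\<^sup>2 * 4"
    by (intro mult_mono power_mono kcut_le kcut_nonneg) auto
  then show ?thesis by simp
qed simp

lemma kcut_tendsto: "(\<lambda>n. kcut (real (Suc n)) p) \<longlonglongrightarrow> hcut ((p $ 3)\<^sup>2)"
proof -
  have "(\<lambda>n. (rsq p)\<^sup>2 * inverse (real (Suc n)) ^ 4 + (p $ 3)\<^sup>2) \<longlonglongrightarrow> (rsq p)\<^sup>2 * 0 ^ 4 + (p $ 3)\<^sup>2"
    by (intro tendsto_intros LIMSEQ_inverse_real_of_nat)
  then have "(\<lambda>n. (rsq p)\<^sup>2 / real (Suc n) ^ 4 + (p $ 3)\<^sup>2) \<longlonglongrightarrow> (p $ 3)\<^sup>2"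
    by (simp add: divide_inverse power_inverse)
  then show ?thesis
    unfolding kcut_def by (rule continuous_on_tendsto_compose[OF continuous_hcut]) auto
qed

section \<open>Mass and tail in the slab\<close>

context stable_solution_growth
begin

definition weight :: "real^3 \<Rightarrow> real" where
  "weight p = energy p + (\<Sum>i\<in>UNIV. (slope i)\<^sup>2) * rsq p"

lemma continuous_weight: "continuous_on UNIV weight"
  unfolding weight_def[abs_def] by (intro continuous_intros continuous_energy)

lemma energy_le_weight: "energy p \<le> weight p"
  by (simp add: weight_def sum_nonneg)

lemma rsq_z_invariant: "rsq (p + t *\<^sub>R axis 3 1) = rsq p"
  by (simp add: axis_def)

lemma weight_z_invariant: "weight (p + t *\<^sub>R axis 3 1) = weight p"
  unfolding weight_def energy_z_invariant rsq_z_invariant ..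

definition mass :: "real \<Rightarrow> real" where
  "mass R = (LINT p|lborel. (kcut R p)\<^sup>2 * weight p)"

text \<open>Models the moment divided by R^4: one factor R^2 sits in the normalised weight, and the
  other is the Jacobian of the dilation of z.\<close>

definition tail :: "real \<Rightarrow> real" where
  "tail R = (LINT p|lborel. (kcut R p)\<^sup>2 * (rsq p / R\<^sup>2 * energy p))"

lemma weight_nonneg: "0 \<le> weight p"
  using energy_le_weight[of p] energy_nonneg[of p] by linarith

lemma mass_le_moment:
  assumes R: "R > 0" shows "mass R \<le> 289 / R ^ 4 * moment (2 * R)"
proof -
  have "R\<^sup>2 * mass R \<le> 289 / R\<^sup>2 * moment (2 * R)"
    using weighted_energy_le[OF R] integral_cutoff_sq[OF R continuous_weight weight_z_invariant]
    by (simp add: mass_def weight_def)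
  then have "R\<^sup>2 * mass R / R\<^sup>2 \<le> 289 / R\<^sup>2 * moment (2 * R) / R\<^sup>2"
    using R by (intro divide_right_mono) auto
  also have "289 / R\<^sup>2 * moment (2 * R) / R\<^sup>2 = 289 / R ^ 4 * moment (2 * R)"
    by (simp add: power2_eq_square power4_eq_xxxx)
  finally show ?thesis using R by simp
qed

lemma moment_le_tail:
  assumes R: "R > 0" shows "moment R \<le> R ^ 4 * tail R"
proof -
  let ?g = "\<lambda>p. rsq p / R\<^sup>2 * energy p"
  have c: "continuous_on UNIV ?g" using R by (intro continuous_intros continuous_energy) auto
  have "moment R \<le> (LINT p|lborel. R\<^sup>2 * ((cutoff R p)\<^sup>2 * ?g p))"
    unfolding moment_def
  proof (rule integral_mono[OF integrable_moment])
    show "integrable lborel (\<lambda>p. R\<^sup>2 * ((cutoff R p)\<^sup>2 * ?g p))"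
      unfolding power2_eq_square[of "cutoff R _"]
      by (intro integrable_mult_right Cc0_integrable Cc0_mult1[OF _ c] Cc0_mult1 Cc1_Cc0 Cc1_cutoff R Ck1_continuous Ck1_cutoff)
    fix p :: "real^3"
    have "indicator (ballH R) p \<le> (cutoff R p)\<^sup>2"
      using R cutoff_eq_1[of R p] by (simp add: indicator_def ballH_iff)
    then have "indicator (ballH R) p * (rsq p * energy p) \<le> (cutoff R p)\<^sup>2 * (rsq p * energy p)"
      by (intro mult_right_mono) (auto simp: energy_nonneg)
    then show "indicator (ballH R) p * (rsq p * energy p) \<le> R\<^sup>2 * ((cutoff R p)\<^sup>2 * ?g p)"
    proof -
      have "R\<^sup>2 * (c * (r / R\<^sup>2 * e)) = c * (r * e)" for c r e :: real using R by simp
      then show ?thesis using \<open>_ \<le> (cutoff R p)\<^sup>2 * (rsq p * energy p)\<close> by (simp only:)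
    qed
  qed
  also have "\<dots> = R\<^sup>2 * (R\<^sup>2 * tail R)"
  proof -
    have "?g (p + t *\<^sub>R axis 3 1) = ?g p" for p t by (simp only: energy_z_invariant rsq_z_invariant)
    from integral_cutoff_sq[OF R c this] show ?thesis by (simp only: tail_def integral_mult_right_zero)
  qed
  finally show ?thesis by (simp add: power2_eq_square power4_eq_xxxx mult.assoc)
qed

text \<open>The self-improving inequality: its right side contains the additional factor
  \<open>rsq p / (2 * R)\<^sup>2\<close>, which tends to zero at every point. The constant is 289 *
  2^4, as the moment is taken at radius 2R.\<close>

lemma mass_le_tail:
  assumes R: "R > 0" shows "mass R \<le> 4624 * tail (2 * R)"
proof -
  have "mass R \<le> 289 / R ^ 4 * ((2 * R) ^ 4 * tail (2 * R))"
    using R by (intro order_trans[OF mass_le_moment mult_left_mono[OF moment_le_tail]]) auto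
  also have "\<dots> = 4624 * tail (2 * R)" using R by (simp add: power_mult_distrib)
  finally show ?thesis .
qed

lemma mass_mono:
  assumes "0 < R" "R \<le> S" shows "mass R \<le> mass S"
  unfolding mass_def
  by (intro integral_mono Cc0_integrable Cc0_kcut_sq continuous_weight mult_right_mono power_mono
      kcut_mono kcut_nonneg weight_nonneg) (use assms in simp_all)

lemma mass_bounded: "\<exists>B. \<forall>R\<ge>1. mass R \<le> B"
proof -
  obtain C where C: "C \<ge> 0" "\<And>R. R > 1 \<Longrightarrow> moment R \<le> C * R ^ 4" using moment_le by blast
  have "mass R \<le> 4624 * C" if R: "R \<ge> 1" for R
  proof -
    have "mass R \<le> 289 / R ^ 4 * (C * (2 * R) ^ 4)"
      using R by (intro order_trans[OF mass_le_moment mult_left_mono[OF C(2)]]) auto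
    also have "\<dots> = 4624 * C" using R by (simp add: power_mult_distrib)
    finally show ?thesis .
  qed
  then show ?thesis by blast
qed

text \<open>Monotone convergence in the radius, the growth hypothesis entering through
  \<open>mass_bounded\<close>. The result supplies the majorant for
  \<open>tail_tendsto_0\<close>.\<close>

lemma integrable_slab: "integrable lborel (\<lambda>p. (hcut ((p $ 3)\<^sup>2))\<^sup>2 * weight p)"
proof -
  let ?f = "\<lambda>n p. (kcut (real (Suc n)) p)\<^sup>2 * weight p"
  obtain B where B: "\<forall>R\<ge>1. mass R \<le> B" using mass_bounded ..
  have mono: "incseq (\<lambda>n. mass (real (Suc n)))" by (intro incseq_SucI mass_mono) auto
  have "\<forall>n. mass (real (Suc n)) \<le> B" using B by simp
  then obtain L where L: "(\<lambda>n. mass (real (Suc n))) \<longlonglongrightarrow> L"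
    using incseq_convergent[OF mono] by blast
  show ?thesis
  proof (rule integrable_monotone_convergence)
    show "integrable lborel (?f n)" for n by (intro Cc0_integrable Cc0_kcut_sq continuous_weight) simp
    show "AE p in lborel. mono (\<lambda>n. ?f n p)"
      by (intro AE_I2 monoI mult_right_mono power_mono kcut_mono kcut_nonneg weight_nonneg) auto
    show "AE p in lborel. (\<lambda>n. ?f n p) \<longlonglongrightarrow> (hcut ((p $ 3)\<^sup>2))\<^sup>2 * weight p"
      by (intro AE_I2 tendsto_intros kcut_tendsto)
    show "(\<lambda>n. LINT p|lborel. ?f n p) \<longlonglongrightarrow> L" using L by (simp add: mass_def)
    show "(\<lambda>p. (hcut ((p $ 3)\<^sup>2))\<^sup>2 * weight p) \<in> borel_measurable lborel"
      unfolding measurable_lborel2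
      by (intro borel_measurable_continuous_onI continuous_intros continuous_weight continuous_on_compose2[OF continuous_hcut]) auto
  qed
qed

text \<open>By \<open>kcut_rsq_le\<close> a fixed multiple of the slab density dominates, while the
  weight decays pointwise like 1/R^2. The radii are doubled to fit the scale in
  \<open>mass_le_tail\<close>.\<close>

lemma tail_tendsto_0: "(\<lambda>n. tail (2 * real (Suc n))) \<longlonglongrightarrow> 0"
proof -
  let ?R = "\<lambda>n. 2 * real (Suc n)"
  let ?f = "\<lambda>n p. (kcut (?R n) p)\<^sup>2 * (rsq p / (?R n)\<^sup>2 * energy p)"
  have ci: "continuous_on UNIV (\<lambda>p. rsq p / (?R n)\<^sup>2 * energy p)" for n
    by (intro continuous_intros continuous_energy) auto
  have "(\<lambda>n. LINT p|lborel. ?f n p) \<longlonglongrightarrow> (LINT p|(lborel :: (real^3) measure). 0)"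
  proof (rule integral_dominated_convergence)
    show "integrable lborel (\<lambda>p. 4 * ((hcut ((p $ 3)\<^sup>2))\<^sup>2 * weight p))"
      by (intro integrable_mult_right integrable_slab)
    show "?f n \<in> borel_measurable lborel" for n
      by (rule borel_measurable_integrable[OF Cc0_integrable[OF Cc0_kcut_sq[OF _ ci]]]) simp
    show "AE p in lborel. norm (?f n p) \<le> 4 * ((hcut ((p $ 3)\<^sup>2))\<^sup>2 * weight p)" for n
    proof (rule AE_I2)
      fix p :: "real^3"
      have "?f n p = ((kcut (?R n) p)\<^sup>2 * (rsq p / (?R n)\<^sup>2)) * energy p" by simp
      also have "\<dots> \<le> (4 * (hcut ((p $ 3)\<^sup>2))\<^sup>2) * weight p"
        by (intro mult_mono kcut_rsq_le energy_le_weight energy_nonneg) auto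
      finally have "?f n p \<le> 4 * ((hcut ((p $ 3)\<^sup>2))\<^sup>2 * weight p)" by (simp only: mult.assoc)
      moreover have "0 \<le> ?f n p" by (intro mult_nonneg_nonneg divide_nonneg_nonneg energy_nonneg) auto
      ultimately show "norm (?f n p) \<le> 4 * ((hcut ((p $ 3)\<^sup>2))\<^sup>2 * weight p)" by (simp only: real_norm_def abs_of_nonneg)
    qed
    show "AE p in lborel. (\<lambda>n. ?f n p) \<longlonglongrightarrow> 0"
    proof (rule AE_I2)
      fix p :: "real^3"
      have "r / (2 * s)\<^sup>2 * e = inverse s ^ 2 * (r / 4 * e)" for r s e :: real
        by (cases "s = 0") (simp_all add: power_mult_distrib field_simps)
      then have eq: "(\<lambda>n. rsq p / (?R n)\<^sup>2 * energy p) = (\<lambda>n. inverse (real (Suc n)) ^ 2 * (rsq p / 4 * energy p))"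
        by (intro ext)
      have "(\<lambda>n. inverse (real (Suc n)) ^ 2 * (rsq p / 4 * energy p)) \<longlonglongrightarrow> 0 ^ 2 * (rsq p / 4 * energy p)"
        by (intro tendsto_intros LIMSEQ_inverse_real_of_nat)
      then have lim: "(\<lambda>n. rsq p / (?R n)\<^sup>2 * energy p) \<longlonglongrightarrow> 0"
        unfolding eq by simp
      show "(\<lambda>n. ?f n p) \<longlonglongrightarrow> 0"
      proof (rule tendsto_0_le[OF lim, of _ 1], rule always_eventually, rule allI)
        fix n
        have "(kcut (?R n) p)\<^sup>2 \<le> 1" using kcut_nonneg[of "?R n" p] hcut_le_1 by (simp add: kcut_def power_le_one)
        then have "(kcut (?R n) p)\<^sup>2 * \<bar>rsq p / (?R n)\<^sup>2 * energy p\<bar> \<le> 1 * \<bar>rsq p / (?R n)\<^sup>2 * energy p\<bar>"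
          by (rule mult_right_mono) simp
        then show "norm (?f n p) \<le> norm (rsq p / (?R n)\<^sup>2 * energy p) * 1"
          by (simp only: real_norm_def abs_mult abs_power2 mult_1 mult_1_right)
      qed
    qed
  qed auto
  then show ?thesis by (simp add: tail_def)
qed

text \<open>The mass is nondecreasing in the radius, yet at large radii it is at most a multiple of
  a tail tending to zero. So it vanishes at every radius, and undoing the dilation of z gives a
  nonnegative continuous function with zero integral.\<close>

lemma energy_zero: "energy p = 0"
proof -
  obtain R where R: "R > 0" "gauge4 p \<le> R ^ 4"
    using gauge4_le_norm[of p] by (intro that[of "1 + norm p"]) (auto simp: add_pos_nonneg)
  have "mass R \<le> 0"
  proof (rule LIMSEQ_le_const)
    show "(\<lambda>n. 4624 * tail (2 * real (Suc n))) \<longlonglongrightarrow> 0"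
      using tendsto_mult_left[OF tail_tendsto_0, of 4624] by simp
    obtain N :: nat where "R \<le> real N" using real_arch_simple by blast
    then have "mass R \<le> 4624 * tail (2 * real (Suc n))" if "n \<ge> N" for n
      using that R(1) by (intro order_trans[OF mass_mono mass_le_tail]) auto
    then show "\<exists>N. \<forall>n\<ge>N. mass R \<le> 4624 * tail (2 * real (Suc n))" by blast
  qed
  moreover have "0 \<le> mass R"
    unfolding mass_def by (intro integral_nonneg_AE AE_I2) (simp add: weight_nonneg)
  ultimately have "mass R = 0" by simp
  then have "(LINT p|lborel. (cutoff R p)\<^sup>2 * weight p) = 0"
    using integral_cutoff_sq[OF R(1) continuous_weight weight_z_invariant] by (simp add: mass_def)
  moreover have "Cc0 (\<lambda>p. (cutoff R p)\<^sup>2 * weight p)"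
    unfolding power2_eq_square using R(1)
    by (intro Cc0_mult1[OF _ continuous_weight] Cc0_mult1 Cc1_Cc0 Cc1_cutoff Ck1_continuous Ck1_cutoff)
  ultimately have "(cutoff R p)\<^sup>2 * weight p = 0"
    by (intro Cc0_integral_nonneg_eq_0[where f="\<lambda>p. (cutoff R p)\<^sup>2 * weight p"]) (auto simp: weight_nonneg)
  then have "weight p = 0" using cutoff_eq_1[OF R] by simp
  then show ?thesis using energy_le_weight[of p] energy_nonneg[of p] by linarith
qed

lemma gradH_zero: "gradH (\<lambda>q. u q $ i) p = 0"
proof -
  have "(Xu i p)\<^sup>2 + (Yu i p)\<^sup>2 = 0"
    using energy_zero[of p] unfolding energy_def by (subst (asm) sum_nonneg_eq_0_iff) auto
  then show ?thesis
    by (simp add: gradH_def vec_eq_iff forall_2 sum_power2_eq_zero_iff)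
qed

end

theorem theorem4p3:
  fixes H :: "'m::finite \<Rightarrow> real^'m \<Rightarrow> real"
    and u :: "real^3 \<Rightarrow> real^'m"
  assumes H_C1: "\<And>i. Ck 1 (H i)"
    and u_C2: "\<And>i. Ck 2 (\<lambda>p. u p $ i)"
    and solution: "solutionH H u"
    and symmetric: "symmetric_system H u"
    and stable: "stableH H u"
    and sign: "\<And>i p. ZH (YH (\<lambda>q. u q $ i)) p * XH (\<lambda>q. u q $ i) p
                    - ZH (XH (\<lambda>q. u q $ i)) p * YH (\<lambda>q. u q $ i) p \<le> 0"
    and growth: "\<exists>C. \<forall>R>1. \<forall>i.
      (LINT p:ballH R|lborel. ((p $ 1)\<^sup>2 + (p $ 2)\<^sup>2) * (norm (gradH (\<lambda>q. u q $ i) p))\<^sup>2)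
        \<le> C * R ^ 4"
  shows "\<forall>i p. gradH (\<lambda>q. u q $ i) p \<noteq> 0 \<longrightarrow>
           curvA (\<lambda>q. u q $ i) p = 0 \<and> curvB (\<lambda>q. u q $ i) p = 0"
proof -
  interpret stable_solution H u
    using H_C1 u_C2 solution symmetric stable by unfold_locales
  interpret stable_solution_growth H u
    using sign growth by unfold_locales
  show ?thesis by (simp add: gradH_zero)
qed

end
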